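(* Let $G$ be a group acting isometrically on two metrically complete leafless trees $T_1,T_2$. Assume that there is a coarse equivalence $f:T_1\to T_2$, that $T_1$ has at least $3$ ends and that the induced map $\partial f:\partial T_1\to\partial T_2$ between the ends of the trees is $G$-equivariant. If the $G$-action on $\partial T_1$ is $2$-transitive, then (after rescaling the metric on $T_2$ by a positive constant) there is a $G$-equivariant isometry $\bar f:T_1\to T_2$ with $\partial f=\partial\bar f$. If $T_1$ has at least two branch points, then $\bar f$ is unique and has finite distance from $f$.
   Context: Geodesics are isometric embeddings of closed intervals $J\subseteq\mathbb R$. A tree ($\mathbb R$-tree) is a metric space $T$ such that (T1) any two points $x,y$ are joined by a unique geodesic $\gamma:[0,d(x,y)]\to T$, with image $[x,y]$, and (T2) if $0<r<s$ and $\gamma:[0,s]\to T$ is an injection whose restrictions to $[0,r]$ and $[r,s]$ are geodesics, then $\gamma$ is a geodesic. A tree is leafless if every geodesic $J\to T$ extends to a geodesic $\mathbb R\to T$. An apartment in $T$ is an isometric image of $\mathbb R$. A ray is an isometric image of $[0,\infty)$; two rays are equivalent if their intersection is a ray; the equivalence classes are the ends of $T$, and $\partial T$ is the set of ends. For distinct ends $u,v$ there is a unique apartment $(u,v)$ with ends $u,v$. A point $z$ is a branch point if there are points $u,v,w$ distinct from $z$ with $[u,v]\cap[v,w]\cap[w,u]=\{z\}$. A map $f:X\to Y$ of metric spaces is controlled if there is a monotonic function $\rho:\mathbb R_{\ge0}\to\mathbb R_{\ge0}$ with $d(f(x),f(y))\le\rho(d(x,y))$ for all $x,y$; it is coarse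 if moreover preimages of bounded sets are bounded. Two maps $f,g:X\to Y$ have finite distance if $\{d(f(x),g(x)):x\in X\}$ is bounded. A coarse equivalence is a coarse map $f:X\to Y$ for which there is a coarse map $g:Y\to X$ such that $g\circ f$ and $f\circ g$ have finite distance from the identity maps. An isometry is a surjective distance-preserving map. For a coarse equivalence $f:T_1\to T_2$ of leafless trees, each apartment $A\subseteq T_1$ determines a unique apartment $f_*A\subseteq T_2$ at finite Hausdorff distance from $f(A)$. If $T_1$ has at least $3$ ends, there is a unique bijection $\partial f:\partial T_1\to\partial T_2$ with $f_*(u,v)=(\partial f(u),\partial f(v))$ for all distinct $u,v\in\partial T_1$; this is the induced map. The action on $\partial T_1$ is $2$-transitive if for all ends $u\ne v$ and $u'\neq v'$ there is $g\in G$ with $g(u)=u'$, $g(v)=v'$. *)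

theory Defs
  imports "HOL-Analysis.Analysis" "HOL-Algebra.Group_Action"
begin

section \<open>Geodesics and trees\<close>

definition geodesic :: "real set \<Rightarrow> (real \<Rightarrow> 'a::metric_space) \<Rightarrow> bool" where
  "geodesic J \<gamma> \<longleftrightarrow> J \<noteq> {} \<and> is_interval J \<and> closed J \<and>
     (\<forall>s\<in>J. \<forall>t\<in>J. dist (\<gamma> s) (\<gamma> t) = \<bar>s - t\<bar>)"

definition joins :: "(real \<Rightarrow> 'a::metric_space) \<Rightarrow> 'a \<Rightarrow> 'a \<Rightarrow> bool" where
  "joins \<gamma> x y \<longleftrightarrow> geodesic {0..dist x y} \<gamma> \<and> \<gamma> 0 = x \<and> \<gamma> (dist x y) = y"

text \<open>Only the values of a geodesic on its interval matter, so uniqueness in the first tree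
  axiom is agreement on that interval.\<close>

definition is_tree :: "'a::metric_space itself \<Rightarrow> bool" where
  "is_tree _ \<longleftrightarrow>
     (\<forall>x y::'a. \<exists>\<gamma>. joins \<gamma> x y \<and>
        (\<forall>\<gamma>'. joins \<gamma>' x y \<longrightarrow> (\<forall>t\<in>{0..dist x y}. \<gamma>' t = \<gamma> t))) \<and>
     (\<forall>r s. \<forall>\<gamma> :: real \<Rightarrow> 'a.
        0 < r \<and> r < s \<and> inj_on \<gamma> {0..s} \<and> geodesic {0..r} \<gamma> \<and> geodesic {r..s} \<gamma>
        \<longrightarrow> geodesic {0..s} \<gamma>)"

text \<open>In a tree this is the image of the unique geodesic from \<open>x\<close> to \<open>y\<close>.\<close>

definition segment :: "'a::metric_space \<Rightarrow> 'a \<Rightarrow> 'a set" where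
  "segment x y = {\<gamma> t | \<gamma> t. joins \<gamma> x y \<and> t \<in> {0..dist x y}}"

definition leafless_tree :: "'a::metric_space itself \<Rightarrow> bool" where
  "leafless_tree T \<longleftrightarrow> is_tree T \<and>
     (\<forall>J. \<forall>\<gamma> :: real \<Rightarrow> 'a. geodesic J \<gamma> \<longrightarrow>
        (\<exists>\<delta>. geodesic UNIV \<delta> \<and> (\<forall>t\<in>J. \<delta> t = \<gamma> t)))"

definition branch_point :: "'a::metric_space \<Rightarrow> bool" where
  "branch_point z \<longleftrightarrow> (\<exists>u v w. u \<noteq> z \<and> v \<noteq> z \<and> w \<noteq> z \<and>
     segment u v \<inter> segment v w \<inter> segment w u = {z})"


section \<open>Apartments and ends\<close>

definition apartment :: "'a::metric_space set \<Rightarrow> bool" where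
  "apartment A \<longleftrightarrow> (\<exists>\<gamma>. geodesic UNIV \<gamma> \<and> A = range \<gamma>)"

definition is_ray :: "'a::metric_space set \<Rightarrow> bool" where
  "is_ray R \<longleftrightarrow> (\<exists>\<gamma>. geodesic {0..} \<gamma> \<and> R = \<gamma> ` {0..})"

definition ray_equiv :: "('a::metric_space set \<times> 'a set) set" where
  "ray_equiv = {(R, R'). is_ray R \<and> is_ray R' \<and> is_ray (R \<inter> R')}"

definition ends :: "'a::metric_space set set set" where
  "ends = {R. is_ray R} // ray_equiv"

definition ends_of :: "'a::metric_space set \<Rightarrow> 'a set set set" where
  "ends_of A = {e \<in> ends. \<exists>R\<in>e. R \<subseteq> A}"

definition apartment_between :: "'a::metric_space set set \<Rightarrow> 'a set set \<Rightarrow> 'a set" where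
  "apartment_between u v = (THE A. apartment A \<and> ends_of A = {u, v})"


section \<open>Coarse equivalences\<close>

definition controlled :: "('a::metric_space \<Rightarrow> 'b::metric_space) \<Rightarrow> bool" where
  "controlled f \<longleftrightarrow> (\<exists>\<rho> :: real \<Rightarrow> real. mono_on {0..} \<rho> \<and> (\<forall>t\<ge>0. \<rho> t \<ge> 0) \<and>
     (\<forall>x y. dist (f x) (f y) \<le> \<rho> (dist x y)))"

definition coarse :: "('a::metric_space \<Rightarrow> 'b::metric_space) \<Rightarrow> bool" where
  "coarse f \<longleftrightarrow> controlled f \<and> (\<forall>B. bounded B \<longrightarrow> bounded (f -` B))"

definition finite_distance :: "('a \<Rightarrow> 'b::metric_space) \<Rightarrow> ('a \<Rightarrow> 'b) \<Rightarrow> bool" where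
  "finite_distance f g \<longleftrightarrow> bounded (range (\<lambda>x. dist (f x) (g x)))"

definition coarse_equivalence :: "('a::metric_space \<Rightarrow> 'b::metric_space) \<Rightarrow> bool" where
  "coarse_equivalence f \<longleftrightarrow> coarse f \<and>
     (\<exists>g. coarse g \<and> finite_distance (g \<circ> f) id \<and> finite_distance (f \<circ> g) id)"

definition finite_hausdorff_distance :: "'a::metric_space set \<Rightarrow> 'a set \<Rightarrow> bool" where
  "finite_hausdorff_distance A B \<longleftrightarrow>
     (\<exists>r. (\<forall>a\<in>A. \<exists>b\<in>B. dist a b \<le> r) \<and> (\<forall>b\<in>B. \<exists>a\<in>A. dist a b \<le> r))"

definition apartment_image ::
    "('a::metric_space \<Rightarrow> 'b::metric_space) \<Rightarrow> 'a set \<Rightarrow> 'b set" where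
  "apartment_image f A = (THE B. apartment B \<and> finite_hausdorff_distance B (f ` A))"

text \<open>The induced map of a coarse equivalence of leafless trees, the first having at least three
  ends. Extensionality (the value is \<open>undefined\<close> off \<open>ends\<close>) makes the map, whose
  domain is \<open>ends\<close>, unique as a function on the whole type.\<close>

definition induced_map ::
    "('a::metric_space \<Rightarrow> 'b::metric_space) \<Rightarrow> 'a set set \<Rightarrow> 'b set set" where
  "induced_map f = (THE \<beta>. \<beta> \<in> extensional ends \<and> bij_betw \<beta> ends ends \<and>
     (\<forall>u\<in>ends. \<forall>v\<in>ends. u \<noteq> v \<longrightarrow>
        apartment_image f (apartment_between u v) = apartment_between (\<beta> u) (\<beta> v)))"


section \<open>Group actions\<close>

definition isometric_action ::
    "('g, 'm) monoid_scheme \<Rightarrow> ('g \<Rightarrow> 'a::metric_space \<Rightarrow> 'a) \<Rightarrow> bool" where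
  "isometric_action G \<phi> \<longleftrightarrow> group_action G UNIV \<phi> \<and>
     (\<forall>g\<in>carrier G. \<forall>x y. dist (\<phi> g x) (\<phi> g y) = dist x y)"

definition end_action :: "('g \<Rightarrow> 'a \<Rightarrow> 'a) \<Rightarrow> 'g \<Rightarrow> 'a set set \<Rightarrow> 'a set set" where
  "end_action \<phi> g u = (\<lambda>R. \<phi> g ` R) ` u"

definition equivariant_on :: "'x set \<Rightarrow> ('g, 'm) monoid_scheme \<Rightarrow>
    ('g \<Rightarrow> 'x \<Rightarrow> 'x) \<Rightarrow> ('g \<Rightarrow> 'y \<Rightarrow> 'y) \<Rightarrow> ('x \<Rightarrow> 'y) \<Rightarrow> bool" where
  "equivariant_on X G \<alpha> \<beta> h \<longleftrightarrow> (\<forall>g\<in>carrier G. \<forall>x\<in>X. h (\<alpha> g x) = \<beta> g (h x))"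

definition two_transitive_on ::
    "'x set \<Rightarrow> ('g, 'm) monoid_scheme \<Rightarrow> ('g \<Rightarrow> 'x \<Rightarrow> 'x) \<Rightarrow> bool" where
  "two_transitive_on X G \<alpha> \<longleftrightarrow>
     (\<forall>u\<in>X. \<forall>v\<in>X. \<forall>u'\<in>X. \<forall>v'\<in>X. u \<noteq> v \<and> u' \<noteq> v' \<longrightarrow>
        (\<exists>g\<in>carrier G. \<alpha> g u = u' \<and> \<alpha> g v = v'))"

text \<open>An isometry with respect to explicitly given metrics, so that the metric of the codomain
  can be rescaled. Rescaling by a positive constant changes neither the sets that are rays or
  apartments nor boundedness, hence neither \<open>ends\<close> nor \<open>induced_map\<close>.\<close>

definition isometry_wrt ::
    "('a \<Rightarrow> 'a \<Rightarrow> real) \<Rightarrow> ('b \<Rightarrow> 'b \<Rightarrow> real) \<Rightarrow> ('a \<Rightarrow> 'b) \<Rightarrow> bool" where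
  "isometry_wrt d1 d2 h \<longleftrightarrow> surj h \<and> (\<forall>x y. d2 (h x) (h y) = d1 x y)"

end

theory Submission
  imports Defs
begin

text \<open>The proof compares Busemann functions. For an end u, the number \<open>bus u x y\<close> says how much farther
x is from u than y. On an apartment \<open>(u,v)\<close> it is a coordinate, and a group element g that
fixes u moves all points by the same Busemann distance, the translation length \<open>shift u g\<close> (positive if g moves
towards u). For each triple of ends, the three apartments between them meet in one point, the \<open>center\<close> of the triple.
Centers are the points that the ends determine canonically: by the Morse lemma for trees, the
coarse equivalence f maps the center of a triple to within a uniform distance of the center of
the image triple (\<open>center_image_near\<close>). Most of the proof is deduced from this estimate and from the
equivariance on ends.

\<^item> The two translation lengths of an element fixing u are the growth rates of the orbits of centers
  in the two trees. Hence each is bounded by a multiple of the other (\<open>shift_bounds\<close>). Two homomorphisms to the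
  reals with this property are proportional. The factor is positive because f maps rays to u close to rays
  to the image of u, and transitivity on the ends makes the factor
  l independent of u (\<open>compatible_scale_exists\<close>). In the end the metric of \<open>T\<^sub>2\<close> is rescaled by \<open>1 / l\<close>.

\<^item> The centers on the apartment \<open>(u,v)\<close> and those on its image must occupy the same positions up to the factor l.
  An element s that swaps u and v reflects both apartments, so positions can be measured from
  the fixed points of the reflections. Let the \<open>defect\<close> of \<open>(u,v,w)\<close> be the difference between the position
  of the image center and l times the position of the center. It changes sign when u and v are exchanged,
  because this reverses the orientation. It does not change when v and w are exchanged: an element
  g that fixes u and maps v to w conjugates one reflection to the other, and its translation
  lengths are in the ratio l. But all transpositions of three letters are conjugate, so the defect
  vanishes (\<open>defect_zero\<close>).

\<^item> Therefore the centers determine a unique affine map of factor l from each apartment \<open>(u,v)\<close> to its image, and these maps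
  agree where apartments intersect. Since any two points lie on a common apartment, they fit
  together to the required map \<open>extension\<close>.

\<^item> If there are two branch points, then some translation length is nonzero; otherwise the defect would
  vanish for every l, which forces the centers on an apartment to coincide. A nonzero
  translation length and transitivity make the centers cobounded in \<open>T\<^sub>1\<close>, and on centers the
  extension is close to f. Any competitor agrees with the extension on centers, and therefore has the same scale
  and is equal to it.\<close>

section \<open>Betweenness in trees\<close>

definition btw :: "'a::metric_space \<Rightarrow> 'a \<Rightarrow> 'a \<Rightarrow> bool" where
  "btw x z y \<longleftrightarrow> dist x z + dist z y = dist x y"

lemma btw_sym: "btw x z y \<longleftrightarrow> btw y z x"
  by (simp add: btw_def dist_commute add.commute)

lemma btw_ends [simp]: "btw x x y" "btw x y y"
  by (simp_all add: btw_def)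

lemma btw_same [simp]: "btw x z x \<longleftrightarrow> z = x"
  by (auto simp: btw_def dist_commute)

lemma btw_trans: "btw x z y \<Longrightarrow> btw x w z \<Longrightarrow> btw x w y"
  unfolding btw_def using dist_triangle[of x y w] dist_triangle[of w y z] by linarith

lemma btw_trans_inner: "btw x z y \<Longrightarrow> btw x w z \<Longrightarrow> btw w z y"
  unfolding btw_def using dist_triangle[of x y w] dist_triangle[of w y z] by linarith

lemma btw_shrink: "btw x p y \<Longrightarrow> btw x s p \<Longrightarrow> btw p t y \<Longrightarrow> btw s p t"
  by (meson btw_sym btw_trans_inner)

lemma geodesic_Icc: "a \<le> b \<Longrightarrow> geodesic {a..b} g \<longleftrightarrow>
    (\<forall>s t. a \<le> s \<longrightarrow> s \<le> b \<longrightarrow> a \<le> t \<longrightarrow> t \<le> b \<longrightarrow> dist (g s) (g t) = \<bar>s - t\<bar>)"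
  by (auto simp: geodesic_def is_interval_cc)

lemma geodesic_Ici: "geodesic {a..} g \<longleftrightarrow> (\<forall>s\<ge>a. \<forall>t\<ge>a. dist (g s) (g t) = \<bar>s - t\<bar>)"
  by (auto simp: geodesic_def is_interval_ci)

lemma geodesic_UNIV: "geodesic UNIV g \<longleftrightarrow> (\<forall>s t. dist (g s) (g t) = \<bar>s - t\<bar>)"
  by (auto simp: geodesic_def)

lemma isometric_set_continuous_on:
  fixes g :: "real \<Rightarrow> 'a::metric_space"
  assumes "\<And>s t. s \<in> J \<Longrightarrow> t \<in> J \<Longrightarrow> dist (g s) (g t) = \<bar>s - t\<bar>"
  shows "continuous_on J g"
  unfolding continuous_on_iff using assms by (auto simp: dist_real_def)

lemma closed_agreement_set:
  fixes g d :: "real \<Rightarrow> 'a::metric_space"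
  assumes "\<And>s t. s \<in> J \<Longrightarrow> t \<in> J \<Longrightarrow> dist (g s) (g t) = \<bar>s - t\<bar>"
    and "\<And>s t. s \<in> J \<Longrightarrow> t \<in> J \<Longrightarrow> dist (d s) (d t) = \<bar>s - t\<bar>"
    and "closed J"
  shows "closed {t\<in>J. g t = d t}"
proof -
  have "continuous_on J (\<lambda>t. dist (g t) (d t))"
    by (intro continuous_intros isometric_set_continuous_on assms)
  then have "closed {t\<in>J. dist (g t) (d t) = 0}"
    using assms(3) by (rule continuous_closed_preimage_constant)
  then show ?thesis by simp
qed

locale real_tree =
  fixes tree_type :: "'a::metric_space itself"
  assumes is_tree: "is_tree TYPE('a)"
begin

lemma joins_exists: "\<exists>g. joins g (x::'a) y"
  using is_tree unfolding is_tree_def by meson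

lemma joins_unique:
  assumes "joins g (x::'a) y" "joins g' x y" "0 \<le> t" "t \<le> dist x y"
  shows "g t = g' t"
  using is_tree assms unfolding is_tree_def by (metis atLeastAtMost_iff)

definition gp :: "'a \<Rightarrow> 'a \<Rightarrow> real \<Rightarrow> 'a" where
  "gp x y = (SOME g. joins g x y)"

lemma gp_joins: "joins (gp x y) x y"
  unfolding gp_def using joins_exists by (rule someI_ex)

lemma gp_0 [simp]: "gp x y 0 = x" and gp_dist [simp]: "gp x y (dist x y) = y"
  using gp_joins[of x y] by (auto simp: joins_def)

lemma dist_gp:
  assumes "0 \<le> s" "s \<le> dist x y" "0 \<le> t" "t \<le> dist x y"
  shows "dist (gp x y s) (gp x y t) = \<bar>s - t\<bar>"
  using gp_joins[of x y] assms by (auto simp: joins_def geodesic_Icc)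

lemma dist_gp_left: "0 \<le> s \<Longrightarrow> s \<le> dist x y \<Longrightarrow> dist x (gp x y s) = s"
  using dist_gp[of 0 x y s] by simp

lemma dist_gp_right: "0 \<le> s \<Longrightarrow> s \<le> dist x y \<Longrightarrow> dist (gp x y s) y = dist x y - s"
  using dist_gp[of s x y "dist x y"] by simp

lemma btw_gp: "0 \<le> s \<Longrightarrow> s \<le> dist x y \<Longrightarrow> btw x (gp x y s) y"
  by (simp add: btw_def dist_gp_left dist_gp_right)

text \<open>A point with \<open>btw x z y\<close> lies on a geodesic from x to y: the two partial geodesics can be concatenated,
since the triangle inequality leaves no room for shortcuts. With uniqueness of geodesics this
reduces statements about geodesics to statements about distances.\<close>

lemma joins_glue:
  assumes "btw x z y"
  shows "joins (\<lambda>t. if t \<le> dist x z then gp x z t else gp z y (t - dist x z)) x y"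
proof -
  let ?g = "\<lambda>t. if t \<le> dist x z then gp x z t else gp z y (t - dist x z)"
  have d: "dist x z + dist z y = dist x y" using assms by (simp add: btw_def)
  have mixed: "dist (gp x z s) (gp z y (t - dist x z)) = t - s"
    if "0 \<le> s" "s \<le> dist x z" "dist x z \<le> t" "t \<le> dist x y" for s t
  proof -
    have "btw (gp x z s) z (gp z y (t - dist x z))"
      using that d by (intro btw_shrink[OF assms] btw_gp) auto
    then show ?thesis using that d
      by (simp add: btw_def dist_gp_left dist_gp_right)
  qed
  have "dist (?g s) (?g t) = \<bar>s - t\<bar>" if "0 \<le> s" "s \<le> dist x y" "0 \<le> t" "t \<le> dist x y" for s t
    using that d mixed[of s t] mixed[of t s]
    by (auto simp: dist_gp dist_commute)
  moreover have "?g (dist x y) = y"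
  proof (cases "z = y")
    case False
    then have "dist x y - dist x z = dist z y" "\<not> dist x y \<le> dist x z"
      using d zero_less_dist_iff[of z y] by linarith+
    then show ?thesis by simp
  qed simp
  ultimately show ?thesis by (auto simp: joins_def geodesic_Icc)
qed

lemma btw_unique:
  assumes "btw x z y" "btw x z' y" "dist x z = dist x (z'::'a)"
  shows "z = z'"
proof -
  have "gp x y (dist x w) = w" if "btw x w y" for w
    using joins_unique[OF gp_joins joins_glue[OF that], of "dist x w"] that
    by (simp add: btw_def) (metis add_increasing2 zero_le_dist order_refl)
  then show ?thesis using assms by metis
qed

lemma btw_exists:
  assumes "0 \<le> t" "t \<le> dist x (y::'a)"
  shows "\<exists>z. btw x z y \<and> dist x z = t"
  using assms btw_gp dist_gp_left by blast

text \<open>The second tree axiom enters here. Beyond the last common point m of the geodesics from x to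
y and to z the two are disjoint, so walking from y back to m and on to z is injective, and
hence geodesic.\<close>

lemma median_exists: "\<exists>m::'a. btw x m y \<and> btw x m z \<and> btw y m z"
proof -
  let ?c = "min (dist x y) (dist x z)"
  define S where "S = {t\<in>{0..?c}. gp x y t = gp x z t}"
  have clS: "closed S" unfolding S_def
    by (rule closed_agreement_set) (auto simp: dist_gp)
  have S0: "0 \<in> S" by (auto simp: S_def)
  have bS: "bdd_above S" by (auto simp: S_def bdd_above_def)
  define t0 where "t0 = Sup S"
  have t0S: "t0 \<in> S" unfolding t0_def using closed_contains_Sup[OF _ bS clS] S0 by auto
  have t0max: "t \<le> t0" if "t \<in> S" for t using that bS by (simp add: t0_def cSup_upper)
  define m where "m = gp x y t0"
  have t0: "0 \<le> t0" "t0 \<le> dist x y" "t0 \<le> dist x z" and mz: "m = gp x z t0"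
    using t0S by (auto simp: S_def m_def)
  have mb: "btw x m y" "btw x m z" and dm: "dist x m = t0"
    using t0 btw_gp[of t0 x y] btw_gp[of t0 x z] dist_gp_left[of t0 x y] mz m_def by auto
  have "btw y m z"
  proof (cases "m = y \<or> m = z")
    case True then show ?thesis by auto
  next
    case False
    then have lt: "t0 < dist x y" "t0 < dist x z" using t0 mz m_def by (auto simp: less_le)
    define r s where "r = dist x y - t0" and "s = r + (dist x z - t0)"
    define \<eta> where "\<eta> t = (if t \<le> r then gp x y (dist x y - t) else gp x z (t0 + (t - r)))" for t
    have r: "0 < r" "r < s" using lt by (auto simp: r_def s_def)
    have \<eta>r: "\<eta> t = gp x z (t0 + (t - r))" if "r \<le> t" for t
      using that mz by (auto simp: \<eta>_def r_def m_def)
    have g1: "geodesic {0..r} \<eta>"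
      using r t0 by (auto simp: geodesic_Icc \<eta>_def dist_gp r_def)
    have g2: "geodesic {r..s} \<eta>"
      using r t0 by (auto simp: geodesic_Icc \<eta>r dist_gp s_def)
    have cross: False if "0 \<le> a" "a \<le> r" "r < b" "b \<le> s" "\<eta> a = \<eta> b" for a b
    proof -
      let ?p = "dist x y - a" and ?q = "t0 + (b - r)"
      have eq: "gp x y ?p = gp x z ?q" using that by (simp add: \<eta>_def)
      have "dist x (gp x y ?p) = ?p"
        using that by (intro dist_gp_left) (auto simp: r_def, use t0 in linarith)
      moreover have "dist x (gp x z ?q) = ?q"
        using that t0 by (intro dist_gp_left) (auto simp: r_def s_def)
      ultimately have pq: "?p = ?q" using eq by metis
      have "gp x y ?q = gp x z ?q" using eq unfolding pq .
      moreover have "0 \<le> ?q" "?q \<le> dist x z" "?p \<le> dist x y"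
        using that t0 by (auto simp: r_def s_def)
      ultimately have "?q \<in> S" unfolding S_def using pq by simp
      then show False using t0max that by fastforce
    qed
    have "inj_on \<eta> {0..s}"
    proof (rule linorder_inj_onI')
      fix a b assume ab: "a \<in> {0..s}" "b \<in> {0..s}" "a < b"
      show "\<eta> a \<noteq> \<eta> b"
      proof
        assume e: "\<eta> a = \<eta> b"
        consider "b \<le> r" | "r \<le> a" | "a \<le> r" "r < b" by linarith
        then show False
        proof cases
          case 1
          then have "dist (\<eta> a) (\<eta> b) = \<bar>a - b\<bar>" using g1 ab r by (auto simp: geodesic_Icc)
          then show ?thesis using e ab by auto
        next
          case 2
          then have "dist (\<eta> a) (\<eta> b) = \<bar>a - b\<bar>" using g2 ab r by (auto simp: geodesic_Icc)
          then show ?thesis using e ab by auto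
        next
          case 3 then show ?thesis using cross e ab by auto
        qed
      qed
    qed
    then have "geodesic {0..s} \<eta>"
      using is_tree r g1 g2 unfolding is_tree_def by blast
    then have "dist (\<eta> 0) (\<eta> s) = s" using r by (auto simp: geodesic_Icc)
    moreover have "\<eta> 0 = y" using r by (simp add: \<eta>_def)
    moreover have "\<eta> s = z" using r by (simp add: \<eta>_def s_def)
    moreover have "dist y m = r" "dist m z = s - r"
      using mb dm by (auto simp: btw_def r_def s_def dist_commute)
    ultimately show ?thesis by (simp add: btw_def)
  qed
  with mb show ?thesis by blast
qed

lemma btw_order:
  assumes "btw x m y" "btw x n y" "dist x m \<le> dist x (n::'a)"
  shows "btw x m n" "btw m n y"
proof -
  obtain p where p: "btw x p n" "dist x p = dist x m"
    using btw_exists[of "dist x m" x n] assms by auto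
  have "btw x p y" using btw_trans assms p by blast
  then have "p = m" using btw_unique assms p by metis
  then show "btw x m n" using p by simp
  then show "btw m n y" using assms btw_trans_inner by blast
qed

text \<open>A point between x and y separates them, so it also separates every other point from one
of the two: compare its position with that of the median of x, y and w. Most facts on the shape
of a tree below are instances of this dichotomy.\<close>

lemma btw_split:
  assumes "btw x m (y::'a)"
  shows "btw x m w \<or> btw w m y"
proof -
  obtain n where n: "btw x n y" "btw x n w" "btw y n w" using median_exists by blast
  show ?thesis
  proof (cases "dist x m \<le> dist x n")
    case True
    then have "btw x m n" using btw_order assms n by blast
    then show ?thesis using n btw_trans by blast
  next
    case False
    then have "btw n m y" using btw_order[OF n(1) assms] by simp
    then show ?thesis using n btw_trans btw_sym by metis
  qed
qed

text \<open>Local geodesics are geodesics: otherwise, by \<open>btw_split\<close>, y would lie between w and z, although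
z lies between y and w.\<close>

lemma btw_extend:
  assumes "btw x y z" "btw y z (w::'a)" "y \<noteq> z"
  shows "btw x y w" "btw x z w"
proof -
  have "\<not> btw w y z"
  proof
    assume "btw w y z"
    moreover have "0 < dist y z" using assms by simp
    ultimately show False using assms(2) unfolding btw_def
      by (metis add.commute add_less_cancel_left dist_commute less_add_same_cancel1 not_less_iff_gr_or_eq)
  qed
  then show *: "btw x y w" using btw_split[OF assms(1)] by blast
  then show "btw x z w" using assms by (meson btw_sym btw_trans)
qed

end

section \<open>Rays and ends\<close>

text \<open>Rays are compared through their parametrizations: equivalent rays agree, after a shift, from some time on.\<close>

definition tail_eq :: "(real \<Rightarrow> 'a) \<Rightarrow> (real \<Rightarrow> 'a) \<Rightarrow> bool" where
  "tail_eq g d \<longleftrightarrow> (\<exists>c. \<forall>\<^sub>F t in at_top. g t = d (t + c))"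

definition end_of :: "(real \<Rightarrow> 'a::metric_space) \<Rightarrow> 'a set set" where
  "end_of g = ray_equiv `` {g ` {0..}}"

lemma eventually_shift_at_top:
  fixes P :: "real \<Rightarrow> bool"
  assumes "\<forall>\<^sub>F t in at_top. P t"
  shows "\<forall>\<^sub>F t in at_top. P (t + c)"
proof -
  obtain N where "\<And>t. t \<ge> N \<Longrightarrow> P t" using assms by (auto simp: eventually_at_top_linorder)
  then have "P (t + c)" if "t \<ge> N - c" for t using that by simp
  then show ?thesis unfolding eventually_at_top_linorder by blast
qed

lemma tail_eq_refl [simp]: "tail_eq g g"
  unfolding tail_eq_def by (rule exI[of _ 0]) simp

lemma tail_eq_sym: "tail_eq g d \<Longrightarrow> tail_eq d g"
proof -
  assume "tail_eq g d"
  then obtain c where "\<forall>\<^sub>F t in at_top. g t = d (t + c)" by (auto simp: tail_eq_def)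
  then have "\<forall>\<^sub>F t in at_top. g (t + - c) = d (t + - c + c)" by (rule eventually_shift_at_top)
  then have "\<forall>\<^sub>F t in at_top. d t = g (t + - c)" by (simp add: eq_commute)
  then show ?thesis unfolding tail_eq_def by blast
qed

lemma tail_eq_trans: "tail_eq g d \<Longrightarrow> tail_eq d \<eta> \<Longrightarrow> tail_eq g \<eta>"
proof -
  assume "tail_eq g d" "tail_eq d \<eta>"
  then obtain a b where *: "\<forall>\<^sub>F t in at_top. g t = d (t + a)" "\<forall>\<^sub>F t in at_top. d t = \<eta> (t + b)"
    by (auto simp: tail_eq_def)
  have "\<forall>\<^sub>F t in at_top. g t = \<eta> (t + (a + b))"
    using *(1) eventually_shift_at_top[OF *(2), of a]
    by eventually_elim (simp add: add.assoc)
  then show ?thesis unfolding tail_eq_def by blast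
qed

lemma tail_eq_shift: "tail_eq (\<lambda>t. g (a + t)) g"
  unfolding tail_eq_def by (rule exI[of _ a]) (simp add: add.commute)

lemma tail_eq_cong: "(\<And>t. t \<ge> a \<Longrightarrow> g t = d t) \<Longrightarrow> tail_eq g d"
  unfolding tail_eq_def by (rule exI[of _ 0]) (auto simp: eventually_at_top_linorder)

lemma ray_dist: "geodesic {0..} g \<Longrightarrow> 0 \<le> s \<Longrightarrow> 0 \<le> t \<Longrightarrow> dist (g s) (g t) = \<bar>s - t\<bar>"
  by (simp add: geodesic_Ici)

lemma line_dist: "geodesic UNIV g \<Longrightarrow> dist (g s) (g t) = \<bar>s - t\<bar>"
  by (simp add: geodesic_UNIV)

lemma ray_btw: "geodesic {0..} g \<Longrightarrow> 0 \<le> a \<Longrightarrow> a \<le> b \<Longrightarrow> b \<le> c \<Longrightarrow> btw (g a) (g b) (g c)"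
  by (simp add: btw_def ray_dist)

lemma ray_shift: "geodesic {0..} g \<Longrightarrow> 0 \<le> a \<Longrightarrow> geodesic {0..} (\<lambda>t. g (a + t))"
  by (auto simp: geodesic_Ici)

lemma line_ray: "geodesic UNIV g \<Longrightarrow> geodesic {0..} (\<lambda>t. g (a + t))"
  by (auto simp: geodesic_Ici geodesic_UNIV)

lemma line_rev_ray: "geodesic UNIV g \<Longrightarrow> geodesic {0..} (\<lambda>t. g (a - t))"
  by (auto simp: geodesic_Ici geodesic_UNIV)

lemma line_is_ray: "geodesic UNIV g \<Longrightarrow> geodesic {0..} g"
  by (auto simp: geodesic_Ici geodesic_UNIV)

lemma line_rev_is_ray: "geodesic UNIV g \<Longrightarrow> geodesic {0..} (\<lambda>t. g (- t))"
  by (auto simp: geodesic_Ici geodesic_UNIV)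

text \<open>Only one of the two signs can occur, because a change of sign would bring two points too
close together. The lemma turns an inclusion of images into an equality of parametrizations.\<close>

lemma half_line_embedding:
  fixes a :: "real \<Rightarrow> real"
  assumes "\<And>s t. 0 \<le> s \<Longrightarrow> 0 \<le> t \<Longrightarrow> \<bar>a s - a t\<bar> = \<bar>s - t\<bar>"
  shows "(\<forall>t\<ge>0. a t = a 0 + t) \<or> (\<forall>t\<ge>0. a t = a 0 - t)"
proof -
  have pm: "a t = a 0 + t \<or> a t = a 0 - t" if "0 \<le> t" for t
    using assms[of t 0] that by (auto simp: abs_if split: if_splits)
  show ?thesis
  proof (cases "a 1 = a 0 + 1")
    case True
    have "a t = a 0 + t" if "0 \<le> t" for t
      using pm[OF that] assms[of t 1] that True by (auto simp: abs_if split: if_splits)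
    then show ?thesis by blast
  next
    case False
    then have "a 1 = a 0 - 1" using pm[of 1] by auto
    then have "a t = a 0 - t" if "0 \<le> t" for t
      using pm[OF that] assms[of t 1] that by (auto simp: abs_if split: if_splits)
    then show ?thesis by blast
  qed
qed

lemma ray_in_image:
  assumes g: "geodesic {0..} g" and d: "\<And>s t. s \<in> J \<Longrightarrow> t \<in> J \<Longrightarrow> dist (d s) (d t) = \<bar>s - t\<bar>"
    and sub: "g ` {0..} \<subseteq> d ` J"
  shows "\<exists>c. (\<forall>t\<ge>0. g t = d (c + t) \<and> c + t \<in> J) \<or> (\<forall>t\<ge>0. g t = d (c - t) \<and> c - t \<in> J)"
proof -
  have "\<forall>t. \<exists>a. 0 \<le> t \<longrightarrow> g t = d a \<and> a \<in> J" using sub by (auto simp: image_subset_iff)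
  then obtain a where a: "\<And>t. 0 \<le> t \<Longrightarrow> g t = d (a t) \<and> a t \<in> J" by metis
  have "(\<forall>t\<ge>0. a t = a 0 + t) \<or> (\<forall>t\<ge>0. a t = a 0 - t)"
  proof (rule half_line_embedding)
    fix s t :: real assume "0 \<le> s" "0 \<le> t"
    then show "\<bar>a s - a t\<bar> = \<bar>s - t\<bar>"
      using a[of s] a[of t] d[of "a s" "a t"] ray_dist[OF g, of s t] by simp
  qed
  then show ?thesis using a by metis
qed

context real_tree begin

lemma ray_determined:
  assumes "geodesic {0..} g" "geodesic {0..} d" "g 0 = d (0::real)" "g T = (d T :: 'a)" "0 \<le> t" "t \<le> T"
  shows "g t = d t"
proof (rule btw_unique)
  show "btw (g 0) (g t) (g T)" using ray_btw[OF assms(1), of 0 t T] assms(5,6) by simp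
  show "btw (g 0) (d t) (g T)" unfolding assms(3,4) using ray_btw[OF assms(2), of 0 t T] assms(5,6) by simp
  show "dist (g 0) (g t) = dist (g 0) (d t)"
    using ray_dist[OF assms(1), of 0 t] ray_dist[OF assms(2), of 0 t] assms by simp
qed

lemma tail_eq_same_origin:
  assumes "geodesic {0..} g" "geodesic {0..} d" "g 0 = (d 0 :: 'a)" "tail_eq g d" "0 \<le> t"
  shows "g t = d t"
proof -
  obtain c where "\<forall>\<^sub>F t in at_top. g t = d (t + c)" using assms by (auto simp: tail_eq_def)
  then obtain N where N: "\<And>s. s \<ge> N \<Longrightarrow> g s = d (s + c)" by (auto simp: eventually_at_top_linorder)
  define s where "s = max N (max t (max 0 (- c)))"
  have s: "g s = d (s + c)" "s \<ge> t" "s \<ge> 0" "s + c \<ge> 0"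
    using N[of s] by (auto simp: s_def)
  then have "c = 0"
    using ray_dist[OF assms(1), of 0 s] ray_dist[OF assms(2), of 0 "s + c"] assms by simp
  then have "g s = d s" using s by simp
  then show ?thesis using ray_determined[OF assms(1-3)] assms(5) s by blast
qed

text \<open>The projection of x to the ray is the median of x, \<open>g 0\<close> and \<open>g N\<close>, where N exceeds the distance from
x to \<open>g 0\<close>. This excludes that the median is \<open>g N\<close>, so that the geodesic continues along the ray.\<close>

lemma ray_projection:
  assumes "geodesic {0..} g"
  shows "\<exists>t0\<ge>0. \<forall>t\<ge>t0. btw (x::'a) (g t0) (g t)"
proof -
  \<comment> \<open>Large enough for the median to come strictly before time N.\<close>
  define N where "N = dist x (g 0) + 1"
  have N: "0 \<le> N" by (simp add: N_def)
  obtain m where m: "btw (g 0) m (g N)" "btw (g 0) m x" "btw (g N) m x"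
    using median_exists by blast
  define t0 where "t0 = dist (g 0) m"
  have "dist (g 0) m + dist m x = dist x (g 0)" using m(2) by (simp add: btw_def dist_commute)
  then have t0: "0 \<le> t0" "t0 < N" using zero_le_dist[of m x] zero_le_dist[of "g 0" m]
    unfolding t0_def N_def by linarith+
  have mt: "m = g t0"
    using m(1) ray_btw[OF assms, of 0 t0 N] t0 ray_dist[OF assms, of 0 t0]
    by (intro btw_unique) (auto simp: t0_def)
  have "btw x (g t0) (g t)" if "t0 \<le> t" for t
  proof (cases "t \<le> N")
    case True
    have "btw x (g t0) (g N)" using m(3) mt btw_sym by metis
    moreover have "btw (g t0) (g t) (g N)" using ray_btw[OF assms] t0 that True by auto
    ultimately show ?thesis by (metis btw_shrink btw_ends(1))
  next
    case False
    have "btw x (g t0) (g N)" using m(3) mt btw_sym by metis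
    moreover have "btw (g t0) (g N) (g t)" using ray_btw[OF assms] t0 that False by auto
    moreover have "g t0 \<noteq> g N" using ray_dist[OF assms, of t0 N] t0 by auto
    ultimately show ?thesis using btw_extend by blast
  qed
  then show ?thesis using t0 by blast
qed

text \<open>The ray runs from x to its projection and then follows g.\<close>

lemma ray_from_exists:
  assumes g: "geodesic {0..} g"
  shows "\<exists>d. geodesic {0..} d \<and> d 0 = (x::'a) \<and> tail_eq d g"
proof -
  obtain t0 where t0: "0 \<le> t0" "\<And>t. t \<ge> t0 \<Longrightarrow> btw x (g t0) (g t)"
    using ray_projection[OF g] by blast
  define D where "D = dist x (g t0)"
  define d where "d t = (if t \<le> D then gp x (g t0) t else g (t0 + (t - D)))" for t
  have mixed: "dist (d s) (d t) = t - s" if "0 \<le> s" "s \<le> D" "D < t" for s t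
  proof -
    have "btw (gp x (g t0) s) (g t0) (g (t0 + (t - D)))"
      using that by (intro btw_trans_inner[OF t0(2)] btw_gp) (auto simp: D_def)
    then show ?thesis using that t0(1) g
      by (simp add: d_def btw_def dist_gp_right ray_dist flip: D_def)
  qed
  have "dist (d s) (d t) = \<bar>s - t\<bar>" if "0 \<le> s" "0 \<le> t" for s t
  proof -
    consider "s \<le> D" "t \<le> D" | "s \<le> D" "D < t" | "D < s" "t \<le> D" | "D < s" "D < t" by linarith
    then show ?thesis
    proof cases
      case 1 then show ?thesis using that by (simp add: d_def dist_gp D_def)
    next
      case 2 then show ?thesis using that mixed[of s t] by simp
    next
      case 3 then show ?thesis using that mixed[of t s] by (simp add: dist_commute)
    next
      case 4 then show ?thesis using that t0(1) by (simp add: d_def ray_dist[OF g])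
    qed
  qed
  then have "geodesic {0..} d" by (simp add: geodesic_Ici)
  moreover have "d 0 = x" by (simp add: d_def D_def)
  moreover have "tail_eq d g" unfolding tail_eq_def
    by (rule exI[of _ "t0 - D"]) (auto simp: eventually_at_top_linorder d_def algebra_simps
      intro!: exI[of _ "D + 1"])
  ultimately show ?thesis by blast
qed

text \<open>For the converse, the times at which the first ray meets the second one with the right shift form a
closed set, upwards closed because geodesics are unique. Its minimum is the origin of the common ray.\<close>

lemma tail_eq_iff_ray_equiv:
  assumes g: "geodesic {0..} g" and d: "geodesic {0..} (d :: real \<Rightarrow> 'a)"
  shows "(g ` {0..}, d ` {0..}) \<in> ray_equiv \<longleftrightarrow> tail_eq g d"
proof
  assume "(g ` {0..}, d ` {0..}) \<in> ray_equiv"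
  then obtain \<eta> where \<eta>: "geodesic {0..} \<eta>" "g ` {0..} \<inter> d ` {0..} = \<eta> ` {0..}"
    by (auto simp: ray_equiv_def is_ray_def)
  have one: "tail_eq \<eta> \<zeta>" if z: "geodesic {0..} \<zeta>" "\<eta> ` {0..} \<subseteq> \<zeta> ` {0..}" for \<zeta>
  proof -
    obtain c where c: "(\<forall>t\<ge>0. \<eta> t = \<zeta> (c + t) \<and> c + t \<in> {0..}) \<or> (\<forall>t\<ge>0. \<eta> t = \<zeta> (c - t) \<and> c - t \<in> {0..})"
      using ray_in_image[OF \<eta>(1) _ z(2)] ray_dist[OF z(1)] by auto
    have "\<not> (\<forall>t\<ge>0. \<eta> t = \<zeta> (c - t) \<and> c - t \<in> {0..})"
      by (auto intro!: exI[of _ "\<bar>c\<bar> + 1"])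
    then have "\<forall>t\<ge>0. \<eta> t = \<zeta> (t + c)" using c by (auto simp: add.commute)
    then show ?thesis unfolding tail_eq_def by (auto simp: eventually_at_top_linorder)
  qed
  show "tail_eq g d"
    using one[OF g] one[OF d] \<eta>(2) tail_eq_sym tail_eq_trans by (metis inf_le1 inf_le2)
next
  assume "tail_eq g d"
  then obtain c where "\<forall>\<^sub>F t in at_top. g t = d (t + c)" by (auto simp: tail_eq_def)
  then obtain N where N: "\<And>t. t \<ge> N \<Longrightarrow> g t = d (t + c)" by (auto simp: eventually_at_top_linorder)
  define S where "S = {t. max 0 (-c) \<le> t \<and> g t = d (t + c)}"
  define M where "M = max N (max 0 (-c))"
  have MS: "t \<in> S" if "t \<ge> M" for t using that N by (auto simp: M_def S_def)
  have S0: "s \<ge> 0" "s + c \<ge> 0" if "s \<in> S" for s using that by (auto simp: S_def)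
  have up: "t \<in> S" if "s \<in> S" "s \<le> t" for s t
  proof -
    define b where "b = max t M"
    have eq: "g b = d (b + c)" "g s = d (s + c)" "s \<ge> 0" "s + c \<ge> 0" "t \<le> b"
      using that MS[of b] by (auto simp: b_def S_def)
    have "g t = d (t + c)"
    proof (rule btw_unique)
      show "btw (g s) (g t) (g b)" using eq that by (intro ray_btw[OF g]) auto
      show "btw (g s) (d (t + c)) (g b)" unfolding eq(1,2)
        using eq that by (intro ray_btw[OF d]) auto
      show "dist (g s) (g t) = dist (g s) (d (t + c))"
        using eq that ray_dist[OF g, of s t] ray_dist[OF d, of "s + c" "t + c"] by simp
    qed
    then show ?thesis using that by (auto simp: S_def)
  qed
  have clS: "closed S"
  proof -
    have "closed {t\<in>{max 0 (-c)..}. g t = d (t + c)}"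
      by (rule closed_agreement_set) (auto simp: ray_dist[OF g] ray_dist[OF d])
    then show ?thesis by (simp add: S_def)
  qed
  have bS: "bdd_below S" by (auto simp: S_def bdd_below_def)
  define s0 where "s0 = Inf S"
  have s0: "s0 \<in> S" unfolding s0_def using closed_contains_Inf[OF _ bS clS] MS[of M] by auto
  have s0min: "s0 \<le> t" if "t \<in> S" for t unfolding s0_def using that bS by (rule cInf_lower)
  have "g ` {0..} \<inter> d ` {0..} = (\<lambda>t. g (s0 + t)) ` {0..}"
  proof (intro equalityI subsetI)
    fix p assume "p \<in> g ` {0..} \<inter> d ` {0..}"
    then obtain t r where p: "p = g t" "p = d r" "0 \<le> t" "0 \<le> r"
      by (metis IntE atLeast_iff imageE)
    define b where "b = M + t + r + \<bar>c\<bar>"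
    have M0: "0 \<le> M" by (simp add: M_def)
    have eq: "g b = d (b + c)" using MS[of b] p M0 by (auto simp: b_def S_def)
    have "b - t = b + c - r"
      using p M0 ray_dist[OF g, of t b] ray_dist[OF d, of r "b + c"] eq
      by (auto simp: b_def)
    then have "r = t + c" by simp
    then have "t \<in> S" using p by (auto simp: S_def)
    then have "t = s0 + (t - s0)" "t - s0 \<in> {0..}" using s0min by auto
    then show "p \<in> (\<lambda>t. g (s0 + t)) ` {0..}" using p by (metis (no_types, lifting) image_eqI)
  next
    fix p assume "p \<in> (\<lambda>t. g (s0 + t)) ` {0..}"
    then obtain t where t: "t \<ge> 0" "p = g (s0 + t)" by auto
    then have "s0 + t \<in> S" using up[OF s0] by simp
    then have "p = g (s0 + t)" "p = d (s0 + t + c)" "0 \<le> s0 + t" "0 \<le> s0 + t + c"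
      using t S0[of "s0 + t"] by (auto simp: S_def)
    then show "p \<in> g ` {0..} \<inter> d ` {0..}" by (metis IntI atLeast_iff image_eqI)
  qed
  then show "(g ` {0..}, d ` {0..}) \<in> ray_equiv"
    using g d ray_shift[OF g S0(1)[OF s0]] by (auto simp: ray_equiv_def is_ray_def)
qed

lemma equiv_ray_equiv: "equiv {R. is_ray (R :: 'a set)} ray_equiv"
proof (rule equivI)
  show "refl_on {R. is_ray (R :: 'a set)} ray_equiv"
    by (auto simp: refl_on_def ray_equiv_def)
  show "sym (ray_equiv :: ('a set \<times> 'a set) set)"
    by (auto simp: sym_def ray_equiv_def Int_commute)
  show "trans (ray_equiv :: ('a set \<times> 'a set) set)"
  proof (rule transI)
    fix P Q R :: "'a set"
    assume a: "(P, Q) \<in> ray_equiv" "(Q, R) \<in> ray_equiv"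
    then have "is_ray P" "is_ray Q" "is_ray R" by (auto simp: ray_equiv_def)
    then obtain p q r where "geodesic {0..} p" "geodesic {0..} q" "geodesic {0..} r"
      "P = p ` {0..}" "Q = q ` {0..}" "R = r ` {0..}" by (auto simp: is_ray_def)
    then show "(P, R) \<in> ray_equiv" using a tail_eq_iff_ray_equiv tail_eq_trans by metis
  qed
qed (auto simp: ray_equiv_def)

lemma end_of_in_ends: "geodesic {0..} g \<Longrightarrow> end_of (g :: real \<Rightarrow> 'a) \<in> ends"
  unfolding ends_def end_of_def by (intro quotientI) (auto simp: is_ray_def)

lemma end_of_exists: "u \<in> ends \<Longrightarrow> \<exists>g. geodesic {0..} g \<and> end_of (g :: real \<Rightarrow> 'a) = u"
  unfolding ends_def end_of_def by (elim quotientE) (auto simp: is_ray_def)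

lemma end_of_eq_iff:
  assumes "geodesic {0..} g" "geodesic {0..} (d :: real \<Rightarrow> 'a)"
  shows "end_of g = end_of d \<longleftrightarrow> tail_eq g d"
  unfolding end_of_def tail_eq_iff_ray_equiv[OF assms, symmetric]
  using assms by (intro eq_equiv_class_iff[OF equiv_ray_equiv]) (auto simp: is_ray_def)

lemma end_of_eq_of_mem:
  assumes "u \<in> ends" "geodesic {0..} (g :: real \<Rightarrow> 'a)" "g ` {0..} \<in> u"
  shows "end_of g = u"
proof -
  obtain d where d: "geodesic {0..} d" "end_of d = u" using end_of_exists assms by blast
  then have "(d ` {0..}, g ` {0..}) \<in> ray_equiv" using assms by (auto simp: end_of_def)
  then show ?thesis using d end_of_eq_iff tail_eq_iff_ray_equiv assms by blast
qed

lemma mem_end_of: "geodesic {0..} (g :: real \<Rightarrow> 'a) \<Longrightarrow> g ` {0..} \<in> end_of g"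
  unfolding end_of_def using tail_eq_iff_ray_equiv by auto

end

section \<open>Busemann functions and apartments\<close>

text \<open>The ray from x to the end u; only its values at nonnegative times are meaningful.\<close>

definition toward :: "'a::metric_space \<Rightarrow> 'a set set \<Rightarrow> real \<Rightarrow> 'a" where
  "toward x u = (SOME g. geodesic {0..} g \<and> g 0 = x \<and> end_of g = u)"

text \<open>The Busemann function of the end u: the rays from x and y to u merge after times a and b,
and \<open>a - b\<close> does not depend on the choice of the common point.\<close>

definition bus :: "'a::metric_space set set \<Rightarrow> 'a \<Rightarrow> 'a \<Rightarrow> real" where
  "bus u x y = (THE r. \<exists>a\<ge>0. \<exists>b\<ge>0. toward x u a = toward y u b \<and> r = a - b)"

text \<open>The rays from x to u and to v leave x in opposite directions. Equivalently, x lies on the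
apartment between u and v (lemma \<open>apartment_between_eq\<close> below).\<close>

definition opp :: "'a::metric_space \<Rightarrow> 'a set set \<Rightarrow> 'a set set \<Rightarrow> bool" where
  "opp x u v \<longleftrightarrow> btw (toward x u 1) x (toward x v 1)"

context real_tree begin

lemma end_of_shift:
  assumes "geodesic {0..} g" "0 \<le> a"
  shows "end_of (\<lambda>t. g (a + t)) = end_of (g :: real \<Rightarrow> 'a)"
  using end_of_eq_iff[OF ray_shift[OF assms] assms(1)] tail_eq_shift by blast

lemma toward_spec:
  assumes "u \<in> ends"
  shows "geodesic {0..} (toward (x::'a) u) \<and> toward x u 0 = x \<and> end_of (toward x u) = u"
proof -
  obtain g :: "real \<Rightarrow> 'a" where g: "geodesic {0..} g" "end_of g = u" using end_of_exists assms by blast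
  obtain d where d: "geodesic {0..} d" "d 0 = x" "tail_eq d g" using ray_from_exists[OF g(1)] by blast
  then have "geodesic {0..} d \<and> d 0 = x \<and> end_of d = u" using end_of_eq_iff g by blast
  then show ?thesis unfolding toward_def
    by (rule someI[where P = "\<lambda>g. geodesic {0..} g \<and> g 0 = x \<and> end_of g = u"])
qed

lemma toward_ray: "u \<in> ends \<Longrightarrow> geodesic {0..} (toward (x::'a) u)"
  using toward_spec by blast

lemma toward_0 [simp]: "u \<in> ends \<Longrightarrow> toward (x::'a) u 0 = x"
  using toward_spec by blast

lemma end_of_toward: "u \<in> ends \<Longrightarrow> end_of (toward (x::'a) u) = u"
  using toward_spec by blast

lemma end_of_tail_eq_toward:
  "geodesic {0..} g \<Longrightarrow> u \<in> ends \<Longrightarrow> tail_eq g (toward (x::'a) u) \<Longrightarrow> end_of g = u"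
  using end_of_eq_iff[of g "toward x u"] toward_ray[of u x] end_of_toward[of u x] by simp

lemma toward_eqI:
  assumes "geodesic {0..} g" "g 0 = (x::'a)" "end_of g = u" "0 \<le> t"
  shows "toward x u t = g t"
proof -
  have u: "u \<in> ends" using end_of_in_ends assms by blast
  have "tail_eq (toward x u) g"
    using end_of_eq_iff[OF toward_ray[OF u] assms(1)] end_of_toward[OF u] assms by simp
  then show ?thesis using tail_eq_same_origin[OF toward_ray[OF u] assms(1) _ _ assms(4)] u assms(2) by simp
qed

lemma toward_on_ray:
  assumes "geodesic {0..} g" "end_of g = u" "0 \<le> a" "0 \<le> t"
  shows "toward (g a :: 'a) u t = g (a + t)"
  using assms end_of_shift[OF assms(1,3)] by (intro toward_eqI ray_shift) auto

lemma toward_toward: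
  "u \<in> ends \<Longrightarrow> 0 \<le> a \<Longrightarrow> 0 \<le> b \<Longrightarrow> toward (toward (x::'a) u a) u b = toward x u (a + b)"
  using toward_on_ray[OF toward_ray end_of_toward] by blast

lemma dist_toward_toward:
  "u \<in> ends \<Longrightarrow> 0 \<le> s \<Longrightarrow> 0 \<le> t \<Longrightarrow> dist (toward x u s) (toward (x::'a) u t) = \<bar>s - t\<bar>"
  using toward_ray ray_dist by blast

lemma dist_toward: "u \<in> ends \<Longrightarrow> 0 \<le> t \<Longrightarrow> dist x (toward (x::'a) u t) = t"
  using dist_toward_toward[of u 0 t x] by simp

lemma btw_toward_eq:
  assumes "u \<in> ends" "0 \<le> a" "btw x y (toward (x::'a) u a)"
  shows "y = toward x u (dist x y)"
proof (rule btw_unique[OF assms(3)])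
  have "dist x y \<le> a" using assms dist_toward[of u a x] zero_le_dist[of y "toward x u a"]
    unfolding btw_def by linarith
  then show "btw x (toward x u (dist x y)) (toward x u a)"
    using ray_btw[OF toward_ray[OF assms(1)], of 0 "dist x y" a x] assms by simp
qed (simp add: dist_toward assms)

lemma toward_merge:
  assumes u: "u \<in> ends"
  shows "\<exists>a\<ge>0. \<exists>b\<ge>0. toward (x::'a) u a = toward y u b"
proof -
  have "tail_eq (toward x u) (toward y u)"
    using end_of_eq_iff[OF toward_ray[OF u] toward_ray[OF u]] end_of_toward[OF u] by simp
  then obtain c N where N: "\<And>t. t \<ge> N \<Longrightarrow> toward x u t = toward y u (t + c)"
    by (auto simp: tail_eq_def eventually_at_top_linorder)
  define s where "s = max N (max 0 (- c))"
  have "s \<ge> N" "s \<ge> 0" "s + c \<ge> 0" by (auto simp: s_def)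
  then show ?thesis using N[of s] by blast
qed

lemma toward_merge_add:
  assumes "u \<in> ends" "0 \<le> a" "0 \<le> b" "0 \<le> r" "toward (x::'a) u a = toward y u b"
  shows "toward x u (a + r) = toward y u (b + r)"
  using assms toward_toward by metis

lemma bus_eqI:
  assumes u: "u \<in> ends" and ab: "0 \<le> a" "0 \<le> b" "toward (x::'a) u a = toward y u b"
  shows "bus u x y = a - b"
proof -
  have le: "a - b = a' - b'"
    if "0 \<le> a" "0 \<le> b" "toward x u a = toward y u b"
      "0 \<le> a'" "0 \<le> b'" "toward x u a' = toward y u b'" "a \<le> a'" for a b a' b'
  proof -
    have "toward y u b' = toward y u (b + (a' - a))"
      using toward_merge_add[OF u that(1,2) _ that(3), of "a' - a"] that by simp
    then have "b' = b + (a' - a)"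
      using dist_toward[OF u that(5), of y] dist_toward[OF u, of "b + (a' - a)" y] that(2,7)
      by (metis add_nonneg_nonneg diff_ge_0_iff_ge)
    then show ?thesis by simp
  qed
  have "r = a - b" if "0 \<le> a'" "0 \<le> b'" "toward x u a' = toward y u b'" "r = a' - b'" for r a' b'
    using le[OF ab that(1-3)] le[OF that(1-3) ab] that(4) by linarith
  then show ?thesis unfolding bus_def using ab by (intro the_equality) blast+
qed

lemma bus_add:
  assumes u: "u \<in> ends"
  shows "bus u (x::'a) y + bus u y z = bus u x z"
proof -
  obtain a b where ab: "a \<ge> 0" "b \<ge> 0" "toward x u a = toward y u b"
    using toward_merge[of u x y] u by blast
  obtain c d where cd: "c \<ge> 0" "d \<ge> 0" "toward y u c = toward z u d"
    using toward_merge[of u y z] u by blast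
  have "toward x u (a + c) = toward z u (d + b)"
    using toward_merge_add[OF u ab(1,2) cd(1) ab(3)] toward_merge_add[OF u cd(1,2) ab(2) cd(3)]
    by (simp add: add.commute)
  then have "bus u x z = (a + c) - (d + b)" using ab cd by (intro bus_eqI u) auto
  then show ?thesis using bus_eqI[OF u ab] bus_eqI[OF u cd] by simp
qed

lemma bus_same [simp]: "u \<in> ends \<Longrightarrow> bus u (x::'a) x = 0"
  using bus_add[of u x x x] by simp

lemma bus_swap: "u \<in> ends \<Longrightarrow> bus u y x = - bus u (x::'a) y"
  using bus_add[of u x y x] by simp

lemma bus_toward: "u \<in> ends \<Longrightarrow> 0 \<le> t \<Longrightarrow> bus u (x::'a) (toward x u t) = t"
  using bus_eqI[of u t 0 x "toward x u t"] by simp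

lemma bus_le_dist:
  assumes u: "u \<in> ends"
  shows "\<bar>bus u (x::'a) y\<bar> \<le> dist x y"
proof -
  obtain a b where ab: "a \<ge> 0" "b \<ge> 0" "toward x u a = toward y u b"
    using toward_merge[of u x y] u by blast
  have "\<bar>dist x p - dist y p\<bar> \<le> dist x y" for p
    using dist_triangle[of x p y] dist_triangle[of y p x] by (simp add: dist_commute)
  moreover have "dist x (toward x u a) = a" "dist y (toward x u a) = b"
    using dist_toward[OF u ab(1), of x] dist_toward[OF u ab(2), of y] ab(3) by simp_all
  ultimately show ?thesis using bus_eqI[OF u ab] by metis
qed

lemma btw_toward_extend:
  assumes w: "w \<in> ends" and q: "0 < q" and r: "0 \<le> r" and b: "btw p x (toward (x::'a) w q)"
  shows "btw p x (toward x w r)"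
proof (cases "q \<le> r")
  case True
  have "btw x (toward x w q) (toward x w r)"
    using ray_btw[OF toward_ray[OF w], of 0 q r x] w q True by simp
  moreover have "x \<noteq> toward x w q" using dist_toward[of w q x] w q by auto
  ultimately show ?thesis using btw_extend b by blast
next
  case False
  have "btw x (toward x w r) (toward x w q)"
    using ray_btw[OF toward_ray[OF w], of 0 r q x] w r False by simp
  then show ?thesis using b by (meson btw_shrink btw_ends(1))
qed

text \<open>By the local-to-global property it does not matter how far one looks along the two rays.\<close>

lemma oppI:
  assumes uv: "u \<in> ends" "v \<in> ends" and s: "0 < s" and t: "0 < t"
    and b: "btw (toward (x::'a) u s) x (toward x v t)"
  shows "opp x u v"
proof -
  have "btw (toward x u s) x (toward x v 1)"
    by (rule btw_toward_extend[OF uv(2) t zero_le_one b])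
  then have "btw (toward x v 1) x (toward x u s)" by (simp add: btw_sym)
  then have "btw (toward x v 1) x (toward x u 1)"
    by (rule btw_toward_extend[OF uv(1) s zero_le_one])
  then show ?thesis unfolding opp_def by (simp add: btw_sym)
qed

lemma opp_btw:
  assumes uv: "u \<in> ends" "v \<in> ends" and s: "0 \<le> s" and t: "0 \<le> t" and o: "opp (x::'a) u v"
  shows "btw (toward x u s) x (toward x v t)"
proof -
  have "btw (toward x u 1) x (toward x v t)"
    using btw_toward_extend[OF uv(2) zero_less_one t] o unfolding opp_def by blast
  then have "btw (toward x v t) x (toward x u 1)" by (simp add: btw_sym)
  then have "btw (toward x v t) x (toward x u s)"
    by (rule btw_toward_extend[OF uv(1) zero_less_one s])
  then show ?thesis by (simp add: btw_sym)
qed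

lemma opp_sym: "opp (x::'a) u v \<longleftrightarrow> opp x v u"
  unfolding opp_def by (rule btw_sym)

lemma opp_neq: "u \<in> ends \<Longrightarrow> opp (x::'a) u v \<Longrightarrow> u \<noteq> v"
  using dist_toward[of u 1 x] by (auto simp: opp_def)

lemma opp_split: "opp (x::'a) u v \<Longrightarrow> opp x u w \<or> opp x w v"
  unfolding opp_def using btw_split by blast

lemma opp_line:
  assumes "u \<in> ends" "v \<in> ends" "opp (x::'a) u v"
  shows "geodesic UNIV (\<lambda>t. if 0 \<le> t then toward x v t else toward x u (- t))"
proof -
  have m: "dist (toward x u s) (toward x v t) = s + t" if "0 \<le> s" "0 \<le> t" for s t
    using opp_btw[OF assms(1,2) that assms(3)] that assms
    by (simp add: btw_def dist_toward dist_commute[of "toward x u s" x])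
  moreover have "dist (toward x v t) (toward x u s) = s + t" if "0 \<le> s" "0 \<le> t" for s t
    using m[OF that] by (simp add: dist_commute)
  ultimately show ?thesis using assms by (auto simp: geodesic_UNIV dist_toward_toward)
qed

lemma end_of_line_shift:
  assumes "geodesic UNIV (g :: real \<Rightarrow> 'a)"
  shows "end_of (\<lambda>t. g (a + t)) = end_of g" "end_of (\<lambda>t. g (a - t)) = end_of (\<lambda>t. g (- t))"
proof -
  have "geodesic {0..} g" using line_ray[OF assms, of 0] by simp
  then show "end_of (\<lambda>t. g (a + t)) = end_of g"
    using end_of_eq_iff[OF line_ray[OF assms]] tail_eq_shift by blast
  have "tail_eq (\<lambda>t. g (a - t)) (\<lambda>t. g (- t))"
    unfolding tail_eq_def by (rule exI[of _ "- a"]) simp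
  then show "end_of (\<lambda>t. g (a - t)) = end_of (\<lambda>t. g (- t))"
    using end_of_eq_iff[OF line_rev_ray[OF assms] line_rev_ray[OF assms, of 0]] by simp
qed

lemma line_ends:
  assumes "geodesic UNIV (g :: real \<Rightarrow> 'a)"
  shows "end_of g \<in> ends" "end_of (\<lambda>t. g (- t)) \<in> ends"
  using end_of_in_ends[OF line_ray[OF assms, of 0]] end_of_in_ends[OF line_rev_ray[OF assms, of 0]]
  by simp_all

lemma toward_on_line:
  assumes "geodesic UNIV (g :: real \<Rightarrow> 'a)" "0 \<le> t"
  shows "toward (g a) (end_of g) t = g (a + t)"
    "toward (g a) (end_of (\<lambda>t. g (- t))) t = g (a - t)"
  using toward_eqI[OF line_ray[OF assms(1), of a] _ _ assms(2)]
    toward_eqI[OF line_rev_ray[OF assms(1), of a] _ _ assms(2)] end_of_line_shift[OF assms(1)]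
  by simp_all

lemma opp_on_line:
  assumes "geodesic UNIV (g :: real \<Rightarrow> 'a)"
  shows "opp (g a) (end_of (\<lambda>t. g (- t))) (end_of g)"
  unfolding opp_def using assms
  by (simp add: toward_on_line btw_def line_dist)

lemma line_between_ends:
  assumes "u \<in> ends" "v \<in> ends" "opp (x::'a) u v"
  shows "\<exists>g. geodesic UNIV g \<and> g 0 = x \<and> end_of (\<lambda>t. g (- t)) = u \<and> end_of g = v"
proof -
  let ?l = "\<lambda>t. if 0 \<le> t then toward x v t else toward x u (- t)"
  note l = opp_line[OF assms]
  have r: "geodesic {0..} ?l" "geodesic {0..} (\<lambda>t. ?l (- t))"
    by (rule line_is_ray[OF l], rule line_rev_is_ray[OF l])
  have "tail_eq ?l (toward x v)" by (rule tail_eq_cong[of 0]) simp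
  then have "end_of ?l = v"
    by (rule end_of_tail_eq_toward[OF r(1) assms(2)])
  moreover have "tail_eq (\<lambda>t. ?l (- t)) (toward x u)" by (rule tail_eq_cong[of 1]) simp
  then have "end_of (\<lambda>t. ?l (- t)) = u"
    by (rule end_of_tail_eq_toward[OF r(2) assms(1)])
  moreover have "?l 0 = x" using assms by simp
  ultimately show ?thesis using l by (intro exI[of _ ?l]) auto
qed

lemma opp_toward:
  assumes "u \<in> ends" "v \<in> ends" "opp (x::'a) u v" "0 \<le> s"
  shows "opp (toward x u s) u v"
proof -
  obtain g where g: "geodesic UNIV g" "g 0 = x" "end_of (\<lambda>t. g (- t)) = u" "end_of g = v"
    using line_between_ends[OF assms(1-3)] by blast
  have "toward x u s = g (- s)"
    using toward_on_line(2)[OF g(1) assms(4), of 0] g by simp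
  then show ?thesis using opp_on_line[OF g(1), of "- s"] g by simp
qed

lemma opp_toward': "u \<in> ends \<Longrightarrow> v \<in> ends \<Longrightarrow> opp (x::'a) u v \<Longrightarrow> 0 \<le> s \<Longrightarrow> opp (toward x v s) u v"
  using opp_toward opp_sym by blast

text \<open>Both points lie between two far points p and q, where the rays from x and y to v
and to u have already merged; there they can be compared.\<close>

lemma opp_points_cases:
  assumes uv: "u \<in> ends" "v \<in> ends" and o: "opp (x::'a) u v" "opp y u v"
  shows "y = toward x u (dist x y) \<or> y = toward x v (dist x y)"
proof -
  obtain a b where ab: "a \<ge> 0" "b \<ge> 0" "toward x v a = toward y v b"
    using toward_merge[of v x y] uv by blast
  obtain c d where cd: "c \<ge> 0" "d \<ge> 0" "toward x u c = toward y u d"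
    using toward_merge[of u x y] uv by blast
  define p where "p = toward x v a"
  define q where "q = toward x u c"
  have xq: "btw p x q" using opp_btw[OF uv cd(1) ab(1) o(1)] by (simp add: p_def q_def btw_sym)
  have yq: "btw p y q" using opp_btw[OF uv cd(2) ab(2) o(2)] ab cd by (simp add: p_def q_def btw_sym)
  show ?thesis
  proof (cases "dist p y \<le> dist p x")
    case True
    then have "btw p y x" using btw_order[OF yq xq] by blast
    then have "btw x y p" by (simp add: btw_sym)
    then show ?thesis using btw_toward_eq[OF uv(2) ab(1)] by (simp add: p_def)
  next
    case False
    then have "btw p x y" using btw_order[OF xq yq] by simp
    then have "btw x y q" using yq btw_trans_inner by blast
    then show ?thesis using btw_toward_eq[OF uv(1) cd(1)] by (simp add: q_def)
  qed
qed

lemma bus_toward_opp: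
  assumes uv: "u \<in> ends" "v \<in> ends" and o: "opp (x::'a) u v" and s: "0 \<le> s"
  shows "bus u x (toward x v s) = - s"
proof -
  define y where "y = toward x v s"
  have oy: "opp y u v" unfolding y_def by (rule opp_toward'[OF uv o s])
  have "x = toward y u s"
  proof -
    have "dist y x = s" by (simp add: y_def dist_commute dist_toward s uv)
    moreover have "x \<noteq> toward y v s" if "0 < s"
    proof
      assume "x = toward y v s"
      then have "x = toward x v (s + s)" using toward_toward[OF uv(2) s s] by (simp add: y_def)
      then show False using dist_toward[OF uv(2), of "s + s" x] that by simp
    qed
    ultimately show ?thesis using opp_points_cases[OF uv oy o] s uv by (cases "s = 0") auto
  qed
  then have "bus u y x = s" using bus_toward[OF uv(1) s, of y] by simp
  then show ?thesis using bus_swap[OF uv(1)] y_def by metis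
qed

text \<open>On an apartment the Busemann functions of its two ends are coordinates of opposite orientation.\<close>

lemma opp_bus:
  assumes uv: "u \<in> ends" "v \<in> ends" and o: "opp (x::'a) u v" "opp y u v"
  shows "bus v x y = - bus u x y" "\<bar>bus u x y\<bar> = dist x y"
proof -
  have ov: "opp x v u" using o opp_sym by blast
  have "(bus u x y = dist x y \<and> bus v x y = - dist x y) \<or> (bus u x y = - dist x y \<and> bus v x y = dist x y)"
    using opp_points_cases[OF uv o] bus_toward[OF uv(1), of "dist x y" x] bus_toward[OF uv(2), of "dist x y" x]
      bus_toward_opp[OF uv o(1), of "dist x y"] bus_toward_opp[OF uv(2,1) ov, of "dist x y"]
    by (metis zero_le_dist)
  then show "bus v x y = - bus u x y" "\<bar>bus u x y\<bar> = dist x y" by auto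
qed

lemma opp_eq_of_bus:
  "u \<in> ends \<Longrightarrow> v \<in> ends \<Longrightarrow> opp (x::'a) u v \<Longrightarrow> opp y u v \<Longrightarrow> bus u x y = 0 \<Longrightarrow> x = y"
  using opp_bus(2) by force

lemma opp_toward_of_bus:
  assumes "u \<in> ends" "v \<in> ends" "opp (x::'a) u v" "opp y u v" "0 \<le> bus u x y"
  shows "y = toward x u (bus u x y)"
proof -
  have "bus u y (toward x u (bus u x y)) = 0"
    using bus_add[OF assms(1), of x y "toward x u (bus u x y)"] bus_toward[OF assms(1,5), of x] by simp
  then show ?thesis using opp_eq_of_bus[OF assms(1,2,4) opp_toward[OF assms(1-3,5)]] by simp
qed

lemma opp_at_bus:
  assumes "u \<in> ends" "v \<in> ends" "opp (x::'a) u v"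
  shows "\<exists>y. opp y u v \<and> bus u x y = r"
proof (cases "0 \<le> r")
  case True
  then show ?thesis using bus_toward opp_toward assms by blast
next
  case False
  then show ?thesis using bus_toward_opp[OF assms, of "- r"] opp_toward'[OF assms, of "- r"] by auto
qed

text \<open>Let m be the last common point of the two rays. If the median of m and of points beyond m on
the two rays were different from m, it would be a later common point.\<close>

lemma branching:
  assumes uw: "u \<in> ends" "w \<in> ends" "u \<noteq> w"
  shows "\<exists>t\<ge>0. toward (x::'a) u t = toward x w t \<and> opp (toward x u t) u w"
proof -
  define S where "S = {t\<in>{0..}. toward x u t = toward x w t}"
  have clS: "closed S" unfolding S_def
    by (rule closed_agreement_set) (auto simp: dist_toward_toward uw)
  have S0: "0 \<in> S" by (simp add: S_def uw)
  have down: "s \<in> S" if "t \<in> S" "0 \<le> s" "s \<le> t" for s t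
    using ray_determined[OF toward_ray[OF uw(1)] toward_ray[OF uw(2)], of x x t s] that uw
    by (auto simp: S_def)
  have bS: "bdd_above S"
  proof (rule ccontr)
    assume "\<not> bdd_above S"
    then have "s \<in> S" if "0 \<le> s" for s using down that unfolding bdd_above_def
      by (meson linear)
    then have "tail_eq (toward x u) (toward x w)" by (intro tail_eq_cong[of 0]) (auto simp: S_def)
    then show False
      using end_of_eq_iff[OF toward_ray[OF uw(1)] toward_ray[OF uw(2)]] end_of_toward uw by metis
  qed
  define t0 where "t0 = Sup S"
  have t0: "t0 \<in> S" unfolding t0_def using closed_contains_Sup[OF _ bS clS] S0 by auto
  then have t0': "0 \<le> t0" "toward x u t0 = toward x w t0" by (auto simp: S_def)
  define m where "m = toward x u t0"
  have mu: "toward m u s = toward x u (t0 + s)" if "0 \<le> s" for s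
    using toward_toward[OF uw(1) t0'(1) that] by (simp only: m_def)
  have mw: "toward m w s = toward x w (t0 + s)" if "0 \<le> s" for s
    using toward_toward[OF uw(2) t0'(1) that] by (simp only: m_def t0'(2))
  obtain n where n: "btw m n (toward m u 1)" "btw m n (toward m w 1)" "btw (toward m u 1) n (toward m w 1)"
    using median_exists by blast
  have "n = toward m u (dist m n)" "n = toward m w (dist m n)"
    using btw_toward_eq[OF uw(1) _ n(1)] btw_toward_eq[OF uw(2) _ n(2)] by auto
  then have "toward x u (t0 + dist m n) = toward x w (t0 + dist m n)"
    using mu mw by (metis zero_le_dist)
  then have "t0 + dist m n \<in> S" using t0' by (simp add: S_def)
  then have "t0 + dist m n \<le> t0" unfolding t0_def using bS by (rule cSup_upper)
  then have "m = n" by simp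
  then have "opp m u w" using n by (simp add: opp_def)
  then show ?thesis using t0' m_def by blast
qed

lemma opp_exists: "u \<in> ends \<Longrightarrow> v \<in> ends \<Longrightarrow> u \<noteq> v \<Longrightarrow> \<exists>x::'a. opp x u v"
  using branching by blast

end

section \<open>Apartments as sets and centers of triples of ends\<close>

context real_tree begin

lemma range_line:
  assumes "geodesic UNIV (g :: real \<Rightarrow> 'a)"
  shows "range g = {x. opp x (end_of (\<lambda>t. g (- t))) (end_of g)}"
proof (intro equalityI subsetI)
  fix x assume "x \<in> {x. opp x (end_of (\<lambda>t. g (- t))) (end_of g)}"
  then have "opp x (end_of (\<lambda>t. g (- t))) (end_of g)" by simp
  then have "x = toward (g 0) (end_of (\<lambda>t. g (- t))) (dist (g 0) x) \<or> x = toward (g 0) (end_of g) (dist (g 0) x)"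
    using opp_points_cases opp_on_line[OF assms, of 0] line_ends[OF assms] by blast
  then show "x \<in> range g"
    using toward_on_line[OF assms, of "dist (g 0) x" 0] by (metis rangeI zero_le_dist)
qed (use opp_on_line[OF assms] in auto)

lemma ends_of_range_line:
  assumes l: "geodesic UNIV (g :: real \<Rightarrow> 'a)"
  shows "ends_of (range g) = {end_of (\<lambda>t. g (- t)), end_of g}"
proof (intro equalityI subsetI)
  fix e assume "e \<in> ends_of (range g)"
  then obtain R where e: "e \<in> ends" "R \<in> e" "R \<subseteq> range g" by (auto simp: ends_of_def)
  obtain d :: "real \<Rightarrow> 'a" where "geodesic {0..} d" "end_of d = e" using end_of_exists e(1) by blast
  then have "is_ray R" using e(2) by (auto simp: end_of_def ray_equiv_def)
  then obtain \<eta> where \<eta>: "geodesic {0..} \<eta>" "R = \<eta> ` {0..}" by (auto simp: is_ray_def)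
  have eq: "end_of \<eta> = e" using end_of_eq_of_mem[OF e(1) \<eta>(1)] e(2) \<eta>(2) by simp
  obtain c where c: "(\<forall>t\<ge>0. \<eta> t = g (c + t) \<and> c + t \<in> UNIV) \<or> (\<forall>t\<ge>0. \<eta> t = g (c - t) \<and> c - t \<in> UNIV)"
    using ray_in_image[OF \<eta>(1), of UNIV g] line_dist[OF l] e(3) \<eta>(2) by auto
  from c show "e \<in> {end_of (\<lambda>t. g (- t)), end_of g}"
  proof
    assume "\<forall>t\<ge>0. \<eta> t = g (c + t) \<and> c + t \<in> UNIV"
    then have "tail_eq \<eta> (\<lambda>t. g (c + t))" by (intro tail_eq_cong[of 0]) auto
    then have "end_of \<eta> = end_of g"
      using end_of_eq_iff[OF \<eta>(1) line_ray[OF l]] end_of_line_shift[OF l] by metis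
    then show ?thesis using eq by simp
  next
    assume "\<forall>t\<ge>0. \<eta> t = g (c - t) \<and> c - t \<in> UNIV"
    then have "tail_eq \<eta> (\<lambda>t. g (c - t))" by (intro tail_eq_cong[of 0]) auto
    then have "end_of \<eta> = end_of (\<lambda>t. g (- t))"
      using end_of_eq_iff[OF \<eta>(1) line_rev_ray[OF l]] end_of_line_shift[OF l] by metis
    then show ?thesis using eq by simp
  qed
next
  have r: "geodesic {0..} g" "geodesic {0..} (\<lambda>t. g (- t))"
    by (rule line_is_ray[OF l], rule line_rev_is_ray[OF l])
  have sub: "g ` {0..} \<subseteq> range g" "(\<lambda>t. g (- t)) ` {0..} \<subseteq> range g" by auto
  fix e assume "e \<in> {end_of (\<lambda>t. g (- t)), end_of g}"
  then show "e \<in> ends_of (range g)"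
    using mem_end_of[OF r(1)] mem_end_of[OF r(2)] end_of_in_ends[OF r(1)] end_of_in_ends[OF r(2)] sub
    unfolding ends_of_def by blast
qed

lemma line_ends_neq: "geodesic UNIV (g :: real \<Rightarrow> 'a) \<Longrightarrow> end_of (\<lambda>t. g (- t)) \<noteq> end_of g"
  using opp_neq line_ends(2) opp_on_line by blast

lemma apartment_iff:
  "apartment (A :: 'a set) \<longleftrightarrow> (\<exists>u\<in>ends. \<exists>v\<in>ends. u \<noteq> v \<and> A = {x. opp x u v})"
proof
  assume "apartment A"
  then obtain g where "geodesic UNIV g" "A = range g" by (auto simp: apartment_def)
  then show "\<exists>u\<in>ends. \<exists>v\<in>ends. u \<noteq> v \<and> A = {x. opp x u v}"
    using range_line line_ends line_ends_neq by metis
next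
  assume "\<exists>u\<in>ends. \<exists>v\<in>ends. u \<noteq> v \<and> A = {x. opp x u v}"
  then obtain u v x where uv: "u \<in> ends" "v \<in> ends" "A = {x. opp x u v}" "opp x u v" using opp_exists by blast
  then obtain g where "geodesic UNIV g" "end_of (\<lambda>t. g (- t)) = u" "end_of g = v"
    using line_between_ends by blast
  then show "apartment A" using range_line uv unfolding apartment_def by metis
qed

lemma ends_of_opp:
  assumes "u \<in> ends" "v \<in> ends" "u \<noteq> v"
  shows "ends_of {x::'a. opp x u v} = {u, v}"
proof -
  obtain x :: 'a where "opp x u v" using opp_exists assms by blast
  then obtain g :: "real \<Rightarrow> 'a" where "geodesic UNIV g" "end_of (\<lambda>t. g (- t)) = u" "end_of g = v"
    using line_between_ends assms by blast
  then show ?thesis using ends_of_range_line range_line by metis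
qed

lemma apartment_between_eq:
  assumes "u \<in> ends" "v \<in> ends" "u \<noteq> v"
  shows "apartment_between u v = {x::'a. opp x u v}"
  unfolding apartment_between_def
proof (rule the_equality)
  show "apartment {x::'a. opp x u v} \<and> ends_of {x::'a. opp x u v} = {u, v}"
    using apartment_iff[of "{x. opp x u v}"] ends_of_opp[OF assms] assms by auto
next
  fix A :: "'a set" assume A: "apartment A \<and> ends_of A = {u, v}"
  then obtain u' v' where *: "u' \<in> ends" "v' \<in> ends" "u' \<noteq> v'" "A = {x. opp x u' v'}"
    using apartment_iff[of A] by blast
  then have "{u', v'} = {u, v}" using ends_of_opp[OF *(1-3)] *(4) A by simp
  then consider "u' = u" "v' = v" | "u' = v" "v' = u" by (auto simp: doubleton_eq_iff)
  then show "A = {x. opp x u v}" 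
    using *(4) by cases (auto simp: opp_sym[of _ v u])
qed

text \<open>From a point of the apartment \<open>(u,v)\<close>, the ray to w runs along the apartment for a while, and leaves it
at the center.\<close>

lemma center_exists:
  assumes uvw: "u \<in> ends" "v \<in> ends" "w \<in> ends" "u \<noteq> v" "v \<noteq> w" "u \<noteq> w"
  shows "\<exists>z::'a. opp z u v \<and> opp z v w \<and> opp z u w"
proof -
  have main: "\<exists>z::'a. opp z u v \<and> opp z v w \<and> opp z u w"
    if e: "u \<in> ends" "v \<in> ends" "w \<in> ends" "u \<noteq> w" and x: "opp (x::'a) u v" "opp x v w" for u v w x
  proof -
    obtain t where t: "t \<ge> 0" "toward x u t = toward x w t" "opp (toward x u t) u w"
      using branching[OF e(1,3,4)] by blast
    have "opp (toward x u t) u v" using opp_toward e x t by blast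
    moreover have "opp (toward x w t) v w" using opp_toward' e x t by blast
    ultimately show ?thesis using t by metis
  qed
  obtain x :: 'a where x: "opp x u v" using opp_exists uvw by blast
  show ?thesis
  proof (cases "opp x v w")
    case True
    then show ?thesis using main[of u v w x] uvw x by blast
  next
    case False
    then have "opp x u w" using opp_split[OF x, of w] opp_sym by blast
    then show ?thesis using main[of v u w x] uvw x opp_sym by blast
  qed
qed

text \<open>Going around the triangle of ends reverses the orientation three times, so the Busemann
distance between two such points equals its own negative.\<close>

lemma center_unique:
  assumes uvw: "u \<in> ends" "v \<in> ends" "w \<in> ends"
    and x: "opp (x::'a) u v" "opp x v w" "opp x u w" and y: "opp y u v" "opp y v w" "opp y u w"
  shows "x = y"
proof -
  have "bus v x y = - bus u x y" "bus w x y = - bus v x y" "bus w x y = - bus u x y"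
    using opp_bus(1) uvw x y by blast+
  then have "bus u x y = 0" by simp
  then show ?thesis using opp_eq_of_bus uvw x y by blast
qed

end

definition center :: "'a::metric_space set set \<Rightarrow> 'a set set \<Rightarrow> 'a set set \<Rightarrow> 'a" where
  "center u v w = (THE z. opp z u v \<and> opp z v w \<and> opp z u w)"

context real_tree begin

lemma center_eqI:
  assumes "u \<in> ends" "v \<in> ends" "w \<in> ends" "opp (x::'a) u v" "opp x v w" "opp x u w"
  shows "center u v w = x"
  unfolding center_def using assms center_unique by (intro the_equality) blast+

lemma center_opp:
  assumes "u \<in> ends" "v \<in> ends" "w \<in> ends" "u \<noteq> v" "v \<noteq> w" "u \<noteq> w"
  shows "opp (center u v w :: 'a) u v" "opp (center u v w :: 'a) v w" "opp (center u v w :: 'a) u w"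
proof -
  obtain z :: 'a where "opp z u v" "opp z v w" "opp z u w" using center_exists assms by blast
  then show "opp (center u v w :: 'a) u v" "opp (center u v w :: 'a) v w" "opp (center u v w :: 'a) u w"
    using center_eqI[OF assms(1-3), of z] by simp_all
qed

lemma center_swap:
  assumes "u \<in> ends" "v \<in> ends" "w \<in> ends" "u \<noteq> v" "v \<noteq> w" "u \<noteq> w"
  shows "center v u w = (center u v w :: 'a)" "center u w v = (center u v w :: 'a)"
  using center_opp[OF assms] assms opp_sym by (auto intro!: center_eqI)

text \<open>The condition on the right says that x lies on the ray from the center to u, which is the common part of
the apartments \<open>(u,v)\<close> and \<open>(u,w)\<close>. So maps defined on single apartments agree on intersections if they agree
on centers.\<close>

lemma opp_iff_bus_center:
  assumes uvw: "u \<in> ends" "v \<in> ends" "w \<in> ends" "u \<noteq> v" "v \<noteq> w" "u \<noteq> w" and x: "opp (x::'a) u v"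
  shows "opp x u w \<longleftrightarrow> 0 \<le> bus u (center u v w) x"
proof -
  let ?z = "center u v w"
  note z = center_opp[OF uvw]
  show ?thesis
  proof
    assume "0 \<le> bus u ?z x"
    then have "x = toward ?z u (bus u ?z x)" using opp_toward_of_bus uvw z x by blast
    then show "opp x u w" using opp_toward[OF uvw(1,3) z(3) \<open>0 \<le> bus u ?z x\<close>] by metis
  next
    assume o: "opp x u w"
    show "0 \<le> bus u ?z x"
    proof (rule ccontr)
      assume n: "\<not> 0 \<le> bus u ?z x"
      have b: "bus v ?z x = - bus u ?z x" using opp_bus(1) uvw z x by blast
      have zx: "opp ?z v u" "opp x v u" using z x by (simp_all add: opp_sym[of _ v u])
      then have "x = toward ?z v (bus v ?z x)" using opp_toward_of_bus[OF uvw(2,1) zx] n b by simp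
      then have "opp x v w" using opp_toward[OF uvw(2,3) z(2), of "bus v ?z x"] n b by simp
      then have "?z = x" using center_eqI uvw x o by blast
      then show False using n uvw by simp
    qed
  qed
qed

text \<open>The ends a, b, c lie in different directions at x, so each of u and v fails to be
opposite to at most one of them.\<close>

lemma center_third_end:
  assumes x: "opp (x::'a) a b" "opp x b c" "opp x a c"
  shows "\<exists>w\<in>{a, b, c}. opp x u w \<and> opp x v w"
proof -
  have "opp x u a \<or> opp x u b" "opp x u b \<or> opp x u c" "opp x u a \<or> opp x u c"
    "opp x v a \<or> opp x v b" "opp x v b \<or> opp x v c" "opp x v a \<or> opp x v c"
    using x opp_split opp_sym by metis+
  then show ?thesis by blast
qed

end

locale leafless_real_tree =
  fixes tree_type :: "'a::metric_space itself"
  assumes leafless: "leafless_tree TYPE('a)"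
begin

sublocale real_tree tree_type
  using leafless by unfold_locales (simp add: leafless_tree_def)

lemma line_through_points:
  "\<exists>g. geodesic UNIV g \<and> g 0 = (x::'a) \<and> g (dist x y) = y"
proof -
  obtain g where g: "joins g x y" using joins_exists by blast
  then obtain d where "geodesic UNIV d" "\<forall>t\<in>{0..dist x y}. d t = g t"
    using leafless unfolding leafless_tree_def joins_def by blast
  then show ?thesis using g by (intro exI[of _ d]) (auto simp: joins_def)
qed

lemma common_apartment:
  "\<exists>u\<in>ends. \<exists>v\<in>ends. u \<noteq> v \<and> opp (x::'a) u v \<and> opp y u v"
proof -
  obtain g where g: "geodesic UNIV g" "g 0 = x" "g (dist x y) = y" using line_through_points by blast
  then show ?thesis using opp_on_line line_ends line_ends_neq by metis
qed

lemma end_beyond: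
  "\<exists>u\<in>ends. y = toward (x::'a) u (dist x y)"
proof -
  obtain g where g: "geodesic UNIV g" "g 0 = x" "g (dist x y) = y" using line_through_points by blast
  then show ?thesis using toward_on_line(1)[OF g(1), of "dist x y" 0] line_ends by (metis add_0 zero_le_dist)
qed

lemma segment_btw: "z \<in> segment x (y::'a) \<longleftrightarrow> btw x z y"
proof
  assume "z \<in> segment x y"
  then obtain g t where g: "joins g x y" "0 \<le> t" "t \<le> dist x y" "z = g t" by (auto simp: segment_def)
  then have "z = gp x y t" using joins_unique gp_joins by blast
  then show "btw x z y" using btw_gp g by simp
next
  assume b: "btw x z y"
  then have "dist x z \<le> dist x y" using zero_le_dist[of z y] unfolding btw_def by linarith
  moreover from this have "gp x y (dist x z) = z"
    using btw_unique[OF btw_gp b] dist_gp_left by simp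
  ultimately show "z \<in> segment x y" unfolding segment_def using gp_joins[of x y]
    by (metis (mono_tags, lifting) atLeastAtMost_iff mem_Collect_eq zero_le_dist)
qed

text \<open>In a leafless tree the three arms at a branch point extend to rays.\<close>

lemma branch_point_is_center:
  assumes "branch_point (z::'a)"
  shows "\<exists>u\<in>ends. \<exists>v\<in>ends. \<exists>w\<in>ends. opp z u v \<and> opp z v w \<and> opp z u w"
proof -
  obtain a b c where abc: "a \<noteq> z" "b \<noteq> z" "c \<noteq> z" "segment a b \<inter> segment b c \<inter> segment c a = {z}"
    using assms by (auto simp: branch_point_def)
  have bt: "btw a z b" "btw b z c" "btw c z a" using abc(4) segment_btw by blast+
  obtain u v w where uvw: "u \<in> ends" "v \<in> ends" "w \<in> ends" "a = toward z u (dist z a)"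
    "b = toward z v (dist z b)" "c = toward z w (dist z c)" using end_beyond by meson
  have pos: "0 < dist z a" "0 < dist z b" "0 < dist z c" using abc by auto
  have "opp z u v" using oppI[OF uvw(1,2) pos(1,2)] bt uvw(4-6) by metis
  moreover have "opp z v w" using oppI[OF uvw(2,3) pos(2,3)] bt uvw(4-6) by metis
  moreover have "opp z u w" using oppI[OF uvw(1,3) pos(1,3)] bt uvw(4-6) btw_sym by metis
  ultimately show ?thesis using uvw by blast
qed

end

section \<open>Similarities of trees\<close>

definition end_image :: "('a \<Rightarrow> 'b) \<Rightarrow> 'a set set \<Rightarrow> 'b set set" where
  "end_image h u = (\<lambda>R. h ` R) ` u"

locale similarity =
  A: real_tree "TYPE('a)" + B: real_tree "TYPE('b)"
  for h :: "'a::metric_space \<Rightarrow> 'b::metric_space" and k :: real +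
  assumes k_pos: "0 < k" and dist_h: "dist (h x) (h y) = k * dist x y" and surj_h: "surj h"
begin

lemma inj_h: "inj h"
proof (rule injI)
  fix x y assume "h x = h y"
  then have "k * dist x y = 0" using dist_h[of x y] by simp
  then show "x = y" using k_pos by simp
qed

lemma ray_image: "geodesic {0..} g \<Longrightarrow> geodesic {0..} (\<lambda>t. h (g (t / k)))"
  using k_pos by (auto simp: geodesic_Ici dist_h simp flip: diff_divide_distrib)

lemma ray_image_set: "(\<lambda>t. h (g (t / k))) ` {0..} = h ` (g ` {0..})"
proof -
  have "(\<lambda>t. t / k) ` {0..} = {0..}"
  proof (intro equalityI subsetI)
    fix t :: real assume "t \<in> {0..}"
    then have "t = (t * k) / k" "t * k \<in> {0..}" using k_pos by auto
    then show "t \<in> (\<lambda>t. t / k) ` {0..}" by (rule image_eqI)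
  qed (use k_pos in auto)
  then have "h ` (g ` {0..}) = h ` (g ` ((\<lambda>t. t / k) ` {0..}))" by simp
  then show ?thesis by (simp add: image_image)
qed

lemma tail_eq_image: "tail_eq g d \<Longrightarrow> tail_eq (\<lambda>t. h (g (t / k))) (\<lambda>t. h (d (t / k)))"
proof -
  assume "tail_eq g d"
  then obtain c N where N: "\<And>t. t \<ge> N \<Longrightarrow> g t = d (t + c)"
    by (auto simp: tail_eq_def eventually_at_top_linorder)
  have "h (g (t / k)) = h (d ((t + c * k) / k))" if "t \<ge> N * k" for t
  proof -
    have "t / k \<ge> N" using that k_pos by (simp add: pos_le_divide_eq)
    then have "g (t / k) = d (t / k + c)" by (rule N)
    moreover have "t / k + c = (t + c * k) / k" using k_pos by (simp add: field_simps)
    ultimately show ?thesis by simp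
  qed
  then show ?thesis unfolding tail_eq_def eventually_at_top_linorder by blast
qed

lemma end_of_image_mem:
  assumes "geodesic {0..} g" "R \<in> end_of g"
  shows "h ` R \<in> end_of (\<lambda>t. h (g (t / k)))"
proof -
  have "is_ray R" using assms by (auto simp: end_of_def ray_equiv_def)
  then obtain d where d: "geodesic {0..} d" "R = d ` {0..}" by (auto simp: is_ray_def)
  then have "tail_eq g d" using assms A.tail_eq_iff_ray_equiv[OF assms(1) d(1)] by (simp add: end_of_def)
  then have "end_of (\<lambda>t. h (d (t / k))) = end_of (\<lambda>t. h (g (t / k)))"
    using B.end_of_eq_iff ray_image assms(1) d(1) tail_eq_image tail_eq_sym by blast
  then show ?thesis using B.mem_end_of[OF ray_image[OF d(1)]] d(2) ray_image_set by metis
qed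

lemma inverse_similarity: "similarity (inv_into UNIV h) (1 / k)"
proof
  show "0 < 1 / k" using k_pos by simp
  show "dist (inv_into UNIV h x) (inv_into UNIV h y) = 1 / k * dist x y" for x y
    using dist_h[of "inv_into UNIV h x" "inv_into UNIV h y"] surj_h k_pos by (simp add: surj_f_inv_f field_simps)
  show "surj (inv_into UNIV h)" using inj_h by (rule inj_imp_surj_inv)
qed

end

context similarity begin

lemma end_image_end_of:
  assumes g: "geodesic {0..} g"
  shows "end_image h (end_of g) = end_of (\<lambda>t. h (g (t / k)))"
proof (intro equalityI subsetI)
  fix R' assume "R' \<in> end_of (\<lambda>t. h (g (t / k)))"
  then have "(inv_into UNIV h) ` R' \<in> end_of (\<lambda>t. inv_into UNIV h (h (g (t / (1 / k) / k))))"
    using similarity.end_of_image_mem[OF inverse_similarity ray_image[OF g]] by simp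
  then have "(inv_into UNIV h) ` R' \<in> end_of g" using inj_h k_pos by simp
  moreover have "R' = h ` ((inv_into UNIV h) ` R')" using surj_h by (simp add: image_f_inv_f)
  ultimately show "R' \<in> end_image h (end_of g)" unfolding end_image_def by blast
qed (use end_of_image_mem[OF g] in \<open>auto simp: end_image_def\<close>)

lemma end_image_in_ends: "u \<in> ends \<Longrightarrow> end_image h u \<in> ends"
  using A.end_of_exists[of u] end_image_end_of B.end_of_in_ends ray_image by metis

lemma toward_image:
  assumes u: "u \<in> ends" and t: "0 \<le> t"
  shows "toward (h x) (end_image h u) (k * t) = h (toward x u t)"
proof -
  have "toward (h x) (end_image h u) (k * t) = (\<lambda>t. h (toward x u (t / k))) (k * t)"
    using end_image_end_of[OF A.toward_ray[OF u]] A.end_of_toward[OF u] u t k_pos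
    by (intro B.toward_eqI ray_image A.toward_ray) simp_all
  then show ?thesis using k_pos by simp
qed

lemma bus_image:
  assumes u: "u \<in> ends"
  shows "bus (end_image h u) (h x) (h y) = k * bus u x y"
proof -
  obtain a b where ab: "0 \<le> a" "0 \<le> b" "toward x u a = toward y u b" using A.toward_merge[OF u, of x y] by blast
  have "toward (h x) (end_image h u) (k * a) = toward (h y) (end_image h u) (k * b)"
    using toward_image[OF u ab(1), of x] toward_image[OF u ab(2), of y] ab(3) by simp
  then have "bus (end_image h u) (h x) (h y) = k * a - k * b"
    using B.bus_eqI[OF end_image_in_ends[OF u]] ab k_pos by simp
  then show ?thesis using A.bus_eqI[OF u ab] by (simp add: right_diff_distrib)
qed

lemma btw_image: "btw (h x) (h y) (h z) \<longleftrightarrow> btw x y z"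
  using k_pos by (simp add: btw_def dist_h flip: distrib_left)

lemma opp_image:
  assumes uv: "u \<in> ends" "v \<in> ends"
  shows "opp (h x) (end_image h u) (end_image h v) \<longleftrightarrow> opp x u v"
proof
  assume "opp (h x) (end_image h u) (end_image h v)"
  then have "btw (toward (h x) (end_image h u) (k * 1)) (h x) (toward (h x) (end_image h v) (k * 1))"
    using B.opp_btw end_image_in_ends uv k_pos by simp
  then show "opp x u v" unfolding toward_image[OF uv(1) zero_le_one] toward_image[OF uv(2) zero_le_one]
    by (simp add: btw_image opp_def)
next
  assume "opp x u v"
  then have "btw (h (toward x u 1)) (h x) (h (toward x v 1))" by (simp add: btw_image opp_def)
  then have "btw (toward (h x) (end_image h u) (k * 1)) (h x) (toward (h x) (end_image h v) (k * 1))"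
    unfolding toward_image[OF uv(1) zero_le_one] toward_image[OF uv(2) zero_le_one] .
  then show "opp (h x) (end_image h u) (end_image h v)"
    using B.oppI end_image_in_ends uv k_pos by simp
qed

end

section \<open>Groups acting on a tree\<close>

locale tree_action = real_tree "TYPE('a)" + group G
  for G :: "('g, 'm) monoid_scheme" (structure) and \<phi> :: "'g \<Rightarrow> 'a::metric_space \<Rightarrow> 'a" +
  assumes action: "isometric_action G \<phi>"
begin

abbreviation E :: "'g \<Rightarrow> 'a set set \<Rightarrow> 'a set set" where "E \<equiv> end_action \<phi>"

lemma ga: "group_action G UNIV \<phi>"
  using action by (simp add: isometric_action_def)

lemma dist_act: "g \<in> carrier G \<Longrightarrow> dist (\<phi> g x) (\<phi> g y) = dist x y"
  using action by (simp add: isometric_action_def)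

lemma act_mult: "g \<in> carrier G \<Longrightarrow> h \<in> carrier G \<Longrightarrow> \<phi> (g \<otimes> h) x = \<phi> g (\<phi> h x)"
  using group_action.composition_rule[OF ga] by blast

lemma act_one [simp]: "\<phi> \<one> x = x"
  using group_action.id_eq_one[OF ga] by (metis UNIV_I restrict_apply)

lemma act_inv [simp]: "g \<in> carrier G \<Longrightarrow> \<phi> (inv g) (\<phi> g x) = x" "g \<in> carrier G \<Longrightarrow> \<phi> g (\<phi> (inv g) x) = x"
  by (simp_all flip: act_mult)

lemma act_similarity: "g \<in> carrier G \<Longrightarrow> similarity (\<phi> g) 1"
proof
  assume g: "g \<in> carrier G"
  show "surj (\<phi> g)" by (rule surjI[of _ "\<phi> (inv g)"]) (simp add: g)
qed (simp_all add: dist_act)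

lemma E_eq: "E g u = end_image (\<phi> g) u"
  by (simp add: end_action_def end_image_def)

lemma E_in_ends: "g \<in> carrier G \<Longrightarrow> u \<in> ends \<Longrightarrow> E g u \<in> ends"
  using similarity.end_image_in_ends[OF act_similarity] by (simp add: E_eq)

lemma E_mult: "g \<in> carrier G \<Longrightarrow> h \<in> carrier G \<Longrightarrow> E (g \<otimes> h) u = E g (E h u)"
  by (simp add: end_action_def image_image act_mult)

lemma E_one [simp]: "E \<one> u = u"
  by (simp add: end_action_def)

lemma E_inv [simp]: "g \<in> carrier G \<Longrightarrow> E (inv g) (E g u) = u" "g \<in> carrier G \<Longrightarrow> E g (E (inv g) u) = u"
  by (simp_all flip: E_mult)

lemma E_inj: "g \<in> carrier G \<Longrightarrow> E g u = E g v \<longleftrightarrow> u = v"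
  by (metis E_inv(1))

lemma E_inv_eq: "g \<in> carrier G \<Longrightarrow> E g u = v \<Longrightarrow> E (inv g) v = u"
  by auto

lemma toward_act: "g \<in> carrier G \<Longrightarrow> u \<in> ends \<Longrightarrow> 0 \<le> t \<Longrightarrow> toward (\<phi> g x) (E g u) t = \<phi> g (toward x u t)"
  using similarity.toward_image[OF act_similarity, of g u t x] by (simp add: E_eq)

lemma bus_act: "g \<in> carrier G \<Longrightarrow> u \<in> ends \<Longrightarrow> bus (E g u) (\<phi> g x) (\<phi> g y) = bus u x y"
  using similarity.bus_image[OF act_similarity] by (simp add: E_eq)

lemma opp_act: "g \<in> carrier G \<Longrightarrow> u \<in> ends \<Longrightarrow> v \<in> ends \<Longrightarrow> opp (\<phi> g x) (E g u) (E g v) \<longleftrightarrow> opp x u v"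
  using similarity.opp_image[OF act_similarity] by (simp add: E_eq)

lemma center_act:
  assumes g: "g \<in> carrier G" and uvw: "u \<in> ends" "v \<in> ends" "w \<in> ends" "u \<noteq> v" "v \<noteq> w" "u \<noteq> w"
  shows "center (E g u) (E g v) (E g w) = \<phi> g (center u v w)"
  using center_opp[OF uvw] opp_act[OF g] E_in_ends[OF g] uvw by (intro center_eqI) auto

text \<open>The signed translation length of a group element fixing the end \<open>u\<close>, measured towards \<open>u\<close>.\<close>

definition shift :: "'a set set \<Rightarrow> 'g \<Rightarrow> real" where
  "shift u g = (THE r. \<forall>x. bus u x (\<phi> g x) = r)"

lemma bus_shift:
  assumes g: "g \<in> carrier G" and u: "u \<in> ends" "E g u = u"
  shows "bus u x (\<phi> g x) = shift u g"
proof -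
  have "bus u x (\<phi> g x) = bus u y (\<phi> g y)" for x y
  proof -
    have "bus u (\<phi> g y) (\<phi> g x) = bus u y x" using bus_act[OF g u(1), of y x] u by simp
    then show ?thesis
      using bus_add[OF u(1), of x y "\<phi> g x"] bus_add[OF u(1), of y "\<phi> g y" "\<phi> g x"] bus_swap[OF u(1), of x y]
      by simp
  qed
  then have "shift u g = bus u x (\<phi> g x)" for x unfolding shift_def by (intro the_equality) auto
  then show ?thesis by simp
qed

lemma shift_mult:
  assumes g: "g \<in> carrier G" and h: "h \<in> carrier G" and u: "u \<in> ends" "E g u = u" "E h u = u"
  shows "shift u (g \<otimes> h) = shift u g + shift u h"
proof -
  fix x :: 'a
  have "shift u (g \<otimes> h) = bus u x (\<phi> g (\<phi> h x))"
    using bus_shift[of "g \<otimes> h" u x] assms by (simp add: E_mult act_mult)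
  also have "\<dots> = bus u x (\<phi> h x) + bus u (\<phi> h x) (\<phi> g (\<phi> h x))" using bus_add u by simp
  finally show ?thesis using bus_shift assms by simp
qed

lemma shift_one: "u \<in> ends \<Longrightarrow> shift u \<one> = 0"
  using bus_shift[of \<one> u] by simp

lemma shift_inv:
  assumes g: "g \<in> carrier G" and u: "u \<in> ends" "E g u = u"
  shows "shift u (inv g) = - shift u g"
  using shift_mult[of g "inv g" u] shift_one[OF u(1)] assms E_inv_eq[OF g u(2)] by simp

lemma E_pow: "g \<in> carrier G \<Longrightarrow> E g u = u \<Longrightarrow> E (g [^] (n::nat)) u = u"
  by (induction n) (auto simp: E_mult)

lemma shift_pow:
  assumes g: "g \<in> carrier G" and u: "u \<in> ends" "E g u = u"
  shows "shift u (g [^] (n::nat)) = real n * shift u g"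
proof (induction n)
  case (Suc n)
  then show ?case using shift_mult[of "g [^] n" g u] E_pow assms by (simp add: algebra_simps)
qed (simp add: shift_one u)

lemma E_int_pow:
  assumes g: "g \<in> carrier G" and u: "E g u = u"
  shows "E (g [^] (z::int)) u = u"
  unfolding int_pow_def2
  using E_pow[OF g u] E_inv_eq[OF nat_pow_closed[OF g] E_pow[OF g u], of "nat (- z)"] by presburger

lemma shift_int_pow:
  assumes g: "g \<in> carrier G" and u: "u \<in> ends" "E g u = u"
  shows "shift u (g [^] (z::int)) = of_int z * shift u g"
proof (cases "z < 0")
  case True
  have "shift u (g [^] z) = - shift u (g [^] nat (- z))"
    using shift_inv[OF nat_pow_closed[OF g] u(1) E_pow[OF g u(2)], of "nat (- z)"] True
    unfolding int_pow_def2 by presburger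
  then show ?thesis using True shift_pow[OF g u, of "nat (- z)"] by simp
next
  case False
  then show ?thesis unfolding int_pow_def2 using shift_pow[OF g u, of "nat z"] by simp
qed

lemma shift_conj:
  assumes k: "k \<in> carrier G" and g: "g \<in> carrier G" and u: "u \<in> ends" "E g u = u"
  shows "shift (E k u) (k \<otimes> g \<otimes> inv k) = shift u g" "E (k \<otimes> g \<otimes> inv k) (E k u) = E k u"
proof -
  show e: "E (k \<otimes> g \<otimes> inv k) (E k u) = E k u" using assms by (simp add: E_mult)
  fix x :: 'a
  have "shift (E k u) (k \<otimes> g \<otimes> inv k) = bus (E k u) (\<phi> k x) (\<phi> (k \<otimes> g \<otimes> inv k) (\<phi> k x))"
    using bus_shift[OF _ _ e, of "\<phi> k x"] assms E_in_ends by simp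
  also have "\<dots> = bus u x (\<phi> g x)" using assms by (simp add: act_mult bus_act)
  finally show "shift (E k u) (k \<otimes> g \<otimes> inv k) = shift u g" using bus_shift assms by simp
qed

text \<open>Far enough towards the fixed end, the element acts as a translation along a ray.\<close>

lemma shift_along_ray:
  assumes g: "g \<in> carrier G" and u: "u \<in> ends" "E g u = u"
  shows "\<exists>b\<ge>0. b + shift u g \<ge> 0 \<and> (\<forall>r\<ge>0. \<phi> g (toward x u (b + r)) = toward x u (b + shift u g + r))"
proof -
  obtain a b where ab: "0 \<le> a" "0 \<le> b" "toward x u a = toward (\<phi> g x) u b"
    using toward_merge[OF u(1), of x "\<phi> g x"] by blast
  have s: "shift u g = a - b" using bus_eqI[OF u(1) ab] bus_shift[OF g u] by simp
  have "\<phi> g (toward x u (b + r)) = toward x u (b + shift u g + r)" if "0 \<le> r" for r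
  proof -
    have "\<phi> g (toward x u (b + r)) = toward (\<phi> g x) u (b + r)"
      using toward_act[OF g u(1), of "b + r" x] ab that u by simp
    also have "\<dots> = toward x u (a + r)" using toward_merge_add[OF u(1) ab(1,2) that ab(3)] by simp
    finally show ?thesis using s by simp
  qed
  then show ?thesis using ab s by (intro exI[of _ b]) auto
qed

lemma orbit_along_ray:
  assumes g: "g \<in> carrier G" and u: "u \<in> ends" "E g u = u" and pos: "0 < shift u g"
  shows "\<exists>b\<ge>0. \<forall>n::nat. \<phi> (g [^] n) (toward x u b) = toward x u (b + real n * shift u g)"
proof -
  obtain b where b: "0 \<le> b" "\<And>r. 0 \<le> r \<Longrightarrow> \<phi> g (toward x u (b + r)) = toward x u (b + shift u g + r)"
    using shift_along_ray[OF g u] by blast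
  have "\<phi> (g [^] n) (toward x u b) = toward x u (b + real n * shift u g)" for n :: nat
  proof (induction n)
    case (Suc n)
    have "\<phi> (g [^] Suc n) (toward x u b) = \<phi> g (\<phi> (g [^] n) (toward x u b))"
      using g by (metis act_mult nat_pow_Suc2 nat_pow_closed)
    then show ?case using Suc b(2)[of "real n * shift u g"] pos by (simp add: algebra_simps)
  qed simp
  then show ?thesis using b(1) by blast
qed

lemma dist_pow_le:
  assumes g: "g \<in> carrier G"
  shows "dist y (\<phi> (g [^] (n::nat)) y) \<le> real n * dist y (\<phi> g y)"
proof (induction n)
  case (Suc n)
  have "dist (\<phi> (g [^] n) y) (\<phi> (g [^] Suc n) y) = dist y (\<phi> g y)"
    using g dist_act[of "g [^] n" y "\<phi> g y"] by (simp add: act_mult)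
  then show ?case using Suc dist_triangle[of y "\<phi> (g [^] Suc n) y" "\<phi> (g [^] n) y"]
    by (simp add: algebra_simps)
qed simp

text \<open>Hence the translation length is the linear growth rate of orbits.\<close>

lemma orbit_growth:
  assumes g: "g \<in> carrier G" and u: "u \<in> ends" "E g u = u"
  shows "real n * \<bar>shift u g\<bar> \<le> dist x (\<phi> (g [^] (n::nat)) x)"
    "\<exists>D. \<forall>n::nat. dist x (\<phi> (g [^] n) x) \<le> real n * \<bar>shift u g\<bar> + D"
proof -
  have "bus u x (\<phi> (g [^] n) x) = real n * shift u g"
    using bus_shift[of "g [^] n" u x] shift_pow[OF g u] E_pow[OF g u(2)] u g by simp
  then show "real n * \<bar>shift u g\<bar> \<le> dist x (\<phi> (g [^] n) x)"
    using bus_le_dist[OF u(1), of x "\<phi> (g [^] n) x"] by (simp add: abs_mult)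
  obtain b where b: "b \<ge> 0" "b + shift u g \<ge> 0"
    "\<And>r. r \<ge> 0 \<Longrightarrow> \<phi> g (toward x u (b + r)) = toward x u (b + shift u g + r)"
    using shift_along_ray[OF g u] by blast
  define y where "y = toward x u b"
  have "dist y (\<phi> g y) = \<bar>shift u g\<bar>"
    using b(3)[of 0] dist_toward_toward[OF u(1) b(1,2), of x] by (simp add: y_def)
  then have "dist y (\<phi> (g [^] n) y) \<le> real n * \<bar>shift u g\<bar>" for n :: nat
    using dist_pow_le[OF g, of y n] by simp
  moreover have "dist (\<phi> (g [^] n) y) (\<phi> (g [^] n) x) = dist y x" for n :: nat
    using dist_act g by simp
  ultimately have "dist x (\<phi> (g [^] n) x) \<le> real n * \<bar>shift u g\<bar> + 2 * dist x y" for n :: nat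
    using dist_triangle[of x "\<phi> (g [^] n) x" y] dist_triangle[of y "\<phi> (g [^] n) x" "\<phi> (g [^] n) y"]
    by (smt (verit) dist_commute)
  then show "\<exists>D. \<forall>n::nat. dist x (\<phi> (g [^] n) x) \<le> real n * \<bar>shift u g\<bar> + D" by blast
qed

text \<open>An element s that swaps u and v reflects the apartment \<open>(u,v)\<close> at a point, and \<open>bus u x (\<phi> s x)\<close>
is twice the signed distance from a point x of the apartment to this fixed point. The next four lemmas describe how this
position changes with the reflection, the apartment, the point and the orientation.\<close>

lemma swap_other:
  assumes s: "s \<in> carrier G" "s' \<in> carrier G" and u: "u \<in> ends" "v \<in> ends"
    and sw: "E s u = v" "E s v = u" "E s' u = v" "E s' v = u"
  shows "bus u x (\<phi> s' x) = bus u x (\<phi> s x) + shift u (s' \<otimes> inv s)" "E (s' \<otimes> inv s) u = u"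
proof -
  have i: "E (inv s) u = v" using E_inv_eq s sw by blast
  then show e: "E (s' \<otimes> inv s) u = u" using s sw by (simp add: E_mult)
  have "\<phi> (s' \<otimes> inv s) (\<phi> s x) = \<phi> s' x" using s by (simp add: act_mult)
  then have "shift u (s' \<otimes> inv s) = bus u (\<phi> s x) (\<phi> s' x)"
    using bus_shift[OF _ u(1) e, of "\<phi> s x"] s by simp
  then show "bus u x (\<phi> s' x) = bus u x (\<phi> s x) + shift u (s' \<otimes> inv s)" using bus_add[OF u(1)] by simp
qed

text \<open>The element g carries the apartment \<open>(u,v)\<close> to \<open>(u,w)\<close> and moves the fixed point of the reflection
by \<open>shift u g\<close> towards u, which counts twice.\<close>

lemma swap_conj:
  assumes s: "s \<in> carrier G" and g: "g \<in> carrier G" and e: "u \<in> ends" "v \<in> ends"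
    and sw: "E s u = v" "E s v = u" and gu: "E g u = u" and gv: "E g v = w"
    and x: "opp x u v" "opp x u w"
  shows "bus u x (\<phi> (g \<otimes> s \<otimes> inv g) x) = 2 * shift u g + bus u x (\<phi> s x)"
    "E (g \<otimes> s \<otimes> inv g) u = w" "E (g \<otimes> s \<otimes> inv g) w = u"
proof -
  have gi: "E (inv g) u = u" "E (inv g) w = v" using E_inv_eq[OF g] gu gv by blast+
  show "E (g \<otimes> s \<otimes> inv g) u = w" "E (g \<otimes> s \<otimes> inv g) w = u"
    using assms gi by (simp_all add: E_mult)
  let ?y = "\<phi> (inv g) x"
  have w: "w \<in> ends" using gv E_in_ends g e by blast
  have oy: "opp ?y u v" using opp_act[of "inv g" u w x] g e w gi x by simp
  have "bus u x (\<phi> g (\<phi> s ?y)) = bus u (\<phi> g ?y) (\<phi> g (\<phi> s ?y))" using g by simp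
  also have "\<dots> = bus u ?y (\<phi> s ?y)" using bus_act[OF g e(1), of ?y "\<phi> s ?y"] gu by simp
  also have "\<dots> = bus u ?y x + bus u x (\<phi> s x) + bus u (\<phi> s x) (\<phi> s ?y)" using bus_add[OF e(1)] by simp
  also have "bus u (\<phi> s x) (\<phi> s ?y) = bus v x ?y" using bus_act[OF s e(2), of x ?y] sw by simp
  also have "\<dots> = bus u ?y x" using opp_bus(1)[OF e x(1) oy] bus_swap[OF e(1), of x ?y] by simp
  also have "bus u ?y x = shift u g" using bus_shift[OF g e(1) gu, of ?y] g by simp
  finally show "bus u x (\<phi> (g \<otimes> s \<otimes> inv g) x) = 2 * shift u g + bus u x (\<phi> s x)"
    using g s by (simp add: act_mult)
qed

lemma swap_difference:
  assumes s: "s \<in> carrier G" and e: "u \<in> ends" "v \<in> ends"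
    and sw: "E s u = v" "E s v = u" and x: "opp x u v" and y: "opp y u v"
  shows "bus u x (\<phi> s x) - bus u y (\<phi> s y) = 2 * bus u x y"
proof -
  have "bus u (\<phi> s y) (\<phi> s x) = bus v y x" using bus_act[OF s e(2), of y x] sw by simp
  also have "\<dots> = bus u x y" using opp_bus(1)[OF e y x] bus_swap[OF e(1), of x y] by simp
  finally show ?thesis
    using bus_add[OF e(1), of x y "\<phi> s x"] bus_add[OF e(1), of y "\<phi> s y" "\<phi> s x"] by simp
qed

lemma swap_reverse:
  assumes s: "s \<in> carrier G" and e: "u \<in> ends" "v \<in> ends"
    and sw: "E s u = v" "E s v = u" and x: "opp x u v"
  shows "bus v x (\<phi> s x) = - bus u x (\<phi> s x)"
proof -
  have "opp (\<phi> s x) u v" using opp_act[OF s e, of x] sw x opp_sym by metis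
  then show ?thesis using opp_bus(1)[OF e x] by blast
qed

end

section \<open>Paths that follow rays\<close>

context real_tree begin

text \<open>Walk along the path in unit steps. By \<open>btw_split\<close>, either the remaining path still has to cross p, or the
current step crosses it, and then p is within the length of the step from its end.\<close>

lemma path_near_geodesic:
  fixes F :: "real \<Rightarrow> 'a"
  assumes jump: "\<And>s t. a \<le> s \<Longrightarrow> s \<le> t \<Longrightarrow> t \<le> b \<Longrightarrow> t \<le> s + 1 \<Longrightarrow> dist (F s) (F t) \<le> J"
    and ab: "a \<le> b" and p: "btw (F a) p (F b)"
  shows "\<exists>t. a \<le> t \<and> t \<le> b \<and> dist p (F t) \<le> J"
proof -
  have "\<exists>t. c \<le> t \<and> t \<le> b \<and> dist p (F t) \<le> J"
    if "b - c \<le> real n" "a \<le> c" "c \<le> b" "btw (F c) p (F b)" for n c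
    using that
  proof (induction n arbitrary: c)
    case 0
    then have "c = b" by simp
    then show ?case using 0 jump[of b b] ab by auto
  next
    case (Suc n)
    show ?case
    proof (cases "b \<le> c + 1")
      case True
      then have "dist (F c) (F b) \<le> J" using jump[of c b] Suc.prems by simp
      then have "dist p (F b) \<le> J" using Suc.prems(4) zero_le_dist[of "F c" p] unfolding btw_def by linarith
      then show ?thesis using Suc.prems by blast
    next
      case False
      from btw_split[OF Suc.prems(4), of "F (c + 1)"] show ?thesis
      proof
        assume "btw (F c) p (F (c + 1))"
        moreover have "dist (F c) (F (c + 1)) \<le> J" using jump[of c "c + 1"] Suc.prems False by simp
        ultimately have "dist p (F (c + 1)) \<le> J" using zero_le_dist[of "F c" p] unfolding btw_def by linarith
        then show ?thesis using Suc.prems False by (intro exI[of _ "c + 1"]) auto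
      next
        assume "btw (F (c + 1)) p (F b)"
        then obtain t where "c + 1 \<le> t" "t \<le> b" "dist p (F t) \<le> J"
          using Suc.IH[of "c + 1"] Suc.prems False by auto
        then show ?thesis by (intro exI[of _ t]) auto
      qed
    qed
  qed
  from this[of a "nat \<lceil>b - a\<rceil>"] show ?thesis using ab p by (simp add: real_nat_ceiling_ge)
qed

text \<open>The projection is the point where the rays from y to u and to v separate.\<close>

lemma projection_to_apartment:
  assumes uv: "u \<in> ends" "v \<in> ends" "u \<noteq> v"
  shows "\<exists>q. opp q u v \<and> (\<forall>s\<ge>0. btw (y::'a) q (toward q u s) \<and> btw y q (toward q v s))"
proof -
  obtain t where t: "0 \<le> t" "toward y u t = toward y v t" "opp (toward y u t) u v"
    using branching[OF uv, of y] by blast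
  let ?q = "toward y u t"
  have "btw y ?q (toward ?q u s)" if "0 \<le> s" for s
    using ray_btw[OF toward_ray[OF uv(1)], of 0 t "t + s" y] toward_toward[OF uv(1) t(1) that, of y] uv t that
    by simp
  moreover have "btw y ?q (toward ?q v s)" if "0 \<le> s" for s
    using ray_btw[OF toward_ray[OF uv(2)], of 0 t "t + s" y] toward_toward[OF uv(2) t(1) that, of y] uv t that
    by simp
  ultimately show ?thesis using t(3) by blast
qed

text \<open>At the center m, the point y lies in the direction of at most one of the three ends. So m is
between y and every point of the apartment that joins the other two.\<close>

lemma near_center:
  assumes e: "u \<in> ends" "v \<in> ends" "w \<in> ends"
    and m: "opp (m::'a) u v" "opp m v w" "opp m u w"
    and near: "opp y1 u v" "dist y y1 \<le> R" "opp y2 v w" "dist y y2 \<le> R" "opp y3 u w" "dist y y3 \<le> R"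
  shows "dist y m \<le> R"
proof -
  define ok where "ok a = btw y m (toward m a 1)" for a
  have two: "ok a \<or> ok b" if "opp m a b" for a b
    using btw_split[of "toward m a 1" m "toward m b 1" y] that btw_sym unfolding ok_def opp_def by metis
  have main: "dist y m \<le> R"
    if "a \<in> ends" "b \<in> ends" "ok a" "ok b" "opp m a b" "opp z a b" "dist y z \<le> R" for a b z
  proof -
    have "z = toward m a (dist m z) \<or> z = toward m b (dist m z)"
      using opp_points_cases that by blast
    then have "btw y m z"
      using btw_toward_extend[OF that(1) zero_less_one zero_le_dist, of y m m z]
        btw_toward_extend[OF that(2) zero_less_one zero_le_dist, of y m m z] that unfolding ok_def by auto
    then show ?thesis using that(7) zero_le_dist[of m z] unfolding btw_def by linarith
  qed
  consider "ok u" "ok v" | "ok v" "ok w" | "ok u" "ok w" using two m by blast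
  then show ?thesis using main e m near by cases blast+
qed

lemma rebase_ray:
  assumes u: "u \<in> ends"
  shows "\<exists>a\<ge>0. \<forall>s\<ge>0. \<exists>s'\<ge>0. dist (toward (x::'a) u s) (toward y u s') \<le> a"
proof -
  obtain a b where ab: "0 \<le> a" "0 \<le> b" "toward x u a = toward y u b"
    using toward_merge[OF u, of x y] by blast
  have "\<exists>s'\<ge>0. dist (toward x u s) (toward y u s') \<le> a" if s: "0 \<le> s" for s
  proof (cases "s \<le> a")
    case True
    then show ?thesis using dist_toward_toward[OF u s ab(1), of x] ab s by (intro exI[of _ b]) auto
  next
    case False
    then have "toward x u s = toward y u (b + (s - a))"
      using toward_merge_add[OF u ab(1,2) _ ab(3), of "s - a"] by simp
    then show ?thesis using ab False by (intro exI[of _ "b + (s - a)"]) auto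
  qed
  then show ?thesis using ab by blast
qed

end

definition tracks :: "(real \<Rightarrow> 'a::metric_space) \<Rightarrow> 'a set set \<Rightarrow> bool" where
  "tracks F u \<longleftrightarrow> (\<exists>x r. \<forall>t\<ge>0. \<exists>s\<ge>0. dist (F t) (toward x u s) \<le> r)"

context real_tree begin

lemma tracksD:
  assumes u: "u \<in> ends" and "tracks F u"
  shows "\<exists>r. \<forall>t\<ge>0. \<exists>s\<ge>0. dist (F t) (toward (y::'a) u s) \<le> r"
proof -
  obtain x r where r: "\<And>t. 0 \<le> t \<Longrightarrow> \<exists>s\<ge>0. dist (F t) (toward x u s) \<le> r"
    using assms by (auto simp: tracks_def)
  obtain a where a: "\<And>s. 0 \<le> s \<Longrightarrow> \<exists>s'\<ge>0. dist (toward x u s) (toward y u s') \<le> a"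
    using rebase_ray[OF u] by blast
  have "\<exists>s\<ge>0. dist (F t) (toward y u s) \<le> r + a" if t: "0 \<le> t" for t
  proof -
    obtain s where s: "0 \<le> s" "dist (F t) (toward x u s) \<le> r" using r t by blast
    obtain s' where s': "0 \<le> s'" "dist (toward x u s) (toward y u s') \<le> a" using a s by blast
    have "dist (F t) (toward y u s') \<le> r + a"
      using s s' dist_triangle[of "F t" "toward y u s'" "toward x u s"] by linarith
    then show ?thesis using s' by blast
  qed
  then show ?thesis by blast
qed

text \<open>If the ends differ, a point near the rays from x to both ends is near x when
x is chosen on the apartment between them.\<close>

lemma tracks_unique:
  assumes uv: "u \<in> ends" "v \<in> ends" and tr: "tracks F u" "tracks F v"
    and unbounded: "\<And>M. \<exists>t\<ge>0. M \<le> dist (F 0 :: 'a) (F t)"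
  shows "u = v"
proof (rule ccontr)
  assume "u \<noteq> v"
  then obtain x :: 'a where x: "opp x u v" using opp_exists uv by blast
  obtain r where r: "\<And>t. 0 \<le> t \<Longrightarrow> \<exists>s\<ge>0. dist (F t) (toward x u s) \<le> r" using tracksD uv tr by blast
  obtain r' where r': "\<And>t. 0 \<le> t \<Longrightarrow> \<exists>s\<ge>0. dist (F t) (toward x v s) \<le> r'" using tracksD uv tr by blast
  have bd: "dist (F t) x \<le> 2 * r + r'" if t: "0 \<le> t" for t
  proof -
    obtain s where s: "0 \<le> s" "dist (F t) (toward x u s) \<le> r" using r t by blast
    obtain s' where s': "0 \<le> s'" "dist (F t) (toward x v s') \<le> r'" using r' t by blast
    have "dist (toward x u s) x + dist x (toward x v s') = dist (toward x u s) (toward x v s')"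
      using opp_btw[OF uv s(1) s'(1) x] by (simp add: btw_def)
    moreover have "dist (toward x u s) x = s" using dist_toward[OF uv(1) s(1), of x] by (simp add: dist_commute)
    moreover have "dist x (toward x v s') = s'" using dist_toward[OF uv(2) s'(1)] .
    ultimately have "s \<le> r + r'"
      using s s' dist_triangle3[of "toward x u s" "toward x v s'" "F t"] by linarith
    then show ?thesis
      using s dist_triangle[of "F t" x "toward x u s"] \<open>dist (toward x u s) x = s\<close> by linarith
  qed
  obtain t where t: "t \<ge> 0" "4 * r + 2 * r' + 1 \<le> dist (F 0) (F t)" using unbounded by blast
  then show False using bd[of 0] bd[of t] dist_triangle2[of "F 0" "F t" x] by simp
qed

lemma ray_tracks: "geodesic {0..} g \<Longrightarrow> tracks g (end_of (g :: real \<Rightarrow> 'a))"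
proof -
  assume g: "geodesic {0..} g"
  have "dist (g t) (toward (g 0) (end_of g) t) \<le> 0" if "0 \<le> t" for t
    using toward_eqI[OF g refl refl that] by simp
  then show ?thesis unfolding tracks_def by blast
qed

text \<open>A far part of an apartment leaves every neighbourhood of another apartment, except along shared ends.\<close>

lemma hausdorff_ends_subset:
  assumes e: "a \<in> ends" "b \<in> ends" "c \<in> ends" "d \<in> ends" "a \<noteq> b" "c \<noteq> d"
    and near: "\<And>x. opp (x::'a) a b \<Longrightarrow> \<exists>y. opp y c d \<and> dist x y \<le> r"
  shows "a \<in> {c, d}"
proof (rule ccontr)
  assume n: "a \<notin> {c, d}"
  obtain x :: 'a where x: "opp x a b" using opp_exists e by blast
  obtain m :: 'a where m: "opp m a c" "opp m c d" "opp m a d"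
    using center_exists[of a c d] e n by auto
  obtain i j where ij: "0 \<le> i" "0 \<le> j" "toward x a i = toward m a j" using toward_merge[OF e(1), of x m] by blast
  define s where "s = \<bar>r\<bar> + 1"
  have s: "0 \<le> s" by (simp add: s_def)
  let ?z = "toward m a (j + s)"
  have "?z = toward x a (i + s)" using toward_merge_add[OF e(1) ij(1,2) s ij(3)] by simp
  then have "opp ?z a b" using opp_toward[OF e(1,2) x, of "i + s"] ij s by simp
  then obtain y where y: "opp y c d" "dist ?z y \<le> r" using near by blast
  have far: "dist ?z (toward m q t) \<ge> s" if "q \<in> ends" "opp m a q" "0 \<le> t" for q t
  proof -
    have "dist ?z m + dist m (toward m q t) = dist ?z (toward m q t)"
      using opp_btw[OF e(1) that(1) _ that(3) that(2), of "j + s"] ij s by (simp add: btw_def)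
    moreover have "dist ?z m = j + s" using dist_toward[OF e(1), of "j + s" m] ij s by (simp add: dist_commute)
    ultimately show ?thesis using ij zero_le_dist[of m "toward m q t"] by linarith
  qed
  have "y = toward m c (dist m y) \<or> y = toward m d (dist m y)" using opp_points_cases e m y by blast
  then have "s \<le> dist ?z y" using far[OF e(3) m(1) zero_le_dist, of m y] far[OF e(4) m(3) zero_le_dist, of m y]
    by metis
  then show False using y by (simp add: s_def)
qed

lemma hausdorff_apartments_eq:
  assumes e: "a \<in> ends" "b \<in> ends" "c \<in> ends" "d \<in> ends" "a \<noteq> b" "c \<noteq> d"
    and near: "\<And>x. opp (x::'a) a b \<Longrightarrow> \<exists>y. opp y c d \<and> dist x y \<le> r"
  shows "{a, b} = {c, d}"
proof -
  have "a \<in> {c, d}" by (rule hausdorff_ends_subset[OF e near])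
  moreover have "b \<in> {c, d}"
    using near opp_sym by (intro hausdorff_ends_subset[OF e(2,1,3,4) e(5)[symmetric] e(6), of r]) metis
  ultimately show ?thesis using e by blast
qed

text \<open>A path \<open>F\<close> that is a quasi-isometric embedding of a half-line follows a ray: the geodesics from
  \<open>F 0\<close> to \<open>F n\<close> stabilize, because the geodesic from \<open>F n\<close> to \<open>F m\<close> stays close to the path,
  hence far away from \<open>F 0\<close>.\<close>

lemma quasi_ray_follows_ray:
  fixes F :: "real \<Rightarrow> 'a"
  assumes L: "0 < L"
    and up: "\<And>s t. 0 \<le> s \<Longrightarrow> s \<le> t \<Longrightarrow> dist (F s) (F t) \<le> L * (t - s) + C"
    and low: "\<And>s t. 0 \<le> s \<Longrightarrow> s \<le> t \<Longrightarrow> t - s \<le> L * dist (F s) (F t) + C"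
  shows "\<exists>u\<in>ends. tracks F u \<and> (\<forall>s\<ge>0. \<exists>t\<ge>0. dist (toward (F 0) u s) (F t) \<le> L + C)"
proof -
  define J where "J = L + C"
  have C: "0 \<le> C" using low[of 0 0] by simp
  have J: "0 \<le> J" using L C by (simp add: J_def)
  have jump: "dist (F s) (F t) \<le> J" if "0 \<le> s" "s \<le> t" "t \<le> s + 1" for s t
  proof -
    have "L * (t - s) \<le> L * 1" using that L by (intro mult_left_mono) auto
    then show ?thesis using up[of s t] that by (simp add: J_def)
  qed
  have near: "\<exists>t. a \<le> t \<and> t \<le> b \<and> dist p (F t) \<le> J" if "0 \<le> a" "a \<le> b" "btw (F a) p (F b)" for a b p
    using path_near_geodesic[of a b F J p] jump that by auto
  \<comment> \<open>From time \<open>N r\<close> on, the path has distance at least \<open>r + J\<close> from \<open>F 0\<close>.\<close>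
  define N where "N r = L * (r + J) + C" for r
  have Npos: "0 \<le> N r" if "0 \<le> r" for r using that L C J by (simp add: N_def)
  have Nmono: "N r \<le> N r'" if "r \<le> r'" for r r' using that L by (simp add: N_def)
  have far: "r + J \<le> dist (F 0) (F t)" if "0 \<le> r" "N r \<le> t" for r t
  proof -
    have "0 \<le> t" using that Npos[of r] by linarith
    then have "L * (r + J) + C \<le> L * dist (F 0) (F t) + C" using low[of 0 t] that by (simp add: N_def)
    then show ?thesis using L by simp
  qed
  have far': "r \<le> dist (F 0) (F t)" if "0 \<le> r" "N r \<le> t" for r t using far[OF that] J by linarith
  have stable: "gp (F 0) (F n) r = gp (F 0) (F m) r" if r: "0 \<le> r" and n: "N r \<le> n" "n \<le> m" for r n m
  proof -
    have n0: "0 \<le> n" using n Npos[OF r] by linarith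
    obtain q where q: "btw (F 0) q (F n)" "btw (F 0) q (F m)" "btw (F n) q (F m)" using median_exists by blast
    obtain t where t: "n \<le> t" "t \<le> m" "dist q (F t) \<le> J" using near[OF n0 n(2) q(3)] by blast
    have "r \<le> dist (F 0) q" using far[OF r, of t] t n dist_triangle[of "F 0" "F t" q] by linarith
    then obtain z where z: "btw (F 0) z q" "dist (F 0) z = r" using btw_exists r by blast
    have "gp (F 0) (F k) r = z" if "btw (F 0) q (F k)" "N r \<le> k" for k
      using btw_unique[OF btw_gp[OF r] btw_trans[OF that(1) z(1)]] dist_gp_left[OF r] z(2) far'[OF r that(2)] by simp
    then show ?thesis using q n by (metis order_trans)
  qed
  define \<rho> where "\<rho> r = gp (F 0) (F (N r)) r" for r
  have \<rho>: "\<rho> r = gp (F 0) (F n) r" if "0 \<le> r" "N r \<le> n" for r n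
    using stable[OF that(1) order_refl that(2)] by (simp add: \<rho>_def)
  have ray: "geodesic {0..} \<rho>"
  proof -
    have "dist (\<rho> r) (\<rho> r') = \<bar>r - r'\<bar>" if "0 \<le> r" "0 \<le> r'" for r r'
      using \<rho>[of r "N (max r r')"] \<rho>[of r' "N (max r r')"] Nmono[of r "max r r'"] Nmono[of r' "max r r'"] that
        dist_gp[of r "F 0" "F (N (max r r'))" r'] far'[of r "N (max r r')"] far'[of r' "N (max r r')"] by simp
    then show ?thesis by (simp add: geodesic_Ici)
  qed
  have \<rho>0: "\<rho> 0 = F 0" by (simp add: \<rho>_def)
  define u where "u = end_of \<rho>"
  have u: "u \<in> ends" unfolding u_def by (rule end_of_in_ends[OF ray])
  have tow: "toward (F 0) u s = \<rho> s" if "0 \<le> s" for s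
    using toward_eqI[OF ray \<rho>0 u_def[symmetric] that] .
  have "\<exists>t\<ge>0. dist (toward (F 0) u s) (F t) \<le> J" if s: "0 \<le> s" for s
    using near[OF order_refl Npos[OF s] btw_gp[OF s far'[OF s order_refl]]] tow[OF s] by (auto simp: \<rho>_def)
  moreover have "\<exists>s\<ge>0. dist (F t) (toward (F 0) u s) \<le> L * (L * (2 * J) + C) + C + J" if t: "0 \<le> t" for t
  proof -
    define n where "n = max t (N (dist (F 0) (F t)))"
    obtain m where m: "btw (F 0) m (F t)" "btw (F 0) m (F n)" "btw (F t) m (F n)" using median_exists by blast
    obtain s where s: "0 \<le> s" "s \<le> t" "dist m (F s) \<le> J" using near[OF order_refl t m(1)] by blast
    obtain s' where s': "t \<le> s'" "s' \<le> n" "dist m (F s') \<le> J" using near[OF t _ m(3)] by (auto simp: n_def)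
    have "dist (F s) (F s') \<le> 2 * J" using s s' dist_triangle3[of "F s" "F s'" m] by linarith
    then have "L * dist (F s) (F s') \<le> L * (2 * J)" using L by simp
    then have "t - s \<le> L * (2 * J) + C" using low[of s s'] s s' by linarith
    then have "L * (t - s) \<le> L * (L * (2 * J) + C)" using L by simp
    then have d: "dist (F t) m \<le> L * (L * (2 * J) + C) + C + J"
      using up[of s t] s dist_triangle2[of "F t" m "F s"] by (simp add: dist_commute)
    let ?r = "dist (F 0) m"
    have r: "?r \<le> dist (F 0) (F t)" using m(1) zero_le_dist[of m "F t"] unfolding btw_def by linarith
    then have Nr: "N ?r \<le> n" using Nmono[OF r] by (simp add: n_def)
    have "\<rho> ?r = m"
      using \<rho>[OF zero_le_dist Nr] btw_unique[OF btw_gp m(2)] dist_gp_left far'[OF zero_le_dist Nr] by simp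
    then show ?thesis using d tow[of ?r] by (intro exI[of _ ?r]) auto
  qed
  then have "tracks F u" unfolding tracks_def by blast
  ultimately show ?thesis using u unfolding J_def by blast
qed

end

section \<open>The boundary map of a quasi-isometry\<close>

text \<open>The base point \<open>undefined\<close> of the ray stands for an arbitrary point; \<open>bd_eqI\<close> below shows that any ray to u
gives the same end.\<close>

definition boundary_map :: "('a::metric_space \<Rightarrow> 'b::metric_space) \<Rightarrow> 'a set set \<Rightarrow> 'b set set" where
  "boundary_map f u = (SOME v. v \<in> ends \<and> tracks (\<lambda>t. f (toward undefined u t)) v)"

text \<open>The assumptions are symmetric in f and f', so all results apply to both maps.\<close>

locale quasi_isometry =
  A: leafless_real_tree "TYPE('a)" + B: leafless_real_tree "TYPE('b)"
  for f :: "'a::metric_space \<Rightarrow> 'b::metric_space" and f' :: "'b \<Rightarrow> 'a" and L C :: real +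
  assumes L: "0 < L"
    and up: "dist (f x) (f y) \<le> L * dist x y + C"
    and low: "dist x y \<le> L * dist (f x) (f y) + C"
    and up': "dist (f' p) (f' q) \<le> L * dist p q + C"
    and low': "dist p q \<le> L * dist (f' p) (f' q) + C"
    and left: "dist (f' (f x)) x \<le> C"
    and right: "dist (f (f' p)) p \<le> C"
begin

abbreviation bd :: "'a set set \<Rightarrow> 'b set set" where "bd \<equiv> boundary_map f"

lemma C_nonneg: "0 \<le> C"
  using up[of undefined undefined] by simp

lemma inverse_quasi_isometry: "quasi_isometry f' f L C"
  by unfold_locales (rule L up low up' low' left right)+

lemma quasi_ray_image:
  assumes g: "geodesic {0..} g"
  shows "\<exists>v\<in>ends. tracks (\<lambda>t. f (g t)) v \<and> (\<forall>s\<ge>0. \<exists>t\<ge>0. dist (toward (f (g 0)) v s) (f (g t)) \<le> L + C)"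
proof (rule B.quasi_ray_follows_ray[OF L])
  fix s t :: real assume st: "0 \<le> s" "s \<le> t"
  then have "dist (g s) (g t) = t - s" using ray_dist[OF g, of s t] by simp
  then show "dist (f (g s)) (f (g t)) \<le> L * (t - s) + C" "t - s \<le> L * dist (f (g s)) (f (g t)) + C"
    using up[of "g s" "g t"] low[of "g s" "g t"] by simp_all
qed

lemma quasi_ray_unbounded:
  assumes g: "geodesic {0..} g"
  shows "\<exists>t\<ge>0. M \<le> dist (f (g 0)) (f (g t))"
proof -
  define t where "t = L * \<bar>M\<bar> + C"
  have t: "0 \<le> t" using L C_nonneg by (simp add: t_def)
  have "dist (g 0) (g t) = t" using ray_dist[OF g, of 0 t] t by simp
  then have "L * \<bar>M\<bar> \<le> L * dist (f (g 0)) (f (g t))" using low[of "g 0" "g t"] by (simp add: t_def)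
  then have "M \<le> dist (f (g 0)) (f (g t))" using L by simp
  then show ?thesis using t by blast
qed

lemma tracks_image_trans:
  assumes u: "u \<in> ends" and v: "v \<in> ends" and F: "tracks F u" and tr: "tracks (\<lambda>t. f (toward x u t)) v"
  shows "tracks (\<lambda>t. f (F t)) v"
proof -
  obtain r where r: "\<And>t. 0 \<le> t \<Longrightarrow> \<exists>s\<ge>0. dist (F t) (toward x u s) \<le> r" using A.tracksD[OF u F] by blast
  obtain y r' where r': "\<And>t. 0 \<le> t \<Longrightarrow> \<exists>s\<ge>0. dist (f (toward x u t)) (toward y v s) \<le> r'"
    using tr by (auto simp: tracks_def)
  have "\<exists>s\<ge>0. dist (f (F t)) (toward y v s) \<le> L * r + C + r'" if t: "0 \<le> t" for t
  proof -
    obtain s where s: "0 \<le> s" "dist (F t) (toward x u s) \<le> r" using r t by blast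
    obtain s' where s': "0 \<le> s'" "dist (f (toward x u s)) (toward y v s') \<le> r'" using r' s by blast
    have "L * dist (F t) (toward x u s) \<le> L * r" using s L by simp
    then have "dist (f (F t)) (f (toward x u s)) \<le> L * r + C" using up[of "F t" "toward x u s"] by linarith
    then have "dist (f (F t)) (toward y v s') \<le> L * r + C + r'"
      using s' dist_triangle[of "f (F t)" "toward y v s'" "f (toward x u s)"] by linarith
    then show ?thesis using s' by blast
  qed
  then show ?thesis unfolding tracks_def by blast
qed

lemma bd_spec:
  assumes u: "u \<in> ends"
  shows "bd u \<in> ends" "tracks (\<lambda>t. f (toward undefined u t)) (bd u)"
proof -
  obtain v where "v \<in> ends \<and> tracks (\<lambda>t. f (toward undefined u t)) v"
    using quasi_ray_image[OF A.toward_ray[OF u]] by blast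
  then have "bd u \<in> ends \<and> tracks (\<lambda>t. f (toward undefined u t)) (bd u)"
    unfolding boundary_map_def by (rule someI[where P = "\<lambda>v. v \<in> ends \<and> tracks (\<lambda>t. f (toward undefined u t)) v"])
  then show "bd u \<in> ends" "tracks (\<lambda>t. f (toward undefined u t)) (bd u)" by auto
qed

lemma tracks_boundary_map:
  assumes u: "u \<in> ends" and F: "tracks F u"
  shows "tracks (\<lambda>t. f (F t)) (bd u)"
  using tracks_image_trans[OF u bd_spec(1)[OF u] F bd_spec(2)[OF u]] .

lemma bd_eqI:
  assumes g: "geodesic {0..} g" "end_of g = u" and v: "v \<in> ends" "tracks (\<lambda>t. f (g t)) v"
  shows "bd u = v"
proof -
  have u: "u \<in> ends" using A.end_of_in_ends g by blast
  have "tracks (\<lambda>t. f (g t)) (bd u)" using tracks_boundary_map[OF u] A.ray_tracks g by blast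
  then show ?thesis
    using B.tracks_unique[OF bd_spec(1)[OF u] v(1) _ v(2)] quasi_ray_unbounded[OF g(1)] by blast
qed

lemma quasi_ray_image_near:
  assumes g: "geodesic {0..} g" "end_of g = u" and s: "0 \<le> s"
  shows "\<exists>t\<ge>0. dist (toward (f (g 0)) (bd u) s) (f (g t)) \<le> L + C"
  using quasi_ray_image[OF g(1)] bd_eqI[OF g] s by metis

text \<open>A ray to u is within bounded distance of its image under \<open>f' \<circ> f\<close>, so it tracks both ends.\<close>

lemma bd_left_inverse:
  assumes u: "u \<in> ends"
  shows "boundary_map f' (bd u) = u"
proof -
  interpret I: quasi_isometry f' f L C by (rule inverse_quasi_isometry)
  let ?F = "toward undefined u"
  let ?v = "boundary_map f' (bd u)"
  have v: "?v \<in> ends" using I.bd_spec(1) bd_spec(1) u by blast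
  have "tracks (\<lambda>t. f' (f (?F t))) ?v"
    using I.tracks_boundary_map[OF bd_spec(1)[OF u] bd_spec(2)[OF u]] .
  then obtain x r where r: "\<And>t. 0 \<le> t \<Longrightarrow> \<exists>s\<ge>0. dist (f' (f (?F t))) (toward x ?v s) \<le> r"
    by (auto simp: tracks_def)
  have "\<exists>s\<ge>0. dist (?F t) (toward x ?v s) \<le> r + C" if t: "0 \<le> t" for t
  proof -
    obtain s where s: "0 \<le> s" "dist (f' (f (?F t))) (toward x ?v s) \<le> r" using r t by blast
    then have "dist (?F t) (toward x ?v s) \<le> r + C"
      using left[of "?F t"] dist_triangle3[of "?F t" "toward x ?v s" "f' (f (?F t))"] by linarith
    then show ?thesis using s by blast
  qed
  then have "tracks ?F ?v" unfolding tracks_def by blast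
  moreover have "tracks ?F u" using A.ray_tracks[OF A.toward_ray[OF u]] A.end_of_toward[OF u] by metis
  moreover have "\<exists>t\<ge>0. M \<le> dist (?F 0) (?F t)" for M
    using A.dist_toward[OF u, of "\<bar>M\<bar>" undefined] u by (intro exI[of _ "\<bar>M\<bar>"]) simp
  ultimately show ?thesis using A.tracks_unique[OF v u] by blast
qed

lemma bd_inj: "u \<in> ends \<Longrightarrow> v \<in> ends \<Longrightarrow> bd u = bd v \<Longrightarrow> u = v"
  using bd_left_inverse by metis

lemma bd_bij: "bij_betw bd ends ends"
proof (rule bij_betw_byWitness[where f' = "boundary_map f'"])
  interpret I: quasi_isometry f' f L C by (rule inverse_quasi_isometry)
  show "\<forall>v\<in>ends. bd (boundary_map f' v) = v" using I.bd_left_inverse by blast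
  show "boundary_map f' ` ends \<subseteq> ends" using I.bd_spec(1) by blast
qed (use bd_left_inverse bd_spec in auto)

text \<open>The distance within which the image of an apartment follows an apartment.\<close>

definition near_const :: real where "near_const = L * (L * (2 * (L + C)) + C) + C + (L + C)"

text \<open>Far out, the apartment between the image ends has points close to the path F, the image of the apartment \<open>(u,v)\<close>, on both sides.
So the projection q of F t lies between F t and a point of F at a later time, and also between
F t and a point at an earlier time. Therefore F comes close to q both before and after t.
These two times are close to each other, because F is a quasi-isometric embedding, and F t is close to q.\<close>

lemma apartment_image_near:
  assumes e: "u \<in> ends" "v \<in> ends" "u \<noteq> v"
  shows "opp x u v \<Longrightarrow> \<exists>y. opp y (bd u) (bd v) \<and> dist (f x) y \<le> near_const"
    "opp y (bd u) (bd v) \<Longrightarrow> \<exists>x. opp x u v \<and> dist y (f x) \<le> near_const"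
proof -
  define u' v' where "u' = bd u" and "v' = bd v"
  have e': "u' \<in> ends" "v' \<in> ends" "u' \<noteq> v'"
    using bd_spec(1) bd_inj e by (auto simp: u'_def v'_def)
  define J where "J = L + C"
  have J: "0 \<le> J" using L C_nonneg by (simp add: J_def)
  obtain o' where "opp o' u v" using A.opp_exists e by blast
  then obtain g where g: "geodesic UNIV g" "end_of (\<lambda>t. g (- t)) = u" "end_of g = v"
    using A.line_between_ends e by blast
  define F where "F t = f (g t)" for t
  have Fup: "dist (F s) (F t) \<le> L * \<bar>s - t\<bar> + C" and Flow: "\<bar>s - t\<bar> \<le> L * dist (F s) (F t) + C" for s t
    using up[of "g s" "g t"] low[of "g s" "g t"] line_dist[OF g(1)] by (simp_all add: F_def)
  have jump: "dist (F s) (F t) \<le> J" if "s \<le> t" "t \<le> s + 1" for s t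
  proof -
    have "L * \<bar>s - t\<bar> \<le> L * 1" using that L by (intro mult_left_mono) auto
    then show ?thesis using Fup[of s t] by (simp add: J_def)
  qed
  have near: "\<exists>t. a \<le> t \<and> t \<le> b \<and> dist p (F t) \<le> J" if "a \<le> b" "btw (F a) p (F b)" for a b p
    using B.path_near_geodesic[of a b F J p] jump that by auto
  have far: "\<exists>s>J. \<exists>b\<ge>N. dist (toward y w s) (f (d b)) \<le> J"
    if d: "geodesic {0..} d" "end_of d \<in> ends" "w = bd (end_of d)" "w \<in> ends" for y w d N
  proof -
    obtain a c where ac: "0 \<le> a" "0 \<le> c" "toward y w a = toward (f (d 0)) w c"
      using B.toward_merge[OF d(4), of y "f (d 0)"] by blast
    \<comment> \<open>The first summands make the point farther than J from y; the others force the time b beyond N.\<close>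
    define r where "r = J + 1 + L * \<bar>N\<bar> + C + J"
    have r: "0 \<le> r" "r > J"
    proof -
      have "0 \<le> L * \<bar>N\<bar>" using L by simp
      then show "0 \<le> r" "r > J" using J C_nonneg unfolding r_def by linarith+
    qed
    have z: "toward y w (a + r) = toward (f (d 0)) w (c + r)"
      using B.toward_merge_add[OF d(4) ac(1,2) r(1) ac(3)] .
    obtain b where b: "b \<ge> 0" "dist (toward y w (a + r)) (f (d b)) \<le> J"
      using quasi_ray_image_near[OF d(1) refl, of "c + r"] ac r(1) z d(3) by (auto simp: J_def)
    have "c + r = dist (f (d 0)) (toward y w (a + r))"
      using z B.dist_toward[OF d(4), of "c + r" "f (d 0)"] ac r by simp
    also have "\<dots> \<le> dist (f (d 0)) (f (d b)) + J"
      using b dist_triangle2[of "f (d 0)" "toward y w (a + r)" "f (d b)"] by linarith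
    also have "\<dots> \<le> L * b + C + J"
      using up[of "d 0" "d b"] ray_dist[OF d(1), of 0 b] b by simp
    finally have "L * \<bar>N\<bar> \<le> L * b" using ac J by (simp add: r_def)
    then have "b \<ge> N" using L by simp
    then show ?thesis using b r ac by (intro exI[of _ "a + r"]) auto
  qed
  have farv: "\<exists>s>J. \<exists>b\<ge>N. dist (toward y v' s) (F b) \<le> J" for y N
    using far[OF line_is_ray[OF g(1)]] g e e' by (simp add: F_def v'_def)
  have faru: "\<exists>s>J. \<exists>b\<ge>N. dist (toward y u' s) (F (- b)) \<le> J" for y N
    using far[OF line_rev_is_ray[OF g(1)]] g e e' by (simp add: F_def u'_def)
  have range: "range g = {x. opp x u v}" using A.range_line[OF g(1)] g by simp
  have shorten: "btw p q (F b)"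
    if "w \<in> ends" "J < s" "dist (toward q w s) (F b) \<le> J" "btw p q (toward q w s)" for p q w s b
  proof -
    have "dist q (toward q w s) = s" using B.dist_toward that J by simp
    then have "\<not> btw (F b) q (toward q w s)"
      using that(2,3) zero_le_dist[of "F b" q] dist_commute[of "F b" "toward q w s"]
      unfolding btw_def by linarith
    then show ?thesis using B.btw_split[OF that(4)] by blast
  qed
  {
    assume x: "opp x u v"
    then obtain t where t: "x = g t" using range by blast
    obtain q where q: "opp q u' v'" "\<And>s. s \<ge> 0 \<Longrightarrow> btw (F t) q (toward q u' s)"
      "\<And>s. s \<ge> 0 \<Longrightarrow> btw (F t) q (toward q v' s)" using B.projection_to_apartment[OF e'] by blast
    obtain s b where b: "s > J" "b \<ge> \<bar>t\<bar>" "dist (toward q v' s) (F b) \<le> J" using farv by blast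
    obtain r a where a: "r > J" "a \<ge> \<bar>t\<bar>" "dist (toward q u' r) (F (- a)) \<le> J" using faru by blast
    have "btw (F t) q (F b)" using shorten[OF e'(2) b(1,3)] q(3)[of s] b J by simp
    then obtain s1 where s1: "t \<le> s1" "dist q (F s1) \<le> J" using near[of t b q] b by force
    have "btw (F t) q (F (- a))" using shorten[OF e'(1) a(1,3)] q(2)[of r] a J by simp
    then have "btw (F (- a)) q (F t)" by (simp add: btw_sym)
    then obtain s0 where s0: "s0 \<le> t" "dist q (F s0) \<le> J" using near[of "- a" t q] a by force
    have "dist (F s0) (F s1) \<le> 2 * J" using s0 s1 dist_triangle3[of "F s0" "F s1" q] by linarith
    then have "L * dist (F s0) (F s1) \<le> L * (2 * J)" using L by simp
    then have "t - s0 \<le> L * (2 * J) + C" using Flow[of s0 s1] s0 s1 by simp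
    then have "L * (t - s0) \<le> L * (L * (2 * J) + C)" using L by simp
    then have "dist (F t) q \<le> L * (L * (2 * J) + C) + C + J"
      using Fup[of t s0] s0 dist_triangle2[of "F t" q "F s0"] by simp
    then show "\<exists>y. opp y (bd u) (bd v) \<and> dist (f x) y \<le> near_const"
      using q(1) t by (auto simp: near_const_def J_def F_def u'_def v'_def)
  }
  {
    assume "opp y (bd u) (bd v)"
    then have y: "opp y u' v'" by (simp add: u'_def v'_def)
    obtain s b where b: "s > J" "b \<ge> 0" "dist (toward y v' s) (F b) \<le> J" using farv by blast
    obtain r a where a: "r > J" "a \<ge> 0" "dist (toward y u' r) (F (- a)) \<le> J" using faru by blast
    have "btw (toward y u' r) y (toward y v' s)" using B.opp_btw[OF e'(1,2) _ _ y] a b J by simp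
    then have "btw (toward y u' r) y (F b)" using shorten[OF e'(2) b(1,3)] by simp
    then have "btw (F b) y (toward y u' r)" by (simp add: btw_sym)
    then have "btw (F b) y (F (- a))" using shorten[OF e'(1) a(1,3)] by simp
    then have "btw (F (- a)) y (F b)" by (simp add: btw_sym)
    then obtain t where t: "dist y (F t) \<le> J" using near[of "- a" b y] a b by force
    have "J \<le> near_const" using L C_nonneg by (simp add: near_const_def J_def)
    then show "\<exists>x. opp x u v \<and> dist y (f x) \<le> near_const"
      using t range by (intro exI[of _ "g t"]) (auto simp: F_def)
  }
qed

lemma center_image_near:
  assumes e: "u \<in> ends" "v \<in> ends" "w \<in> ends" "u \<noteq> v" "v \<noteq> w" "u \<noteq> w"
  shows "dist (f (center u v w)) (center (bd u) (bd v) (bd w)) \<le> near_const"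
proof -
  have e': "bd u \<in> ends" "bd v \<in> ends" "bd w \<in> ends"
    "bd u \<noteq> bd v" "bd v \<noteq> bd w" "bd u \<noteq> bd w"
    using bd_spec(1) bd_inj e by auto
  note z = A.center_opp[OF e]
  obtain y1 where "opp y1 (bd u) (bd v)" "dist (f (center u v w)) y1 \<le> near_const"
    using apartment_image_near(1)[OF e(1,2,4) z(1)] by blast
  moreover obtain y2 where "opp y2 (bd v) (bd w)" "dist (f (center u v w)) y2 \<le> near_const"
    using apartment_image_near(1)[OF e(2,3,5) z(2)] by blast
  moreover obtain y3 where "opp y3 (bd u) (bd w)" "dist (f (center u v w)) y3 \<le> near_const"
    using apartment_image_near(1)[OF e(1,3,6) z(3)] by blast
  ultimately show ?thesis using B.near_center[OF e'(1-3) B.center_opp[OF e']] by blast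
qed

lemma apartment_image_eq:
  assumes e: "u \<in> ends" "v \<in> ends" "u \<noteq> v"
  shows "apartment_image f {x. opp x u v} = {y. opp y (bd u) (bd v)}"
  unfolding apartment_image_def
proof (rule the_equality)
  have e': "bd u \<in> ends" "bd v \<in> ends" "bd u \<noteq> bd v"
    using bd_spec(1) bd_inj e by auto
  let ?B = "{y. opp y (bd u) (bd v)}"
  have "finite_hausdorff_distance ?B (f ` {x. opp x u v})"
    unfolding finite_hausdorff_distance_def using apartment_image_near[OF e]
    by (intro exI[of _ near_const]) (auto, metis dist_commute)
  then show "apartment ?B \<and> finite_hausdorff_distance ?B (f ` {x. opp x u v})"
    using B.apartment_iff[of ?B] e' by auto
  fix B assume B: "apartment B \<and> finite_hausdorff_distance B (f ` {x. opp x u v})"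
  then obtain a b where ab: "a \<in> ends" "b \<in> ends" "a \<noteq> b" "B = {y. opp y a b}" using B.apartment_iff by blast
  obtain r where r: "\<And>y. opp y a b \<Longrightarrow> \<exists>x. opp x u v \<and> dist y (f x) \<le> r"
    using B ab(4) by (auto simp: finite_hausdorff_distance_def)
  have "{a, b} = {bd u, bd v}"
  proof (rule B.hausdorff_apartments_eq[OF ab(1,2) e'(1,2) ab(3) e'(3)])
    fix y assume "opp y a b"
    then obtain x where x: "opp x u v" "dist y (f x) \<le> r" using r by blast
    obtain y' where y': "opp y' (bd u) (bd v)" "dist (f x) y' \<le> near_const"
      using apartment_image_near(1)[OF e x(1)] by blast
    then show "\<exists>y'. opp y' (bd u) (bd v) \<and> dist y y' \<le> r + near_const"
      using x dist_triangle[of y y' "f x"] by (intro exI[of _ y']) auto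
  qed
  then show "B = ?B" using ab(4) B.opp_sym by (auto simp: doubleton_eq_iff)
qed

text \<open>Uniqueness is where three ends are used: the image of u is the only common end of the images of \<open>(u,v)\<close> and \<open>(u,w)\<close>
for two further ends v and w.\<close>

lemma induced_map_eq:
  assumes three: "\<exists>u\<in>ends. \<exists>v\<in>ends. \<exists>w\<in>(ends :: 'a set set set). u \<noteq> v \<and> v \<noteq> w \<and> w \<noteq> u"
  shows "induced_map f = restrict bd ends"
  unfolding induced_map_def
proof (rule the_equality)
  have ne: "bd u \<in> ends" "bd v \<in> ends" "bd u \<noteq> bd v"
    if "u \<in> ends" "v \<in> ends" "u \<noteq> v" for u v
    using that bd_spec(1) bd_inj by auto
  have ap: "apartment_image f (apartment_between u v) = apartment_between (bd u) (bd v)"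
    if "u \<in> ends" "v \<in> ends" "u \<noteq> v" for u v
    using apartment_image_eq[OF that] A.apartment_between_eq[OF that] B.apartment_between_eq[OF ne[OF that]] by simp
  have bij: "bij_betw (restrict bd ends) ends ends"
    using bd_bij by (simp cong: bij_betw_cong)
  show "restrict bd ends \<in> extensional ends \<and> bij_betw (restrict bd ends) ends ends \<and>
    (\<forall>u\<in>ends. \<forall>v\<in>ends. u \<noteq> v \<longrightarrow> apartment_image f (apartment_between u v) =
      apartment_between (restrict bd ends u) (restrict bd ends v))"
    using ap bij by simp
  fix b assume b: "b \<in> extensional ends \<and> bij_betw b ends ends \<and>
    (\<forall>u\<in>ends. \<forall>v\<in>ends. u \<noteq> v \<longrightarrow> apartment_image f (apartment_between u v) = apartment_between (b u) (b v))"
  have bne: "b u \<in> ends" "b v \<in> ends" "b u \<noteq> b v" if "u \<in> ends" "v \<in> ends" "u \<noteq> v" for u v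
    using b that by (auto simp: bij_betw_def inj_on_def)
  have set: "{b u, b v} = {bd u, bd v}" if "u \<in> ends" "v \<in> ends" "u \<noteq> v" for u v
  proof -
    have "apartment_between (b u) (b v) = apartment_between (bd u) (bd v)"
      using b ap that by metis
    then have "{y. opp y (b u) (b v)} = {y. opp y (bd u) (bd v)}"
      using B.apartment_between_eq[OF ne[OF that]] B.apartment_between_eq[OF bne[OF that]] by simp
    then show ?thesis using B.ends_of_opp[OF ne[OF that]] B.ends_of_opp[OF bne[OF that]] by simp
  qed
  show "b = restrict bd ends"
  proof (rule extensionalityI[of _ ends])
    fix u :: "'a set set" assume u: "u \<in> ends"
    obtain v w :: "'a set set" where vw: "v \<in> ends" "w \<in> ends" "u \<noteq> v" "u \<noteq> w" "v \<noteq> w"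
      using three by metis
    show "b u = restrict bd ends u"
      using set[OF u vw(1,3)] set[OF u vw(2,4)] ne(3)[OF vw(1,2,5)] u by (auto simp: doubleton_eq_iff)
  qed (use b in auto)
qed

end

text \<open>In a geodesic space, a bound for the images of points at distance at most one can be added up along
unit steps.\<close>

lemma (in leafless_real_tree) controlled_imp_coarsely_lipschitz:
  fixes f :: "'a \<Rightarrow> 'b::metric_space"
  assumes "controlled f"
  shows "\<exists>L\<ge>0. \<forall>x y. dist (f x) (f y) \<le> L * dist x y + L"
proof -
  obtain \<rho> where \<rho>: "mono_on {0..} \<rho>" "\<And>x y. dist (f x) (f y) \<le> \<rho> (dist x y)"
    using assms by (auto simp: controlled_def)
  define L where "L = \<rho> 1"
  have short: "dist (f x) (f y) \<le> L" if "dist x y \<le> 1" for x y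
    using \<rho>(2)[of x y] mono_onD[OF \<rho>(1), of "dist x y" 1] that by (simp add: L_def)
  have L: "0 \<le> L" using short[of undefined undefined] by simp
  have steps: "dist (f x) (f y) \<le> real n * L" if "dist x y \<le> real n" for n x y
    using that
  proof (induction n arbitrary: x)
    case 0
    then show ?case by simp
  next
    case (Suc n)
    obtain z where z: "btw x z y" "dist x z = min 1 (dist x y)" using btw_exists[of "min 1 (dist x y)" x y] by auto
    have "dist z y \<le> real n" using z Suc.prems unfolding btw_def by simp
    then have "dist (f z) (f y) \<le> real n * L" by (rule Suc.IH)
    moreover have "dist (f x) (f z) \<le> L" using short z by simp
    ultimately show ?case using dist_triangle[of "f x" "f y" "f z"] by (simp add: algebra_simps)
  qed
  have "dist (f x) (f y) \<le> L * dist x y + L" for x y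
  proof -
    let ?n = "nat \<lceil>dist x y\<rceil>"
    have n: "dist x y \<le> real ?n" "real ?n \<le> dist x y + 1"
      using real_nat_ceiling_ge[of "dist x y"] of_int_ceiling_le_add_one[of "dist x y"] by auto
    have "dist (f x) (f y) \<le> real ?n * L" using steps n by blast
    also have "\<dots> \<le> (dist x y + 1) * L" using n L by (intro mult_right_mono) auto
    finally show ?thesis by (simp add: algebra_simps)
  qed
  then show ?thesis using L by blast
qed

lemma coarse_equivalence_imp_quasi_isometry:
  fixes f :: "'a::metric_space \<Rightarrow> 'b::metric_space"
  assumes A: "leafless_tree TYPE('a)" and B: "leafless_tree TYPE('b)" and f: "coarse_equivalence f"
  shows "\<exists>f' L C. quasi_isometry f f' L C"
proof -
  interpret A: leafless_real_tree "TYPE('a)" by unfold_locales (rule A)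
  interpret B: leafless_real_tree "TYPE('b)" by unfold_locales (rule B)
  obtain g where g: "controlled g" "finite_distance (g \<circ> f) id" "finite_distance (f \<circ> g) id" "controlled f"
    using f by (auto simp: coarse_equivalence_def coarse_def)
  obtain K1 where K1: "\<And>x. dist (g (f x)) x \<le> K1"
    using g(2) by (auto simp: finite_distance_def bounded_real)
  obtain K2 where K2: "\<And>x. dist (f (g x)) x \<le> K2"
    using g(3) by (auto simp: finite_distance_def bounded_real)
  obtain L1 where L1: "0 \<le> L1" "\<And>x y. dist (f x) (f y) \<le> L1 * dist x y + L1"
    using A.controlled_imp_coarsely_lipschitz[OF g(4)] by blast
  obtain L2 where L2: "0 \<le> L2" "\<And>x y. dist (g x) (g y) \<le> L2 * dist x y + L2"
    using B.controlled_imp_coarsely_lipschitz[OF g(1)] by blast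
  define L where "L = L1 + L2 + 1"
  define K where "K = \<bar>K1\<bar> + \<bar>K2\<bar>"
  define C where "C = L + 2 * K"
  have L: "0 < L" "L1 \<le> L" "L2 \<le> L" using L1 L2 by (auto simp: L_def)
  have K: "0 \<le> K" "\<And>x. dist (g (f x)) x \<le> K" "\<And>x. dist (f (g x)) x \<le> K"
  proof -
    show "dist (g (f x)) x \<le> K" for x using K1[of x] by (simp add: K_def)
    show "dist (f (g x)) x \<le> K" for x using K2[of x] by (simp add: K_def)
  qed (simp add: K_def)
  have fu: "dist (f x) (f y) \<le> L * dist x y + L" for x y
    using L1(2)[of x y] mult_right_mono[OF L(2), of "dist x y"] L by simp
  have gu: "dist (g x) (g y) \<le> L * dist x y + L" for x y
    using L2(2)[of x y] mult_right_mono[OF L(3), of "dist x y"] L by simp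
  have "quasi_isometry f g L C"
  proof unfold_locales
    fix x y :: 'a and p q :: 'b
    show "0 < L" by (rule L)
    show "dist (f x) (f y) \<le> L * dist x y + C" using fu[of x y] K by (simp add: C_def)
    show "dist (g p) (g q) \<le> L * dist p q + C" using gu[of p q] K by (simp add: C_def)
    show "dist (g (f x)) x \<le> C" using K(1) K(2)[of x] L by (simp add: C_def)
    show "dist (f (g p)) p \<le> C" using K(1) K(3)[of p] L by (simp add: C_def)
    have "dist x y \<le> dist (g (f x)) (g (f y)) + 2 * K"
      using K(2)[of x] K(2)[of y] dist_triangle3[of x "g (f y)" "g (f x)"] dist_triangle[of x y "g (f y)"] by linarith
    then show "dist x y \<le> L * dist (f x) (f y) + C" using gu[of "f x" "f y"] by (simp add: C_def)
    have "dist p q \<le> dist (f (g p)) (f (g q)) + 2 * K"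
      using K(3)[of p] K(3)[of q] dist_triangle3[of p "f (g q)" "f (g p)"] dist_triangle[of p q "f (g q)"] by linarith
    then show "dist p q \<le> L * dist (g p) (g q) + C" using fu[of "g p" "g q"] by (simp add: C_def)
  qed
  then show ?thesis by blast
qed

section \<open>Comparison of the two actions\<close>

lemma linear_bound_slope:
  fixes a b c :: real
  assumes "\<And>n::nat. real n * a \<le> real n * b + c"
  shows "a \<le> b"
proof (rule ccontr)
  assume "\<not> a \<le> b"
  then obtain n :: nat where "c < real n * (a - b)" using reals_Archimedean3[of "a - b"] by auto
  then show False using assms[of n] by (simp add: algebra_simps)
qed

lemma similarity_quasi_isometry:
  fixes h :: "'a::metric_space \<Rightarrow> 'b::metric_space"
  assumes "leafless_tree TYPE('a)" "leafless_tree TYPE('b)" and s: "similarity h k"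
  shows "quasi_isometry h (inv_into UNIV h) (k + 1 / k) 0"
proof -
  interpret S: similarity h k by (rule s)
  interpret I: similarity "inv_into UNIV h" "1 / k" by (rule S.inverse_similarity)
  have b: "c * d \<le> (k + 1 / k) * d" "d \<le> (k + 1 / k) * (c * d)" if "c = k \<or> c = 1 / k" "0 \<le> d" for c d
  proof -
    have "c \<le> k + 1 / k" using that S.k_pos by auto
    then show "c * d \<le> (k + 1 / k) * d" using that by (intro mult_right_mono)
    have "1 \<le> (k + 1 / k) * c" using that S.k_pos by (auto simp: algebra_simps)
    then show "d \<le> (k + 1 / k) * (c * d)" using that mult_right_mono[of 1 "(k + 1 / k) * c" d] by (simp add: mult.assoc)
  qed
  show ?thesis
  proof (unfold_locales)
    show "dist (inv_into UNIV h (h x)) x \<le> 0" for x using S.inj_h by simp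
    show "dist (h (inv_into UNIV h p)) p \<le> 0" for p using S.surj_h by (simp add: surj_f_inv_f)
    show "0 < k + 1 / k" using S.k_pos by (simp add: add_pos_pos)
  qed (use assms b in \<open>simp_all add: S.dist_h I.dist_h del: times_divide_eq_left\<close>)
qed

text \<open>A similarity maps rays to rays, so the end tracked by the image of a ray is the image end.\<close>

lemma similarity_induced_map:
  fixes h :: "'a::metric_space \<Rightarrow> 'b::metric_space"
  assumes lf: "leafless_tree TYPE('a)" "leafless_tree TYPE('b)" and s: "similarity h k"
    and three: "\<exists>u\<in>ends. \<exists>v\<in>ends. \<exists>w\<in>(ends :: 'a set set set). u \<noteq> v \<and> v \<noteq> w \<and> w \<noteq> u"
  shows "induced_map h = restrict (end_image h) ends"
proof -
  interpret S: similarity h k by (rule s)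
  interpret Q: quasi_isometry h "inv_into UNIV h" "k + 1 / k" 0
    by (rule similarity_quasi_isometry[OF lf s])
  have "boundary_map h u = end_image h u" if u: "u \<in> ends" for u
  proof (rule Q.bd_eqI[OF S.A.toward_ray[OF u] S.A.end_of_toward[OF u] S.end_image_in_ends[OF u]])
    fix x
    have "h (toward x u t) = toward (h x) (end_image h u) (k * t)" if "0 \<le> t" for t
      using S.toward_image[OF u that] by simp
    then have "dist (h (toward x u t)) (toward (h x) (end_image h u) (k * t)) \<le> 0" if "0 \<le> t" for t
      using that by simp
    then show "tracks (\<lambda>t. h (toward x u t)) (end_image h u)"
      unfolding tracks_def using S.k_pos by (meson mult_nonneg_nonneg less_imp_le)
  qed
  then show ?thesis using Q.induced_map_eq[OF three] by (simp add: restrict_def fun_eq_iff)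
qed

locale equivariant_quasi_isometry =
  quasi_isometry f f' L C + G1: tree_action G \<phi>1 + G2: tree_action G \<phi>2
  for f :: "'a::metric_space \<Rightarrow> 'b::metric_space" and f' L C
    and G :: "('g, 'm) monoid_scheme" (structure)
    and \<phi>1 :: "'g \<Rightarrow> 'a \<Rightarrow> 'a" and \<phi>2 :: "'g \<Rightarrow> 'b \<Rightarrow> 'b" +
  assumes equivariant: "g \<in> carrier G \<Longrightarrow> u \<in> ends \<Longrightarrow>
      boundary_map f (end_action \<phi>1 g u) = end_action \<phi>2 g (boundary_map f u)"
    and two_transitive: "two_transitive_on ends G (end_action \<phi>1)"
    and three_ends: "\<exists>u\<in>ends. \<exists>v\<in>ends. \<exists>w\<in>(ends :: 'a set set set). u \<noteq> v \<and> v \<noteq> w \<and> w \<noteq> u"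
begin

definition triple :: "'a set set \<Rightarrow> 'a set set \<Rightarrow> 'a set set \<Rightarrow> bool" where
  "triple u v w \<longleftrightarrow> u \<in> ends \<and> v \<in> ends \<and> w \<in> ends \<and> u \<noteq> v \<and> v \<noteq> w \<and> u \<noteq> w"

abbreviation center' :: "'a set set \<Rightarrow> 'a set set \<Rightarrow> 'a set set \<Rightarrow> 'b" where
  "center' u v w \<equiv> center (bd u) (bd v) (bd w)"

lemma tripleD: "triple u v w \<Longrightarrow> u \<in> ends" "triple u v w \<Longrightarrow> v \<in> ends" "triple u v w \<Longrightarrow> w \<in> ends"
    "triple u v w \<Longrightarrow> u \<noteq> v" "triple u v w \<Longrightarrow> v \<noteq> w" "triple u v w \<Longrightarrow> u \<noteq> w"
  by (simp_all add: triple_def)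

lemma bd_triple: "triple u v w \<Longrightarrow> bd u \<in> ends" "triple u v w \<Longrightarrow> bd v \<in> ends" "triple u v w \<Longrightarrow> bd w \<in> ends"
  using bd_spec(1) by (simp_all add: triple_def)

lemma triple_swap: "triple u v w \<Longrightarrow> triple v u w" "triple u v w \<Longrightarrow> triple u w v"
  by (auto simp: triple_def)

lemma third_end: "\<exists>w. u \<in> ends \<and> v \<in> ends \<and> u \<noteq> v \<longrightarrow> triple u v w"
  using three_ends unfolding triple_def by metis

lemma other_ends: "u \<in> ends \<Longrightarrow> \<exists>v w. triple u v w"
  using three_ends unfolding triple_def by metis

lemma bd_ends: "u \<in> ends \<Longrightarrow> bd u \<in> ends"
  using bd_spec(1) .

lemma bd_neq: "u \<in> ends \<Longrightarrow> v \<in> ends \<Longrightarrow> u \<noteq> v \<Longrightarrow> bd u \<noteq> bd v"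
  using bd_inj by blast

lemma bd_surj: "u' \<in> ends \<Longrightarrow> \<exists>u\<in>ends. u' = bd u"
  using bd_bij unfolding bij_betw_def by blast

lemma center_opp1:
  assumes "triple u v w"
  shows "opp (center u v w) u v" "opp (center u v w) v w" "opp (center u v w) u w"
  using A.center_opp assms by (simp_all add: triple_def)

lemma center_opp2:
  assumes "triple u v w"
  shows "opp (center' u v w) (bd u) (bd v)" "opp (center' u v w) (bd v) (bd w)" "opp (center' u v w) (bd u) (bd w)"
  using B.center_opp[of "bd u" "bd v" "bd w"] assms bd_ends bd_neq by (simp_all add: triple_def)

lemma center_swap1:
  assumes "triple u v w"
  shows "center v u w = center u v w" "center u w v = center u v w"
  using A.center_swap assms by (simp_all add: triple_def)

lemma center_swap2:
  assumes "triple u v w"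
  shows "center' v u w = center' u v w" "center' u w v = center' u v w"
  using B.center_swap[of "bd u" "bd v" "bd w"] assms bd_ends bd_neq by (simp_all add: triple_def)

lemma triple_act: "g \<in> carrier G \<Longrightarrow> triple u v w \<Longrightarrow> triple (G1.E g u) (G1.E g v) (G1.E g w)"
  by (simp add: triple_def G1.E_in_ends G1.E_inj)

lemma center_act1:
  "g \<in> carrier G \<Longrightarrow> triple u v w \<Longrightarrow> center (G1.E g u) (G1.E g v) (G1.E g w) = \<phi>1 g (center u v w)"
  using G1.center_act by (simp add: triple_def)

lemma center_act2:
  assumes g: "g \<in> carrier G" and t: "triple u v w"
  shows "center' (G1.E g u) (G1.E g v) (G1.E g w) = \<phi>2 g (center' u v w)"
  using G2.center_act[OF g, of "bd u" "bd v" "bd w"] t g bd_ends bd_neq by (simp add: triple_def equivariant)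

lemma transitive_pairs:
  assumes "u \<in> ends" "v \<in> ends" "u' \<in> ends" "v' \<in> ends" "u \<noteq> v" "u' \<noteq> v'"
  shows "\<exists>g\<in>carrier G. G1.E g u = u' \<and> G1.E g v = v'"
  using two_transitive assms unfolding two_transitive_on_def by blast

lemma transitive: "u \<in> ends \<Longrightarrow> u' \<in> ends \<Longrightarrow> \<exists>g\<in>carrier G. G1.E g u = u'"
  using other_ends[of u] other_ends[of u'] transitive_pairs unfolding triple_def by metis

text \<open>The group permutes the centers in both trees in the same way. This lets translates of a
single center be compared, with a constant that does not depend on the group element.\<close>

lemma orbit_near:
  assumes t: "triple u v w" and g: "g \<in> carrier G"
  shows "dist (f (\<phi>1 g (center u v w))) (\<phi>2 g (center' u v w)) \<le> near_const"
  using center_image_near[of "G1.E g u" "G1.E g v" "G1.E g w"] triple_act[OF g t]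
    center_act1[OF g t] center_act2[OF g t] by (simp add: triple_def)

lemma bd_fixed: "g \<in> carrier G \<Longrightarrow> u \<in> ends \<Longrightarrow> G1.E g u = u \<Longrightarrow> G2.E g (bd u) = bd u"
  using equivariant[of g u] by simp

text \<open>Compare the growth of the orbit of a center in the two trees: f maps one orbit to within \<open>near_const\<close> of the
other, and additive constants disappear in the growth rate.\<close>

lemma shift_bounds:
  assumes g: "g \<in> carrier G" and u: "u \<in> ends" "G1.E g u = u"
  shows "\<bar>G2.shift (bd u) g\<bar> \<le> L * \<bar>G1.shift u g\<bar>" "\<bar>G1.shift u g\<bar> \<le> L * \<bar>G2.shift (bd u) g\<bar>"
proof -
  obtain v w where t: "triple u v w" using other_ends u by blast
  define x where "x = center u v w"
  define y where "y = center' u v w"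
  note u2 = bd_ends[OF u(1)] bd_fixed[OF g u]
  have near: "dist (f (\<phi>1 (g [^] n) x)) (\<phi>2 (g [^] n) y) \<le> near_const" for n :: nat
    using orbit_near[OF t] g by (simp add: x_def y_def)
  have near0: "dist (f x) y \<le> near_const" using near[of 0] by simp
  obtain D1 where D1: "\<And>n::nat. dist x (\<phi>1 (g [^] n) x) \<le> real n * \<bar>G1.shift u g\<bar> + D1"
    using G1.orbit_growth(2)[OF g u] by blast
  obtain D2 where D2: "\<And>n::nat. dist y (\<phi>2 (g [^] n) y) \<le> real n * \<bar>G2.shift (bd u) g\<bar> + D2"
    using G2.orbit_growth(2)[OF g u2] by blast
  have L0: "0 \<le> L" using L by simp
  have "real n * \<bar>G2.shift (bd u) g\<bar> \<le> real n * (L * \<bar>G1.shift u g\<bar>) + (L * D1 + C + 2 * near_const)" for n :: nat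
  proof -
    have "real n * \<bar>G2.shift (bd u) g\<bar> \<le> dist y (\<phi>2 (g [^] n) y)" by (rule G2.orbit_growth(1)[OF g u2])
    also have "\<dots> \<le> dist (f x) (f (\<phi>1 (g [^] n) x)) + 2 * near_const"
      using near[of n] near0 dist_triangle3[of y "\<phi>2 (g [^] n) y" "f x"]
        dist_triangle[of "f x" "\<phi>2 (g [^] n) y" "f (\<phi>1 (g [^] n) x)"] by linarith
    also have "\<dots> \<le> L * dist x (\<phi>1 (g [^] n) x) + C + 2 * near_const" using up by simp
    also have "\<dots> \<le> L * (real n * \<bar>G1.shift u g\<bar> + D1) + C + 2 * near_const"
      using mult_left_mono[OF D1[of n] L0] by simp
    finally show ?thesis by (simp add: algebra_simps)
  qed
  then show "\<bar>G2.shift (bd u) g\<bar> \<le> L * \<bar>G1.shift u g\<bar>" by (rule linear_bound_slope)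
  have "real n * \<bar>G1.shift u g\<bar> \<le> real n * (L * \<bar>G2.shift (bd u) g\<bar>) + (L * (D2 + 2 * near_const) + C)" for n :: nat
  proof -
    have "real n * \<bar>G1.shift u g\<bar> \<le> dist x (\<phi>1 (g [^] n) x)" by (rule G1.orbit_growth(1)[OF g u])
    also have "\<dots> \<le> L * dist (f x) (f (\<phi>1 (g [^] n) x)) + C" using low .
    also have "\<dots> \<le> L * (dist y (\<phi>2 (g [^] n) y) + 2 * near_const) + C"
    proof -
      have "dist (f x) (f (\<phi>1 (g [^] n) x)) \<le> dist y (\<phi>2 (g [^] n) y) + 2 * near_const"
        using near[of n] near0 dist_triangle[of "f x" "f (\<phi>1 (g [^] n) x)" y]
          dist_triangle2[of y "f (\<phi>1 (g [^] n) x)" "\<phi>2 (g [^] n) y"] by linarith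
      then show ?thesis using mult_left_mono[OF _ L0] by simp
    qed
    also have "\<dots> \<le> L * (real n * \<bar>G2.shift (bd u) g\<bar> + D2 + 2 * near_const) + C"
      using mult_left_mono[OF add_right_mono[OF D2[of n], of "2 * near_const"] L0] by simp
    finally show ?thesis by (simp add: algebra_simps)
  qed
  then show "\<bar>G1.shift u g\<bar> \<le> L * \<bar>G2.shift (bd u) g\<bar>" by (rule linear_bound_slope)
qed

text \<open>If m is the integer part of \<open>n b / a\<close>, then \<open>h\<^sup>n g\<^sup>-\<^sup>m\<close> has bounded translation length in the first tree, hence
in the second. Dividing by n gives the claim in the limit.\<close>

lemma shift_proportional:
  assumes g: "g \<in> carrier G" and h: "h \<in> carrier G" and u: "u \<in> ends" "G1.E g u = u" "G1.E h u = u"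
    and nz: "G1.shift u g \<noteq> 0"
  shows "G2.shift (bd u) h = G2.shift (bd u) g / G1.shift u g * G1.shift u h"
proof -
  define a b where "a = G1.shift u g" and "b = G1.shift u h"
  define a' b' where "a' = G2.shift (bd u) g" and "b' = G2.shift (bd u) h"
  note u2 = bd_ends[OF u(1)] bd_fixed[OF g u(1,2)] bd_fixed[OF h u(1,3)]
  have est: "real n * \<bar>b' - b / a * a'\<bar> \<le> real n * 0 + (L * \<bar>a\<bar> + \<bar>a'\<bar>)" for n :: nat
  proof -
    define m where "m = \<lfloor>real n * b / a\<rfloor>"
    define q where "q = real n * b / a - of_int m"
    have q: "0 \<le> q" "q \<le> 1" unfolding q_def m_def by linarith+
    let ?k = "h [^] (int n) \<otimes> g [^] (- m)"
    have fx: "G1.E (h [^] int n) u = u" "G1.E (g [^] (- m)) u = u"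
      "G2.E (h [^] int n) (bd u) = bd u" "G2.E (g [^] (- m)) (bd u) = bd u"
      by (rule G1.E_int_pow[OF h u(3)] G1.E_int_pow[OF g u(2)] G2.E_int_pow[OF h u2(3)] G2.E_int_pow[OF g u2(2)])+
    note cl = G1.int_pow_closed[OF h, of "int n"] G1.int_pow_closed[OF g, of "- m"]
    have "G1.shift u ?k = real n * b - of_int m * a"
      using G1.shift_mult[OF cl u(1) fx(1,2)] G1.shift_int_pow[OF h u(1,3)] G1.shift_int_pow[OF g u(1,2)]
      by (simp add: a_def b_def)
    also have "\<dots> = q * a" using nz by (simp add: q_def a_def field_simps)
    finally have "\<bar>G1.shift u ?k\<bar> \<le> \<bar>a\<bar>" using q mult_right_mono[of q 1 "\<bar>a\<bar>"] by (simp add: abs_mult)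
    moreover have "G2.shift (bd u) ?k = real n * b' - of_int m * a'"
      using G2.shift_mult[OF cl u2(1) fx(3,4)] G2.shift_int_pow[OF h u2(1,3)] G2.shift_int_pow[OF g u2(1,2)]
      by (simp add: a'_def b'_def)
    moreover have "\<bar>G2.shift (bd u) ?k\<bar> \<le> L * \<bar>G1.shift u ?k\<bar>"
      using shift_bounds(1)[OF G1.m_closed[OF cl] u(1)] G1.E_mult[OF cl] fx by simp
    moreover have "L * \<bar>G1.shift u ?k\<bar> \<le> L * \<bar>a\<bar>" using calculation(1) L by simp
    ultimately have "\<bar>real n * b' - of_int m * a'\<bar> \<le> L * \<bar>a\<bar>" by linarith
    moreover have "real n * (b' - b / a * a') = (real n * b' - of_int m * a') - q * a'"
      by (simp add: q_def algebra_simps)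
    moreover have "\<bar>q * a'\<bar> \<le> \<bar>a'\<bar>" using q mult_right_mono[of q 1 "\<bar>a'\<bar>"] by (simp add: abs_mult)
    ultimately have "\<bar>real n * (b' - b / a * a')\<bar> \<le> L * \<bar>a\<bar> + \<bar>a'\<bar>"
      using abs_triangle_ineq4[of "real n * b' - of_int m * a'" "q * a'"] by (metis add_mono order_trans)
    then show ?thesis by (simp add: abs_mult)
  qed
  have "\<bar>b' - b / a * a'\<bar> \<le> 0" using linear_bound_slope[OF est] by simp
  then show ?thesis by (simp add: a_def b_def a'_def b'_def)
qed

text \<open>The orbit of a center z under g follows the ray from z to u. Its image under f follows a ray to \<open>bd u\<close>, so
the orbit in the second tree cannot recede from \<open>bd u\<close>. By \<open>shift_bounds\<close> the translation length there is
not zero.\<close>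

lemma shift_pos:
  assumes g: "g \<in> carrier G" and u: "u \<in> ends" "G1.E g u = u" and pos: "0 < G1.shift u g"
  shows "0 < G2.shift (bd u) g"
proof -
  obtain v w where t: "triple u v w" using other_ends u by blast
  define z where "z = center u v w"
  define z' where "z' = center' u v w"
  note u2 = bd_ends[OF u(1)] bd_fixed[OF g u]
  obtain b where b: "0 \<le> b"
    and orbit: "\<And>n::nat. \<phi>1 (g [^] n) (toward z u b) = toward z u (b + real n * G1.shift u g)"
    using G1.orbit_along_ray[OF g u pos] by blast
  have "tracks (toward z u) u" using A.ray_tracks[OF A.toward_ray[OF u(1)]] A.end_of_toward[OF u(1)] by metis
  then have "tracks (\<lambda>t. f (toward z u t)) (bd u)" by (rule tracks_boundary_map[OF u(1)])
  then obtain r where r: "\<And>t. 0 \<le> t \<Longrightarrow> \<exists>s\<ge>0. dist (f (toward z u t)) (toward z' (bd u) s) \<le> r"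
    using B.tracksD[OF u2(1)] by blast
  have "real n * (- G2.shift (bd u) g) \<le> real n * 0 + (near_const + (L * b + C) + r)" for n :: nat
  proof -
    let ?y = "toward z u (b + real n * G1.shift u g)"
    obtain s where s: "0 \<le> s" "dist (f ?y) (toward z' (bd u) s) \<le> r"
      using r[of "b + real n * G1.shift u g"] b pos by auto
    have "dist (\<phi>1 (g [^] n) z) ?y = b"
      using orbit[of n] G1.dist_act[of "g [^] n" z "toward z u b"] A.dist_toward[OF u(1) b] g by simp
    then have "dist (f (\<phi>1 (g [^] n) z)) (f ?y) \<le> L * b + C" using up[of "\<phi>1 (g [^] n) z" ?y] by simp
    moreover have "dist (f (\<phi>1 (g [^] n) z)) (\<phi>2 (g [^] n) z') \<le> near_const"
      using orbit_near[OF t] g by (simp add: z_def z'_def)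
    ultimately have d: "dist (\<phi>2 (g [^] n) z') (toward z' (bd u) s) \<le> near_const + (L * b + C) + r"
      using s dist_triangle3[of "\<phi>2 (g [^] n) z'" "f ?y" "f (\<phi>1 (g [^] n) z)"]
        dist_triangle[of "\<phi>2 (g [^] n) z'" "toward z' (bd u) s" "f ?y"] by linarith
    have "bus (bd u) z' (\<phi>2 (g [^] n) z') = real n * G2.shift (bd u) g"
      using G2.bus_shift[OF _ u2(1) G2.E_pow[OF g u2(2)]] G2.shift_pow[OF g u2] g by simp
    moreover have "bus (bd u) z' (toward z' (bd u) s) = s" by (rule B.bus_toward[OF u2(1) s(1)])
    moreover have "bus (bd u) z' (\<phi>2 (g [^] n) z') + bus (bd u) (\<phi>2 (g [^] n) z') (toward z' (bd u) s)
        = bus (bd u) z' (toward z' (bd u) s)" by (rule B.bus_add[OF u2(1)])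
    ultimately show ?thesis using d s B.bus_le_dist[OF u2(1), of "\<phi>2 (g [^] n) z'" "toward z' (bd u) s"]
      by simp
  qed
  then have "- G2.shift (bd u) g \<le> 0" by (rule linear_bound_slope)
  moreover have "G2.shift (bd u) g \<noteq> 0" using shift_bounds(2)[OF g u] pos by auto
  ultimately show ?thesis by linarith
qed

definition compatible :: "real \<Rightarrow> bool" where
  "compatible l \<longleftrightarrow> (\<forall>u\<in>ends. \<forall>g\<in>carrier G. G1.E g u = u \<longrightarrow> G2.shift (bd u) g = l * G1.shift u g)"

text \<open>One element with nonzero translation length determines the scale, and conjugation carries
it from one end to all others. If all translation lengths vanish, any scale will do.\<close>

lemma compatible_scale_exists: "\<exists>l>0. compatible l"
proof (cases "\<exists>u\<in>ends. \<exists>g\<in>carrier G. G1.E g u = u \<and> G1.shift u g \<noteq> 0")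
  case False
  have "compatible 1" unfolding compatible_def
  proof (intro ballI impI)
    fix u g assume *: "u \<in> ends" "g \<in> carrier G" "G1.E g u = u"
    then have "G1.shift u g = 0" using False by blast
    then show "G2.shift (bd u) g = 1 * G1.shift u g" using shift_bounds(1)[OF *(2,1,3)] by simp
  qed
  then show ?thesis using zero_less_one by blast
next
  case True
  then obtain u0 h where h: "u0 \<in> ends" "h \<in> carrier G" "G1.E h u0 = u0" "G1.shift u0 h \<noteq> 0" by blast
  have "\<exists>g\<in>carrier G. G1.E g u0 = u0 \<and> 0 < G1.shift u0 g"
  proof (cases "0 < G1.shift u0 h")
    case False
    then have "0 < G1.shift u0 (inv h)" using G1.shift_inv h by simp
    then show ?thesis using h G1.E_inv_eq G1.inv_closed by blast
  qed (use h in blast)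
  then obtain g where g: "g \<in> carrier G" "G1.E g u0 = u0" "0 < G1.shift u0 g" by blast
  define l where "l = G2.shift (bd u0) g / G1.shift u0 g"
  have "0 < l" using shift_pos[OF g(1) h(1) g(2,3)] g(3) by (simp add: l_def)
  moreover have "compatible l" unfolding compatible_def
  proof (intro ballI impI)
    fix u k assume k: "u \<in> ends" "k \<in> carrier G" "G1.E k u = u"
    obtain c where c: "c \<in> carrier G" "G1.E c u = u0" using transitive k(1) h(1) by blast
    let ?k = "c \<otimes> k \<otimes> inv c"
    have e: "G1.E ?k u0 = u0" "G1.shift u0 ?k = G1.shift u k"
      using G1.shift_conj[OF c(1) k(2,1,3)] c by simp_all
    have "G2.E c (bd u) = bd u0" using equivariant[OF c(1) k(1)] c by simp
    then have "G2.shift (bd u0) ?k = G2.shift (bd u) k"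
      using G2.shift_conj(1)[OF c(1) k(2) bd_ends[OF k(1)] bd_fixed[OF k(2,1,3)]] by simp
    then show "G2.shift (bd u) k = l * G1.shift u k"
      using shift_proportional[OF g(1) _ h(1) g(2) e(1)] g(3) e c k by (simp add: l_def)
  qed
  ultimately show ?thesis by blast
qed

definition swaps :: "'g \<Rightarrow> 'a set set \<Rightarrow> 'a set set \<Rightarrow> bool" where
  "swaps s u v \<longleftrightarrow> s \<in> carrier G \<and> G1.E s u = v \<and> G1.E s v = u"

lemma swaps_exists: "triple u v w \<Longrightarrow> \<exists>s. swaps s u v"
  using transitive_pairs[of u v v u] unfolding triple_def swaps_def by metis

lemma swaps2: "swaps s u v \<Longrightarrow> u \<in> ends \<Longrightarrow> v \<in> ends \<Longrightarrow> G2.E s (bd u) = bd v \<and> G2.E s (bd v) = bd u"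
  using equivariant[of s] unfolding swaps_def by metis

text \<open>The position of the image center relative to the fixed point of the reflection s, minus l times the
corresponding position in the first tree (both doubled).\<close>

definition defect :: "real \<Rightarrow> 'g \<Rightarrow> 'a set set \<Rightarrow> 'a set set \<Rightarrow> 'a set set \<Rightarrow> real" where
  "defect l s u v w = bus (bd u) (center' u v w) (\<phi>2 s (center' u v w)) - l * bus u (center u v w) (\<phi>1 s (center u v w))"

lemma defect_reverse:
  assumes t: "triple u v w" and s: "swaps s u v"
  shows "defect l s v u w = - defect l s u v w"
proof -
  note e = tripleD[OF t] and s' = s[unfolded swaps_def]
  have s2: "G2.E s (bd u) = bd v" "G2.E s (bd v) = bd u" using swaps2[OF s] e by auto
  show ?thesis
    using G1.swap_reverse[OF _ e(1,2) _ _ center_opp1(1)[OF t], of s] s'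
      G2.swap_reverse[OF _ bd_ends[OF e(1)] bd_ends[OF e(2)] s2 center_opp2(1)[OF t]]
      center_swap1(1)[OF t] center_swap2(1)[OF t] by (simp add: defect_def)
qed

text \<open>Conjugating s by an element g that fixes u and maps v to w gives a swap of u and w, which
differs from s' by an element d that fixes u. Both corrections are translation lengths, and compatibility
makes them cancel.\<close>

lemma defect_exchange:
  assumes l: "compatible l" and t: "triple u v w" and s: "swaps s u v" and s': "swaps s' u w"
  shows "defect l s' u w v = defect l s u v w"
proof -
  note e = tripleD[OF t] and e2 = bd_triple[OF t]
  obtain g where g: "g \<in> carrier G" "G1.E g u = u" "G1.E g v = w" using transitive_pairs e by blast
  have sc: "s \<in> carrier G" "G1.E s u = v" "G1.E s v = u" "s' \<in> carrier G" "G1.E s' u = w" "G1.E s' w = u"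
    using s s' by (auto simp: swaps_def)
  have s2: "G2.E s (bd u) = bd v" "G2.E s (bd v) = bd u" "G2.E s' (bd u) = bd w" "G2.E s' (bd w) = bd u"
    using swaps2[OF s] swaps2[OF s'] e by auto
  have g2: "G2.E g (bd u) = bd u" "G2.E g (bd v) = bd w" using equivariant[OF g(1)] e g by metis+
  define k where "k = g \<otimes> s \<otimes> inv g"
  have k: "k \<in> carrier G" using g sc by (simp add: k_def)
  define d where "d = s' \<otimes> inv k"
  have d: "d \<in> carrier G" using k sc by (simp add: d_def)
  let ?x = "center u v w" and ?y = "center' u v w"
  have "bus u ?x (\<phi>1 k ?x) = 2 * G1.shift u g + bus u ?x (\<phi>1 s ?x)"
    and k1: "G1.E k u = w" "G1.E k w = u"
    using G1.swap_conj[OF sc(1) g(1) e(1,2) sc(2,3) g(2,3) center_opp1(1,3)[OF t]] by (simp_all add: k_def)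
  moreover have "bus u ?x (\<phi>1 s' ?x) = bus u ?x (\<phi>1 k ?x) + G1.shift u d" and d1: "G1.E d u = u"
    using G1.swap_other[OF k sc(4) e(1,3) k1 sc(5,6)] by (simp_all add: d_def)
  ultimately have one: "bus u ?x (\<phi>1 s' ?x) = 2 * G1.shift u g + G1.shift u d + bus u ?x (\<phi>1 s ?x)" by simp
  have "bus (bd u) ?y (\<phi>2 k ?y) = 2 * G2.shift (bd u) g + bus (bd u) ?y (\<phi>2 s ?y)"
    and k2: "G2.E k (bd u) = bd w" "G2.E k (bd w) = bd u"
    using G2.swap_conj[OF sc(1) g(1) e2(1,2) s2(1,2) g2 center_opp2(1,3)[OF t]] by (simp_all add: k_def)
  moreover have "bus (bd u) ?y (\<phi>2 s' ?y) = bus (bd u) ?y (\<phi>2 k ?y) + G2.shift (bd u) d"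
    using G2.swap_other[OF k sc(4) e2(1,3) k2 s2(3,4)] by (simp_all add: d_def)
  ultimately have two: "bus (bd u) ?y (\<phi>2 s' ?y) = 2 * G2.shift (bd u) g + G2.shift (bd u) d + bus (bd u) ?y (\<phi>2 s ?y)"
    by simp
  have "G2.shift (bd u) g = l * G1.shift u g" "G2.shift (bd u) d = l * G1.shift u d"
    using l e(1) g d d1 by (auto simp: compatible_def)
  then show ?thesis unfolding defect_def using one two center_swap1(2)[OF t] center_swap2(2)[OF t]
    by (simp add: algebra_simps)
qed

text \<open>The sign of \<open>defect_reverse\<close> and the invariance of \<open>defect_exchange\<close> contradict each other
unless the defect is zero: six alternating transpositions of the three ends lead back to the original order.\<close>

lemma defect_zero:
  assumes l: "compatible l" and t: "triple u v w" and s: "swaps s u v"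
  shows "defect l s u v w = 0"
proof -
  note t' = triple_swap[OF t]
  obtain p where p: "swaps p u w" using swaps_exists[OF t'(2)] by blast
  obtain q where q: "swaps q v w" using swaps_exists triple_swap(2)[OF t'(1)] by blast
  have sym: "swaps s v u" "swaps p w u" "swaps q w v" using s p q by (auto simp: swaps_def)
  have tw: "triple w u v" "triple w v u" "triple v w u" using t by (auto simp: triple_def)
  have "defect l s u v w = defect l p u w v" using defect_exchange[OF l t s p] by simp
  also have "\<dots> = - defect l p w u v" using defect_reverse[OF t'(2) p] by simp
  also have "\<dots> = - defect l q w v u" using defect_exchange[OF l tw(1) sym(2,3)] by simp
  also have "\<dots> = defect l q v w u" using defect_reverse[OF tw(3) q] by simp
  also have "\<dots> = defect l s v u w" using defect_exchange[OF l t'(1) sym(1) q] by simp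
  also have "\<dots> = - defect l s u v w" by (rule defect_reverse[OF t s])
  finally show ?thesis by simp
qed

lemma bus_centers:
  assumes l: "compatible l" and t: "triple u v w" and t': "triple u v w'"
  shows "bus (bd u) (center' u v w) (center' u v w') = l * bus u (center u v w) (center u v w')"
proof -
  note e = tripleD[OF t]
  obtain s where s: "swaps s u v" using swaps_exists[OF t] by blast
  have sc: "s \<in> carrier G" "G1.E s u = v" "G1.E s v = u" using s by (auto simp: swaps_def)
  have s2: "G2.E s (bd u) = bd v" "G2.E s (bd v) = bd u" using swaps2[OF s] e by auto
  have "2 * bus (bd u) (center' u v w) (center' u v w') = l * (2 * bus u (center u v w) (center u v w'))"
    using G1.swap_difference[OF sc(1) e(1,2) sc(2,3) center_opp1(1)[OF t] center_opp1(1)[OF t']]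
      G2.swap_difference[OF sc(1) bd_ends[OF e(1)] bd_ends[OF e(2)] s2 center_opp2(1)[OF t] center_opp2(1)[OF t']]
      defect_zero[OF l t s] defect_zero[OF l t' s] by (simp add: defect_def algebra_simps)
  then show ?thesis by simp
qed

end

section \<open>The equivariant isometry\<close>

locale equivariant_quasi_isometry_scaled =
  equivariant_quasi_isometry +
  fixes l :: real
  assumes l_pos: "0 < l" and l_compatible: "compatible l"
begin

text \<open>The point y has the same position on the image of the apartment \<open>(u,v)\<close> as x has on \<open>(u,v)\<close>, up to the scale l. By
\<open>bus_centers\<close> one center suffices to test this.\<close>

definition corresponds :: "'a set set \<Rightarrow> 'a set set \<Rightarrow> 'a \<Rightarrow> 'b \<Rightarrow> bool" where
  "corresponds u v x y \<longleftrightarrow> opp y (bd u) (bd v) \<and>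
     (\<forall>w. triple u v w \<longrightarrow> bus (bd u) (center' u v w) y = l * bus u (center u v w) x)"

lemma correspondsI:
  assumes t: "triple u v w" and y: "opp y (bd u) (bd v)"
    and b: "bus (bd u) (center' u v w) y = l * bus u (center u v w) x"
  shows "corresponds u v x y"
  unfolding corresponds_def
proof (intro conjI allI impI y)
  note e = tripleD[OF t]
  fix w' assume t': "triple u v w'"
  show "bus (bd u) (center' u v w') y = l * bus u (center u v w') x"
    using bus_centers[OF l_compatible t' t] b
      B.bus_add[OF bd_ends[OF e(1)], of "center' u v w'" "center' u v w" y]
      A.bus_add[OF e(1), of "center u v w'" "center u v w" x]
    by (simp flip: distrib_left)
qed

lemma corresponds_unique:
  assumes e: "u \<in> ends" "v \<in> ends" "u \<noteq> v" and y: "corresponds u v x y" "corresponds u v x y'"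
  shows "y = y'"
proof -
  obtain w where t: "triple u v w" using third_end e by blast
  have "bus (bd u) (center' u v w) y = bus (bd u) (center' u v w) y'"
    using y t unfolding corresponds_def by simp
  then have "bus (bd u) y y' = 0"
    using B.bus_add[OF bd_ends[OF e(1)], of "center' u v w" y y'] by simp
  then show ?thesis using B.opp_eq_of_bus[OF bd_ends[OF e(1)] bd_ends[OF e(2)]] y unfolding corresponds_def by blast
qed

lemma corresponds_exists:
  assumes e: "u \<in> ends" "v \<in> ends" "u \<noteq> v"
  shows "\<exists>y. corresponds u v x y"
proof -
  obtain w where t: "triple u v w" using third_end e by blast
  obtain y where "opp y (bd u) (bd v) \<and> bus (bd u) (center' u v w) y = l * bus u (center u v w) x"
    using B.opp_at_bus[OF bd_ends[OF e(1)] bd_ends[OF e(2)] center_opp2(1)[OF t]] by blast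
  then show ?thesis using correspondsI[OF t] by blast
qed

lemma corresponds_reverse:
  assumes e: "u \<in> ends" "v \<in> ends" "u \<noteq> v" and x: "opp x u v" and y: "corresponds u v x y"
  shows "corresponds v u x y"
proof -
  obtain w where t: "triple u v w" using third_end e by blast
  have oy: "opp y (bd u) (bd v)" using y by (simp add: corresponds_def)
  have "bus (bd u) (center' u v w) y = l * bus u (center u v w) x" using y t by (simp add: corresponds_def)
  then have "bus (bd v) (center' v u w) y = l * bus v (center v u w) x"
    using A.opp_bus(1)[OF e(1,2) center_opp1(1)[OF t] x] center_swap1(1)[OF t] center_swap2(1)[OF t]
      B.opp_bus(1)[OF bd_ends[OF e(1)] bd_ends[OF e(2)] center_opp2(1)[OF t] oy] by simp
  then show ?thesis using correspondsI[OF triple_swap(1)[OF t]] oy B.opp_sym by blast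
qed

text \<open>Both x and y lie on the ray from the center to u and to \<open>bd u\<close>, respectively, which the two apartments share.\<close>

lemma corresponds_exchange:
  assumes e: "u \<in> ends" "v \<in> ends" "w \<in> ends" and x: "opp x u v" "opp x u w" and y: "corresponds u v x y"
  shows "corresponds u w x y"
proof (cases "v = w")
  case False
  then have t: "triple u v w" using e A.opp_neq x by (auto simp: triple_def)
  have oy: "opp y (bd u) (bd v)" and b: "bus (bd u) (center' u v w) y = l * bus u (center u v w) x"
    using y t by (auto simp: corresponds_def)
  have "0 \<le> bus u (center u v w) x"
    using A.opp_iff_bus_center[OF tripleD[OF t] x(1)] x(2) by simp
  then have "0 \<le> bus (bd u) (center' u v w) y" using b l_pos by simp
  moreover have "bd u \<noteq> bd v" "bd v \<noteq> bd w" "bd u \<noteq> bd w" using bd_neq t by (auto simp: triple_def)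
  ultimately have "opp y (bd u) (bd w)"
    using B.opp_iff_bus_center[OF bd_ends[OF e(1)] bd_ends[OF e(2)] bd_ends[OF e(3)]] oy by blast
  then show ?thesis
    using correspondsI[OF triple_swap(2)[OF t]] b center_swap1(2)[OF t] center_swap2(2)[OF t] by simp
qed (use y in simp)

text \<open>Two apartments through x are connected by a chain of apartments through x, each sharing
an end with the next.\<close>

lemma corresponds_transfer:
  assumes e: "u \<in> ends" "v \<in> ends" "u' \<in> ends" "v' \<in> ends"
    and x: "opp x u v" "opp x u' v'" and y: "corresponds u v x y"
  shows "corresponds u' v' x y"
proof -
  have rev: "corresponds q p x y" if "p \<in> ends" "q \<in> ends" "opp x p q" "corresponds p q x y" for p q
    using corresponds_reverse[OF that(1,2) A.opp_neq[OF that(1,3)] that(3,4)] .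
  have sym: "opp x q p" if "opp x p q" for p q using that A.opp_sym by blast
  from A.opp_split[OF x(2), of u] show ?thesis
  proof
    assume o: "opp x u' u"
    have "corresponds u u' x y" by (rule corresponds_exchange[OF e(1,2,3) x(1) sym[OF o] y])
    then have "corresponds u' u x y" by (rule rev[OF e(1,3) sym[OF o]])
    then show ?thesis by (rule corresponds_exchange[OF e(3,1,4) o x(2)])
  next
    assume o: "opp x u v'"
    have "corresponds u v' x y" by (rule corresponds_exchange[OF e(1,2,4) x(1) o y])
    then have "corresponds v' u x y" by (rule rev[OF e(1,4) o])
    then have "corresponds v' u' x y" by (rule corresponds_exchange[OF e(4,1,3) sym[OF o] sym[OF x(2)]])
    then show ?thesis by (rule rev[OF e(4,3) sym[OF x(2)]])
  qed
qed

definition extension :: "'a \<Rightarrow> 'b" where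
  "extension x = (THE y. \<forall>u\<in>ends. \<forall>v\<in>ends. opp x u v \<longrightarrow> corresponds u v x y)"

lemma extension_eqI:
  assumes e: "u \<in> ends" "v \<in> ends" and x: "opp x u v" and y: "corresponds u v x y"
  shows "extension x = y"
  unfolding extension_def
proof (rule the_equality)
  show "\<forall>u\<in>ends. \<forall>v\<in>ends. opp x u v \<longrightarrow> corresponds u v x y"
    using corresponds_transfer[OF e _ _ x _ y] by blast
  show "y' = y" if "\<forall>u\<in>ends. \<forall>v\<in>ends. opp x u v \<longrightarrow> corresponds u v x y'" for y'
    using corresponds_unique[OF e A.opp_neq[OF e(1) x]] that e x y by blast
qed

lemma extension_corresponds:
  assumes e: "u \<in> ends" "v \<in> ends" and x: "opp x u v"
  shows "corresponds u v x (extension x)"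
  using corresponds_exists[OF e A.opp_neq[OF e(1) x]] extension_eqI[OF e x] by metis

lemma bus_extension:
  assumes e: "u \<in> ends" "v \<in> ends" and x: "opp x u v" "opp x' u v"
  shows "bus (bd u) (extension x) (extension x') = l * bus u x x'"
proof -
  obtain w where t: "triple u v w" using third_end e A.opp_neq[OF e(1) x(1)] by blast
  have "bus (bd u) (center' u v w) (extension x) = l * bus u (center u v w) x"
    "bus (bd u) (center' u v w) (extension x') = l * bus u (center u v w) x'"
    using extension_corresponds[OF e] x t by (auto simp: corresponds_def)
  moreover have "l * bus u (center u v w) x' = l * bus u (center u v w) x + l * bus u x x'"
    using A.bus_add[OF e(1), of "center u v w" x x'] by (simp flip: distrib_left)
  ultimately show ?thesis
    using B.bus_add[OF bd_ends[OF e(1)], of "center' u v w" "extension x" "extension x'"] by linarith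
qed

lemma opp_extension:
  "u \<in> ends \<Longrightarrow> v \<in> ends \<Longrightarrow> opp x u v \<Longrightarrow> opp (extension x) (bd u) (bd v)"
  using extension_corresponds by (simp add: corresponds_def)

lemma dist_extension: "dist (extension x) (extension x') = l * dist x x'"
proof -
  obtain u v where e: "u \<in> ends" "v \<in> ends" and x: "opp x u v" "opp x' u v"
    using A.common_apartment by blast
  have "dist (extension x) (extension x') = \<bar>bus (bd u) (extension x) (extension x')\<bar>"
    using B.opp_bus(2)[OF bd_ends[OF e(1)] bd_ends[OF e(2)]] opp_extension e x by simp
  also have "\<dots> = l * \<bar>bus u x x'\<bar>" using bus_extension[OF e x] l_pos by (simp add: abs_mult)
  also have "\<dots> = l * dist x x'" using A.opp_bus(2)[OF e x] by simp
  finally show ?thesis .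
qed

lemma surj_extension: "surj extension"
  unfolding surj_def
proof
  fix y :: 'b
  obtain u' v' where e': "u' \<in> ends" "v' \<in> ends" "opp y u' v'" using B.common_apartment[of y y] by blast
  then obtain u v where e: "u \<in> ends" "v \<in> ends" and uv: "u' = bd u" "v' = bd v" using bd_surj by blast
  have ne: "u \<noteq> v" using B.opp_neq[OF e'(1,3)] uv by blast
  obtain w where t: "triple u v w" using third_end e ne by blast
  obtain x where x: "opp x u v" "bus u (center u v w) x = bus (bd u) (center' u v w) y / l"
    using A.opp_at_bus[OF e center_opp1(1)[OF t]] by blast
  have "corresponds u v x y" using correspondsI[OF t] e'(3) x(2) l_pos uv by simp
  then show "\<exists>x. y = extension x" using extension_eqI[OF e x(1)] by blast
qed

lemma extension_equivariant:
  assumes g: "g \<in> carrier G"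
  shows "extension (\<phi>1 g x) = \<phi>2 g (extension x)"
proof -
  obtain u v where e: "u \<in> ends" "v \<in> ends" and x: "opp x u v" using A.common_apartment by blast
  have ne: "u \<noteq> v" by (rule A.opp_neq[OF e(1) x])
  obtain w where t: "triple u v w" using third_end e ne by blast
  let ?u = "G1.E g u" and ?v = "G1.E g v" and ?w = "G1.E g w"
  have c: "corresponds u v x (extension x)" by (rule extension_corresponds[OF e x])
  have "bus (bd ?u) (center' ?u ?v ?w) (\<phi>2 g (extension x)) = bus (bd u) (center' u v w) (extension x)"
    using center_act2[OF g t] equivariant[OF g e(1)] G2.bus_act[OF g bd_ends[OF e(1)]] by simp
  also have "\<dots> = l * bus u (center u v w) x" using c t by (simp add: corresponds_def)
  also have "\<dots> = l * bus ?u (center ?u ?v ?w) (\<phi>1 g x)"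
    using center_act1[OF g t] G1.bus_act[OF g e(1)] by simp
  finally have b: "bus (bd ?u) (center' ?u ?v ?w) (\<phi>2 g (extension x)) = l * bus ?u (center ?u ?v ?w) (\<phi>1 g x)" .
  have "opp (\<phi>2 g (extension x)) (bd ?u) (bd ?v)"
    using opp_extension[OF e x] G2.opp_act[OF g] equivariant[OF g] bd_ends e by simp
  then have "corresponds ?u ?v (\<phi>1 g x) (\<phi>2 g (extension x))" using correspondsI[OF triple_act[OF g t]] b by blast
  moreover have "opp (\<phi>1 g x) ?u ?v" using G1.opp_act[OF g e] x by simp
  ultimately show ?thesis using extension_eqI G1.E_in_ends[OF g] e by blast
qed

lemma extension_similarity: "similarity extension l"
  by unfold_locales (rule l_pos dist_extension surj_extension)+

text \<open>On the apartment \<open>(u,v)\<close>, the extension preserves the Busemann coordinate up to scale, so it maps the ray to u to the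
ray to \<open>bd u\<close>.\<close>

lemma extension_ends:
  assumes u: "u \<in> ends"
  shows "end_image extension u = bd u"
proof -
  interpret S: similarity extension l by (rule extension_similarity)
  obtain v w where t: "triple u v w" using other_ends[OF u] by blast
  note e = tripleD[OF t]
  let ?x = "center u v w"
  note x = center_opp1(1)[OF t]
  have "toward (extension ?x) (end_image extension u) s = toward (extension ?x) (bd u) s" if s: "0 \<le> s" for s
  proof -
    have s': "0 \<le> s / l" "l * (s / l) = s" using s l_pos by simp_all
    let ?y = "toward ?x u (s / l)"
    have y: "opp ?y u v" by (rule A.opp_toward[OF e(1,2) x s'(1)])
    have b: "bus (bd u) (extension ?x) (extension ?y) = s"
      using bus_extension[OF e(1,2) x y] A.bus_toward[OF e(1) s'(1), of ?x] s'(2) by simp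
    have "extension ?y = toward (extension ?x) (bd u) s"
      using B.opp_toward_of_bus[OF bd_ends[OF e(1)] bd_ends[OF e(2)] opp_extension[OF e(1,2) x] opp_extension[OF e(1,2) y]]
        b s by simp
    then show ?thesis using S.toward_image[OF e(1) s'(1), of ?x] s'(2) by simp
  qed
  then have "tail_eq (toward (extension ?x) (end_image extension u)) (toward (extension ?x) (bd u))"
    by (intro tail_eq_cong[of 0]) auto
  then show ?thesis
    using B.end_of_tail_eq_toward[OF B.toward_ray[OF S.end_image_in_ends[OF u]] bd_ends[OF u]]
      B.end_of_toward[OF S.end_image_in_ends[OF u]] by metis
qed

lemma extension_center: "triple u v w \<Longrightarrow> extension (center u v w) = center' u v w"
proof -
  assume t: "triple u v w"
  note e = tripleD[OF t]
  have "bus (bd u) (center' u v w) (extension (center u v w)) = 0"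
    using extension_corresponds[OF e(1,2) center_opp1(1)[OF t]] t e by (simp add: corresponds_def)
  then show ?thesis
    using B.opp_eq_of_bus[OF bd_ends[OF e(1)] bd_ends[OF e(2)] center_opp2(1)[OF t] opp_extension[OF e(1,2) center_opp1(1)[OF t]]]
    by simp
qed

lemma similarity_center:
  assumes h: "similarity h k" and he: "\<And>u. u \<in> ends \<Longrightarrow> end_image h u = bd u" and t: "triple u v w"
  shows "h (center u v w) = center' u v w"
proof -
  interpret S: similarity h k by (rule h)
  note e = tripleD[OF t]
  have "opp (h (center u v w)) (bd u) (bd v)" "opp (h (center u v w)) (bd v) (bd w)" "opp (h (center u v w)) (bd u) (bd w)"
    using S.opp_image center_opp1[OF t] he e by metis+
  then show ?thesis using B.center_eqI[OF bd_ends[OF e(1)] bd_ends[OF e(2)] bd_ends[OF e(3)]] by metis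
qed

lemma branch_point_center:
  assumes z: "branch_point (z::'a)" and e: "u \<in> ends" "v \<in> ends" and x: "opp z u v"
  shows "\<exists>w. triple u v w \<and> z = center u v w"
proof -
  obtain a b c where abc: "a \<in> ends" "b \<in> ends" "c \<in> ends" "opp z a b" "opp z b c" "opp z a c"
    using A.branch_point_is_center[OF z] by blast
  obtain w where w: "w \<in> {a, b, c}" "opp z u w" "opp z v w" using A.center_third_end[OF abc(4-6)] by blast
  have we: "w \<in> ends" using w(1) abc by blast
  have "triple u v w" using A.opp_neq e x w we by (auto simp: triple_def)
  moreover have "center u v w = z" using A.center_eqI[OF e we x w(3,2)] .
  ultimately show ?thesis by metis
qed

text \<open>Two branch points on one apartment fix the scale, and one center on each apartment fixes the
position.\<close>

lemma similarity_unique: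
  assumes h: "similarity h k" and he: "\<And>u. u \<in> ends \<Longrightarrow> end_image h u = bd u"
    and z: "branch_point (z::'a)" "branch_point z'" "z \<noteq> z'"
  shows "h = extension"
proof
  interpret S: similarity h k by (rule h)
  obtain u v where e: "u \<in> ends" "v \<in> ends" and oz: "opp z u v" "opp z' u v"
    using A.common_apartment[of z z'] by blast
  obtain w where w: "triple u v w" "z = center u v w" using branch_point_center[OF z(1) e oz(1)] by blast
  obtain w' where w': "triple u v w'" "z' = center u v w'" using branch_point_center[OF z(2) e oz(2)] by blast
  have "h z = extension z" "h z' = extension z'"
    using similarity_center[OF h he] extension_center w w' by simp_all
  then have "k * dist z z' = l * dist z z'" using S.dist_h[of z z'] dist_extension[of z z'] by metis
  then have k: "k = l" using z(3) by simp
  fix x :: 'a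
  obtain p q where pq: "p \<in> ends" "q \<in> ends" "opp x p q" using A.common_apartment[of x x] by blast
  obtain r where t: "triple p q r" using third_end pq A.opp_neq by blast
  have "opp (h x) (bd p) (bd q)" using S.opp_image[OF pq(1,2), of x] pq he by simp
  moreover have "bus (bd p) (center' p q r) (h x) = l * bus p (center p q r) x"
    using S.bus_image[OF pq(1), of "center p q r" x] similarity_center[OF h he t] he pq k by simp
  ultimately have "corresponds p q x (h x)" by (rule correspondsI[OF t])
  then show "h x = extension x" using extension_eqI[OF pq] by simp
qed

text \<open>If all translation lengths vanished, every number would be a compatible scale. Comparing
the scales 0 and 1 in \<open>bus_centers\<close> would force the two branch points, both centers on a common
apartment, to coincide.\<close>

lemma some_shift_nonzero:
  assumes z: "branch_point (z::'a)" "branch_point z'" "z \<noteq> z'"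
  shows "\<exists>u\<in>ends. \<exists>g\<in>carrier G. G1.E g u = u \<and> 0 < G1.shift u g"
proof (rule ccontr)
  assume n: "\<not> ?thesis"
  have zero: "G1.shift u g = 0" if "u \<in> ends" "g \<in> carrier G" "G1.E g u = u" for u g
  proof -
    have "\<not> 0 < G1.shift u g" using n that by blast
    moreover have "\<not> 0 < G1.shift u (inv g)" using n that G1.E_inv_eq G1.inv_closed by blast
    ultimately show ?thesis using G1.shift_inv[OF that(2,1,3)] by simp
  qed
  have comp: "compatible r" for r unfolding compatible_def
  proof (intro ballI impI)
    fix u g assume *: "u \<in> ends" "g \<in> carrier G" "G1.E g u = u"
    then show "G2.shift (bd u) g = r * G1.shift u g" using zero[OF *] shift_bounds(1)[OF *(2,1,3)] by simp
  qed
  obtain u v where e: "u \<in> ends" "v \<in> ends" and oz: "opp z u v" "opp z' u v"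
    using A.common_apartment[of z z'] by blast
  obtain w where w: "triple u v w" "z = center u v w" using branch_point_center[OF z(1) e oz(1)] by blast
  obtain w' where w': "triple u v w'" "z' = center u v w'" using branch_point_center[OF z(2) e oz(2)] by blast
  have "bus u z z' = 0"
    using bus_centers[OF comp[of 0] w(1) w'(1)] bus_centers[OF comp[of 1] w(1) w'(1)] w w' by simp
  then show False using A.opp_eq_of_bus[OF e oz] z(3) by blast
qed

text \<open>Powers of an element g with positive translation length push a center along the ray to u with bounded
gaps. A swap of u and v takes care of the other half of the apartment \<open>(u,v)\<close>, and 2-transitivity of all other
apartments.\<close>

lemma centers_cobounded:
  assumes z: "branch_point (z::'a)" "branch_point z'" "z \<noteq> z'"
  shows "\<exists>D. \<forall>x. \<exists>u v w. triple u v w \<and> dist x (center u v w) \<le> D"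
proof -
  obtain u g where g: "u \<in> ends" "g \<in> carrier G" "G1.E g u = u" "0 < G1.shift u g"
    using some_shift_nonzero[OF z] by blast
  obtain v w where t: "triple u v w" using other_ends[OF g(1)] by blast
  note e = tripleD[OF t]
  define c where "c = center u v w"
  have oc: "opp c u v" using center_opp1(1)[OF t] by (simp add: c_def)
  define near where "near x D \<longleftrightarrow> (\<exists>u v w. triple u v w \<and> dist x (center u v w) \<le> D)" for x D
  have near_act: "near x D" if k: "k \<in> carrier G" and n: "near (\<phi>1 k x) D" for k x D
  proof -
    obtain a b d where abd: "triple a b d" "dist (\<phi>1 k x) (center a b d) \<le> D" using n by (auto simp: near_def)
    have ik: "inv k \<in> carrier G" using k by simp
    have "dist x (\<phi>1 (inv k) (center a b d)) \<le> D"
      using G1.dist_act[OF ik, of "\<phi>1 k x" "center a b d"] abd(2) k by simp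
    then show ?thesis unfolding near_def using triple_act[OF ik abd(1)] center_act1[OF ik abd(1)] by metis
  qed
  obtain b where b: "0 \<le> b"
    and orbit: "\<And>n::nat. \<phi>1 (g [^] n) (toward c u b) = toward c u (b + real n * G1.shift u g)"
    using G1.orbit_along_ray[OF g(2,1,3,4)] by blast
  define D where "D = 2 * b + G1.shift u g"
  have ray: "near (toward c u s) D" if s: "0 \<le> s" for s
  proof -
    \<comment> \<open>The number of whole steps of g that fit into the distance s.\<close>
    define n where "n = nat \<lfloor>s / G1.shift u g\<rfloor>"
    have n0: "0 \<le> \<lfloor>s / G1.shift u g\<rfloor>" using s g(4) by simp
    have "real n \<le> s / G1.shift u g" "s / G1.shift u g < real n + 1"
      using n0 unfolding n_def by linarith+
    then have n: "real n * G1.shift u g \<le> s" "s \<le> real n * G1.shift u g + G1.shift u g"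
      using g(4) by (simp_all add: field_simps)
    let ?h = "g [^] n"
    have h: "?h \<in> carrier G" using g(2) by simp
    have "dist (toward c u s) (\<phi>1 ?h (toward c u b)) \<le> b + G1.shift u g"
      using orbit[of n] A.dist_toward_toward[OF g(1) s, of "b + real n * G1.shift u g" c] b n g(4) by simp
    moreover have "dist (\<phi>1 ?h (toward c u b)) (\<phi>1 ?h c) = b"
      using G1.dist_act[OF h, of "toward c u b" c] A.dist_toward[OF g(1) b, of c] by (simp add: dist_commute)
    ultimately have "dist (toward c u s) (\<phi>1 ?h c) \<le> D"
      using dist_triangle[of "toward c u s" "\<phi>1 ?h c" "\<phi>1 ?h (toward c u b)"] by (simp add: D_def)
    then show ?thesis unfolding near_def c_def using triple_act[OF h t] center_act1[OF h t] by metis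
  qed
  obtain s where s: "swaps s u v" using swaps_exists[OF t] by blast
  then have sc: "s \<in> carrier G" "G1.E s u = v" "G1.E s v = u" by (auto simp: swaps_def)
  obtain a where a: "0 \<le> a" "\<And>r. 0 \<le> r \<Longrightarrow> \<exists>r'\<ge>0. dist (toward (\<phi>1 s c) u r) (toward c u r') \<le> a"
    using A.rebase_ray[OF g(1), of "\<phi>1 s c" c] by blast
  have weaken: "near x (a + D)" if "near y D" "dist x y \<le> a" for x y
  proof -
    obtain p q r where "triple p q r" "dist y (center p q r) \<le> D" using \<open>near y D\<close> by (auto simp: near_def)
    then show ?thesis unfolding near_def
      using that(2) dist_triangle[of x "center p q r" y] by (intro exI[of _ p] exI[of _ q] exI[of _ r]) auto
  qed
  have "near x (a + D)" for x
  proof -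
    obtain p q where pq: "p \<in> ends" "q \<in> ends" "opp x p q" using A.common_apartment[of x x] by blast
    obtain k where k: "k \<in> carrier G" "G1.E k p = u" "G1.E k q = v"
      using transitive_pairs[OF pq(1,2) e(1,2) A.opp_neq[OF pq(1,3)] e(4)] by blast
    let ?x = "\<phi>1 k x"
    have "opp ?x u v" using G1.opp_act[OF k(1) pq(1,2), of x] pq(3) k by simp
    then consider "?x = toward c u (dist c ?x)" | "?x = toward c v (dist c ?x)"
      using A.opp_points_cases[OF e(1,2) oc] by blast
    then have "near ?x (a + D)"
    proof cases
      case 1
      then have "near ?x D" using ray[OF zero_le_dist, of c ?x] by simp
      then show ?thesis using weaken[of ?x ?x] a(1) by simp
    next
      case 2
      let ?r = "dist c ?x"
      have "\<phi>1 s ?x = toward (\<phi>1 s c) u ?r"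
        using G1.toward_act[OF sc(1) e(2) zero_le_dist, of c c ?x] 2 sc(3) by simp
      then obtain r' where "0 \<le> r'" "dist (\<phi>1 s ?x) (toward c u r') \<le> a" using a(2)[OF zero_le_dist, of c ?x] by auto
      then have "near (\<phi>1 s ?x) (a + D)" using weaken ray by blast
      then show ?thesis by (rule near_act[OF sc(1)])
    qed
    then show ?thesis by (rule near_act[OF k(1)])
  qed
  then show ?thesis unfolding near_def by blast
qed

lemma extension_finite_distance:
  assumes z: "branch_point (z::'a)" "branch_point z'" "z \<noteq> z'"
  shows "finite_distance extension f"
proof -
  obtain D where D: "\<And>x. \<exists>u v w. triple u v w \<and> dist x (center u v w) \<le> D"
    using centers_cobounded[OF z] by blast
  have "dist (extension x) (f x) \<le> l * D + near_const + (L * D + C)" for x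
  proof -
    obtain u v w where t: "triple u v w" and d: "dist x (center u v w) \<le> D" using D by blast
    let ?c = "center u v w"
    have "dist (extension x) (extension ?c) \<le> l * D" using d l_pos by (simp add: dist_extension)
    moreover have "dist (extension ?c) (f ?c) \<le> near_const"
      using center_image_near[OF tripleD[OF t]] extension_center[OF t] by (simp add: dist_commute)
    moreover have "L * dist x ?c \<le> L * D" using d L by simp
    then have "dist (f ?c) (f x) \<le> L * D + C"
      using up[of ?c x] unfolding dist_commute[of ?c x] by linarith
    ultimately show ?thesis
      using dist_triangle[of "extension x" "f x" "extension ?c"] dist_triangle[of "extension ?c" "f x" "f ?c"] by linarith
  qed
  then show ?thesis unfolding finite_distance_def bounded_iff by (intro exI[of _ "l * D + near_const + (L * D + C)"]) auto
qed

end

theorem theoremI: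
  fixes G :: "('g, 'm) monoid_scheme"
    and \<phi>1 :: "'g \<Rightarrow> 'a::complete_space \<Rightarrow> 'a"
    and \<phi>2 :: "'g \<Rightarrow> 'b::complete_space \<Rightarrow> 'b"
    and f :: "'a \<Rightarrow> 'b"
  assumes "leafless_tree TYPE('a)" and "leafless_tree TYPE('b)"
    and "isometric_action G \<phi>1" and "isometric_action G \<phi>2"
    and "coarse_equivalence f"
    and "\<exists>u\<in>ends. \<exists>v\<in>ends. \<exists>w\<in>(ends :: 'a set set set). u \<noteq> v \<and> v \<noteq> w \<and> w \<noteq> u"
    and "equivariant_on ends G (end_action \<phi>1) (end_action \<phi>2) (induced_map f)"
    and "two_transitive_on ends G (end_action \<phi>1)"
  shows "\<exists>c>0. \<exists>fbar.
           isometry_wrt dist (\<lambda>x y. c * dist x y) fbar \<and>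
           equivariant_on UNIV G \<phi>1 \<phi>2 fbar \<and>
           induced_map fbar = induced_map f \<and>
           ((\<exists>z z'::'a. branch_point z \<and> branch_point z' \<and> z \<noteq> z') \<longrightarrow>
              (\<forall>c'>0. \<forall>h. isometry_wrt dist (\<lambda>x y. c' * dist x y) h \<and>
                 equivariant_on UNIV G \<phi>1 \<phi>2 h \<and> induced_map h = induced_map f
                 \<longrightarrow> h = fbar) \<and>
              finite_distance fbar f)"
proof -
  obtain f' L C where qi: "quasi_isometry f f' L C"
    using coarse_equivalence_imp_quasi_isometry[OF assms(1,2,5)] by blast
  interpret Q: quasi_isometry f f' L C by (rule qi)
  have ind: "induced_map f = restrict (boundary_map f) ends" by (rule Q.induced_map_eq[OF assms(6)])
  have G: "group G"
    using assms(3) by (simp add: isometric_action_def group_action_def group_hom_def)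
  interpret G1: tree_action G \<phi>1
    using G assms(3) by (intro tree_action.intro Q.A.real_tree_axioms tree_action_axioms.intro)
  interpret G2: tree_action G \<phi>2
    using G assms(4) by (intro tree_action.intro Q.B.real_tree_axioms tree_action_axioms.intro)
  interpret EQ: equivariant_quasi_isometry f f' L C G \<phi>1 \<phi>2
  proof
    fix g and u :: "'a set set" assume g: "g \<in> carrier G" "u \<in> ends"
    then have "induced_map f (end_action \<phi>1 g u) = end_action \<phi>2 g (induced_map f u)"
      using assms(7) by (simp add: equivariant_on_def)
    then show "boundary_map f (end_action \<phi>1 g u) = end_action \<phi>2 g (boundary_map f u)"
      using g G1.E_in_ends[OF g] by (simp add: ind)
  qed (rule assms)+
  obtain l where l: "0 < l" "EQ.compatible l" using EQ.compatible_scale_exists by blast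
  interpret S: equivariant_quasi_isometry_scaled f f' L C G \<phi>1 \<phi>2 l
    by unfold_locales (rule l)+
  let ?fb = S.extension
  have "isometry_wrt dist (\<lambda>x y. (1 / l) * dist x y) ?fb"
    using l S.surj_extension by (simp add: isometry_wrt_def S.dist_extension)
  moreover have "equivariant_on UNIV G \<phi>1 \<phi>2 ?fb"
    by (simp add: equivariant_on_def S.extension_equivariant)
  moreover have "induced_map ?fb = induced_map f"
    using similarity_induced_map[OF assms(1,2) S.extension_similarity assms(6)] S.extension_ends
    by (simp add: ind restrict_def fun_eq_iff)
  moreover have "h = ?fb"
    if z: "branch_point z" "branch_point z'" "z \<noteq> z'"
      and h: "0 < c'" "isometry_wrt dist (\<lambda>x y. c' * dist x y) h" "induced_map h = induced_map f" for z z' :: 'a and c' h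
  proof -
    have sim: "similarity h (1 / c')"
    proof
      show "dist (h x) (h y) = 1 / c' * dist x y" for x y
        using h(1,2) unfolding isometry_wrt_def by (simp add: field_simps)
      show "surj h" using h(2) by (simp add: isometry_wrt_def)
    qed (use h(1) in simp)
    have "restrict (end_image h) ends = restrict (boundary_map f) ends"
      using similarity_induced_map[OF assms(1,2) sim assms(6)] h(3) ind by simp
    then have "end_image h u = boundary_map f u" if "u \<in> ends" for u
      using that by (metis restrict_apply')
    then show ?thesis using S.similarity_unique[OF sim _ z] by blast
  qed
  ultimately show ?thesis
    using l S.extension_finite_distance by (intro exI[of _ "1 / l"] conjI exI[of _ ?fb]) auto
qed

end
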